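(* Let $\mathcal K_h$ be a regular polygonal mesh of $\Omega$. There exist uniform constants $c$, depending only on the regularity parameters $\sigma_{\mathcal K}$ and $c_{\mathcal K}$, such that for every $z\in\mathcal N_h$ \[ \|v-Q_{\omega_z}v\|_{0,\omega_z}\le c\,h_{\omega_z}|v|_{1,\omega_z}\qquad\text{for } v\in H^1(\omega_z), \] and \[ \|v-Q_{\widetilde\omega_z}v\|_{0,\widetilde\omega_z}\le c\,h_{\widetilde\omega_z}|v|_{1,\widetilde\omega_z}\qquad\text{for } v\in H^1(\widetilde\omega_z), \] where $h_{\omega_z}$ and $h_{\widetilde\omega_z}$ denote the diameters of $\omega_z$ and $\widetilde\omega_z$, respectively.
   Context: $\Omega\subset\mathbb R^2$ is a connected, bounded, polygonal domain. $\|\cdot\|_{0,\omega}$ is the $L_2(\omega)$ norm and $|\cdot|_{1,\omega}$ the $H^1(\omega)$ semi-norm. $Q_\omega:L_2(\omega)\to\mathbb R$ is the $L_2(\omega)$-projection onto constants (mean value). **Mesh.** $\mathcal K_h$ is a decomposition of $\overline\Omega$ into non-overlapping star-shaped (possibly non-convex) polygonal elements $K$. The boundary of each element consists of nodes and straight edges; each edge $E=\overline{z_bz_e}$ lies between two nodes and its endpoints are the only nodes on $E$ (hanging nodes count as nodes of the elements on whose boundary they lie). $\mathcal N_h,\mathcal E_h$ are the sets of all nodes and edges; $\mathcal N(K),\mathcal E(K)$ those of $K$. $h_E$ is the length of $E$, $h_K$ the diameter of $K$. The mesh is *regular* with parameters $\sigma_{\mathcal K},c_{\mathcal K}$ if: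 (1) each $K$ is star-shaped with respect to a circle of radius $\rho_K$ and midpoint $z_K$ (chosen with maximal radius; if the position is not unique, $z_K$ is fixed once per element); (2) $h_K/\rho_K<\sigma_{\mathcal K}$ for all $K$; (3) $h_K\le c_{\mathcal K}h_E$ for all $K$ and all $E\in\mathcal E(K)$. It is assumed that $h_K<1$ for all $K$. **Auxiliary triangulation.** $\mathcal T_h(K)$ consists of the triangles $T_E$, $E=\overline{z_bz_e}\in\mathcal E(K)$, with vertices $z_b,z_e,z_K$; $\mathcal T_h(\Omega)$ is the union of all $\mathcal T_h(K)$. **Patches** (open sets): $\overline\omega_z=\bigcup_{K':z\in\mathcal N(K')}\overline{K'}$ and $\overline{\widetilde\omega}_z=\bigcup_{T\in\mathcal T_h(\Omega):z\in\overline T}\overline T$. *)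

theory Defs
  imports "HOL-Analysis.Analysis"
begin

section \<open>The spaces L2 and H1 on open sets\<close>

definition L2 :: "'a::euclidean_space set \<Rightarrow> ('a \<Rightarrow> 'b::euclidean_space) set" where
  "L2 S = {f. f \<in> borel_measurable (lebesgue_on S) \<and>
              integrable (lebesgue_on S) (\<lambda>x. (norm (f x))\<^sup>2)}"

definition L2_norm :: "'a::euclidean_space set \<Rightarrow> ('a \<Rightarrow> 'b::euclidean_space) \<Rightarrow> real" where
  "L2_norm S f = sqrt (LINT x|lebesgue_on S. (norm (f x))\<^sup>2)"

definition mean_value :: "'a::euclidean_space set \<Rightarrow> ('a \<Rightarrow> real) \<Rightarrow> real" where
  "mean_value S f = (LINT x|lebesgue_on S. f x) / measure lebesgue S"

definition partial_deriv :: "'a::euclidean_space \<Rightarrow> ('a \<Rightarrow> real) \<Rightarrow> 'a \<Rightarrow> real" where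
  "partial_deriv i f x = frechet_derivative f (at x) i"

primrec k_times_cont_diff :: "nat \<Rightarrow> ('a::euclidean_space \<Rightarrow> real) \<Rightarrow> bool" where
  "k_times_cont_diff 0 f \<longleftrightarrow> continuous_on UNIV f"
| "k_times_cont_diff (Suc k) f \<longleftrightarrow>
     (\<forall>x. f differentiable (at x)) \<and> (\<forall>i\<in>Basis. k_times_cont_diff k (partial_deriv i f))"

definition test_functions :: "'a::euclidean_space set \<Rightarrow> ('a \<Rightarrow> real) set" where
  "test_functions S = {\<phi>. (\<forall>k. k_times_cont_diff k \<phi>) \<and>
     compact (closure {x. \<phi> x \<noteq> 0}) \<and> closure {x. \<phi> x \<noteq> 0} \<subseteq> S}"

definition is_weak_gradient ::
    "'a::euclidean_space set \<Rightarrow> ('a \<Rightarrow> real) \<Rightarrow> ('a \<Rightarrow> 'a) \<Rightarrow> bool" where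
  "is_weak_gradient S v g \<longleftrightarrow>
     (\<forall>\<phi>\<in>test_functions S. \<forall>i\<in>Basis.
        (LINT x|lebesgue_on S. v x * partial_deriv i \<phi> x) =
        - (LINT x|lebesgue_on S. (g x \<bullet> i) * \<phi> x))"

definition H1 :: "'a::euclidean_space set \<Rightarrow> ('a \<Rightarrow> real) set" where
  "H1 S = {v. v \<in> L2 S \<and> (\<exists>g\<in>L2 S. is_weak_gradient S v g)}"

text \<open>The weak gradient is unique only up to null sets, so a representative is chosen;
  the seminorm below does not depend on the choice.\<close>

definition weak_gradient :: "'a::euclidean_space set \<Rightarrow> ('a \<Rightarrow> real) \<Rightarrow> 'a \<Rightarrow> 'a" where
  "weak_gradient S v = (SOME g. g \<in> L2 S \<and> is_weak_gradient S v g)"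

definition H1_seminorm :: "'a::euclidean_space set \<Rightarrow> ('a \<Rightarrow> real) \<Rightarrow> real" where
  "H1_seminorm S v = L2_norm S (weak_gradient S v)"


section \<open>Polygonal domains and elements\<close>

type_synonym point = "real ^ 2"

definition simple_closed_polygon :: "point set \<Rightarrow> bool" where
  "simple_closed_polygon J \<longleftrightarrow>
     (\<exists>g. simple_path g \<and> pathfinish g = pathstart g \<and> path_image g = J) \<and>
     (\<exists>P. finite P \<and> J = (\<Union>(a, b)\<in>P. closed_segment a b))"

text \<open>Holes are allowed. Disjointness of the boundary polygons together with connectedness
  places the domain locally on one side of its boundary; slits and points where the domain
  touches itself are excluded.\<close>

definition polygonal_domain :: "point set \<Rightarrow> bool" where
  "polygonal_domain \<Omega> \<longleftrightarrow> open \<Omega> \<and> connected \<Omega> \<and> bounded \<Omega> \<and> \<Omega> \<noteq> {} \<and>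
     (\<exists>F. finite F \<and> pairwise disjnt F \<and> (\<forall>J\<in>F. simple_closed_polygon J) \<and>
          frontier \<Omega> = \<Union>F)"

definition polygonal_element :: "point set \<Rightarrow> bool" where
  "polygonal_element K \<longleftrightarrow> (\<exists>J. simple_closed_polygon J \<and> K = J \<union> inside J)"

definition star_shaped_wrt_disc :: "point set \<Rightarrow> point \<Rightarrow> real \<Rightarrow> bool" where
  "star_shaped_wrt_disc K m r \<longleftrightarrow> 0 < r \<and>
     (\<forall>y\<in>cball m r. \<forall>x\<in>K. closed_segment y x \<subseteq> K)"

definition maximal_star_disc :: "point set \<Rightarrow> point \<Rightarrow> real \<Rightarrow> bool" where
  "maximal_star_disc K m r \<longleftrightarrow> star_shaped_wrt_disc K m r \<and>
     (\<forall>m' r'. star_shaped_wrt_disc K m' r' \<longrightarrow> r' \<le> r)"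


section \<open>Polygonal meshes\<close>

text \<open>Elements are closed sets. A mesh is given by its set \<open>\<K>\<close> of elements and its set \<open>N\<close>
  of nodes. Every mesh node on the boundary of an element, hanging or not, is a node of that
  element.\<close>

definition nodes_of :: "point set \<Rightarrow> point set \<Rightarrow> point set" where
  "nodes_of N K = N \<inter> frontier K"

definition edges_of :: "point set \<Rightarrow> point set \<Rightarrow> point set set" where
  "edges_of N K = {closed_segment a b |a b. a \<in> nodes_of N K \<and> b \<in> nodes_of N K \<and> a \<noteq> b \<and>
     closed_segment a b \<subseteq> frontier K \<and> open_segment a b \<inter> N = {}}"

definition polygonal_mesh :: "point set \<Rightarrow> point set set \<Rightarrow> point set \<Rightarrow> bool" where
  "polygonal_mesh \<Omega> \<K> N \<longleftrightarrow>
     finite \<K> \<and> finite N \<and>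
     (\<forall>K\<in>\<K>. polygonal_element K) \<and>
     \<Union>\<K> = closure \<Omega> \<and>
     (\<forall>K\<in>\<K>. \<forall>L\<in>\<K>. K \<noteq> L \<longrightarrow> interior K \<inter> interior L = {}) \<and>
     N \<subseteq> (\<Union>K\<in>\<K>. frontier K) \<and>
     (\<forall>K\<in>\<K>. frontier K = \<Union>(edges_of N K))"

text \<open>The function \<open>ctr\<close> fixes, for each element, the midpoint of one of its largest star discs.
  The diameter of an edge is its length.\<close>

definition regular_mesh ::
    "real \<Rightarrow> real \<Rightarrow> point set \<Rightarrow> point set set \<Rightarrow> point set \<Rightarrow> (point set \<Rightarrow> point) \<Rightarrow> bool" where
  "regular_mesh \<sigma> \<kappa> \<Omega> \<K> N ctr \<longleftrightarrow>
     polygonal_mesh \<Omega> \<K> N \<and>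
     (\<forall>K\<in>\<K>. \<exists>\<rho>. maximal_star_disc K (ctr K) \<rho> \<and> diameter K / \<rho> < \<sigma>) \<and>
     (\<forall>K\<in>\<K>. \<forall>E\<in>edges_of N K. diameter K \<le> \<kappa> * diameter E) \<and>
     (\<forall>K\<in>\<K>. diameter K < 1)"

definition aux_triangulation ::
    "point set set \<Rightarrow> point set \<Rightarrow> (point set \<Rightarrow> point) \<Rightarrow> point set set" where
  "aux_triangulation \<K> N ctr =
     (\<Union>K\<in>\<K>. (\<lambda>E. convex hull (insert (ctr K) E)) ` edges_of N K)"

definition node_patch :: "point set set \<Rightarrow> point set \<Rightarrow> point \<Rightarrow> point set" where
  "node_patch \<K> N z = interior (\<Union>{K\<in>\<K>. z \<in> nodes_of N K})"

definition triangle_patch ::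
    "point set set \<Rightarrow> point set \<Rightarrow> (point set \<Rightarrow> point) \<Rightarrow> point \<Rightarrow> point set" where
  "triangle_patch \<K> N ctr z = interior (\<Union>{T\<in>aux_triangulation \<K> N ctr. z \<in> T})"

end

theory Submission
  imports Defs
begin

text \<open>
  For a smooth function the difference of values at two points is bounded by the integral of the
  gradient along the segment between them. Integrating the square of this bound over pairs
  \<open>(x, y)\<close> with \<open>x\<close> in a star-shaped cell and \<open>y\<close> in its star disc, and substituting affinely in
  \<open>x\<close> on the half of the segment near \<open>x\<close> and in \<open>y\<close> on the other half, gives the Poincare inequality
  on the cell with a constant depending only on the ratio of diameter and disc radius. Mollification
  by test functions transfers it to weakly differentiable functions.

  Two Poincare inequalities on sets with a sizeable intersection combine to one on the union.
  Neighbouring elements (or triangles) around a node share an edge, and a disc around its midpoint, of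
  radius comparable to the diameters, is covered by the two; it overlaps both substantially. Hence
  one can pass from cell to cell. The number of cells at a node is bounded by comparing areas of
  scaled star discs, and every cell is reached because a punctured neighbourhood of the node in the
  domain is connected, which at a boundary node rests on the Jordan separation theorem.
\<close>

subsection \<open>Smooth bump functions\<close>

text \<open>Elements may be non-convex, and a segment between two of their points can leave them;
  only segments ending in the star disc are certain to stay inside, so every cell is compared with
  the mean over such a disc. Adjacent cells share only a null set and cannot be compared directly;
  the disc over the common side is a third star-shaped set inserted between them, subject to the
  same inequality. The constant must not see the number of cells: each link costs one step of the
  recursion \<open>chain_const\<close>, whose depth is capped by \<open>4 * \<sigma>^2\<close>. The
  triangle patch has two kinds of links, across mesh edges and across the spoke joining the node to
  the centre of one element. The shape of the triangles is controlled because the whole line of a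
  boundary edge, and not just the edge, avoids the open star disc. Integrals are moved from the
  patch to the plane by extending functions by zero. Kernels are built explicitly, since a test
  function must be differentiable to every order.\<close>

definition flat :: "real poly \<Rightarrow> real \<Rightarrow> real" where
  "flat p t = (if t > 0 then poly p (inverse t) * exp (- inverse t) else 0)"

lemma poly_exp_tendsto_0: "((\<lambda>x. poly p x * exp (- x)) \<longlongrightarrow> 0) at_top" for p :: "real poly"
proof -
  have "((\<lambda>x. \<Sum>i\<le>degree p. coeff p i * (x ^ i / exp x)) \<longlongrightarrow> (\<Sum>i\<le>degree p. coeff p i * 0)) at_top"
    by (intro tendsto_sum tendsto_mult tendsto_const tendsto_power_div_exp_0)
  then show ?thesis
    by (simp add: poly_altdef exp_minus divide_inverse sum_distrib_right mult.assoc)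
qed

text \<open>For \<open>t > 0\<close> the chain rule gives an expression of the same shape, with
  polynomial \<open>(p - p') * x^2\<close>; the list \<open>[:0, 0, 1:]\<close> is
  \<open>x^2\<close>. At 0 the right difference quotient is again of this shape and tends to 0,
  since exponential decay beats every polynomial. One rule thus covers derivatives of all
  orders.\<close>

lemma flat_deriv: "(flat p has_real_derivative flat ((p - pderiv p) * [:0, 0, 1:]) t) (at t)"
proof (cases t "0::real" rule: linorder_cases)
  case less
  have "((\<lambda>_. 0) has_real_derivative 0) (at t)" by simp
  then have "(flat p has_real_derivative 0) (at t)"
    by (rule DERIV_cong_ev[THEN iffD1, rotated 3, of _ _ t t])
      (use eventually_nhds_in_open[of "{..<0}" t] less in \<open>auto simp: flat_def elim!: eventually_mono\<close>)
  then show ?thesis using less by (simp add: flat_def)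
next
  case greater
  have "((\<lambda>t. poly p (inverse t) * exp (- inverse t)) has_real_derivative
      flat ((p - pderiv p) * [:0, 0, 1:]) t) (at t)"
    using greater
    by (auto intro!: derivative_eq_intros DERIV_chain'[where f=inverse and g="poly p"] poly_DERIV
        simp: flat_def field_simps power2_eq_square)
  then show ?thesis
    by (rule DERIV_cong_ev[THEN iffD1, rotated 3, of _ _ t t])
      (use eventually_nhds_in_open[of "{0<..}" t] greater in \<open>auto simp: flat_def elim!: eventually_mono\<close>)
next
  case equal
  have "((\<lambda>h. flat p h / h) \<longlongrightarrow> 0) (at_left 0)"
    by (rule tendsto_eventually) (auto simp: flat_def eventually_at_left_field intro!: exI[of _ "-1"])
  moreover have "((\<lambda>h. flat p h / h) \<longlongrightarrow> 0) (at_right 0)"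
  proof -
    have "((\<lambda>h. poly (p * [:0, 1:]) (inverse h) * exp (- inverse h)) \<longlongrightarrow> 0) (at_right (0::real))"
      by (rule filterlim_compose[OF poly_exp_tendsto_0 filterlim_inverse_at_top_right])
    then show ?thesis
      by (rule Lim_transform_eventually)
        (auto simp: flat_def eventually_at_right_field field_simps intro!: exI[of _ 1])
  qed
  ultimately have "((\<lambda>h. flat p h / h) \<longlongrightarrow> 0) (at 0)"
    by (simp add: filterlim_split_at_real)
  then show ?thesis using equal by (simp add: DERIV_def flat_def)
qed

text \<open>The class is closed under directional derivatives, so smoothness of every order follows
  by induction on the order, without formulas for higher derivatives.\<close>

inductive_set bump_algebra :: "('a::euclidean_space \<Rightarrow> real) set" where
  const: "(\<lambda>x. c) \<in> bump_algebra"
| flat: "(\<lambda>x. flat p (a + s * (x \<bullet> b))) \<in> bump_algebra"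
| add: "f \<in> bump_algebra \<Longrightarrow> g \<in> bump_algebra \<Longrightarrow> (\<lambda>x. f x + g x) \<in> bump_algebra"
| mult: "f \<in> bump_algebra \<Longrightarrow> g \<in> bump_algebra \<Longrightarrow> (\<lambda>x. f x * g x) \<in> bump_algebra"

lemma bump_algebra_has_derivative:
  assumes "f \<in> bump_algebra"
  shows "\<exists>D. (\<forall>x. (f has_derivative D x) (at x)) \<and> (\<forall>i. (\<lambda>x. D x i) \<in> bump_algebra)"
  using assms
proof induction
  case (const c)
  show ?case by (intro exI[of _ "\<lambda>x i. 0"]) (auto intro: bump_algebra.const)
next
  case (flat p a s b)
  let ?q = "(p - pderiv p) * [:0, 0, 1:]"
  have "((\<lambda>x. flat p (a + s * (x \<bullet> b))) has_derivative
      (\<lambda>i. flat ?q (a + s * (x \<bullet> b)) * (s * (i \<bullet> b)))) (at x)" for x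
    by (rule has_derivative_compose[of "\<lambda>x. a + s * (x \<bullet> b)", OF _
          flat_deriv[THEN has_field_derivative_imp_has_derivative, of p "a + s * (x \<bullet> b)"]])
      (auto intro!: derivative_eq_intros)
  then show ?case
    by (intro exI[of _ "\<lambda>x i. flat ?q (a + s * (x \<bullet> b)) * (s * (i \<bullet> b))"])
      (auto intro!: bump_algebra.mult bump_algebra.flat bump_algebra.const)
next
  case (add f g)
  then obtain D E where "\<forall>x. (f has_derivative D x) (at x)" "\<forall>i. (\<lambda>x. D x i) \<in> bump_algebra"
    "\<forall>x. (g has_derivative E x) (at x)" "\<forall>i. (\<lambda>x. E x i) \<in> bump_algebra" by blast
  then show ?case
    by (intro exI[of _ "\<lambda>x i. D x i + E x i"])
      (auto intro!: has_derivative_add bump_algebra.add)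
next
  case (mult f g)
  then obtain D E where "\<forall>x. (f has_derivative D x) (at x)" "\<forall>i. (\<lambda>x. D x i) \<in> bump_algebra"
    "\<forall>x. (g has_derivative E x) (at x)" "\<forall>i. (\<lambda>x. E x i) \<in> bump_algebra" by blast
  with mult.hyps show ?case
    by (intro exI[of _ "\<lambda>x i. f x * E x i + D x i * g x"])
      (auto intro!: has_derivative_mult bump_algebra.add bump_algebra.mult)
qed

lemma bump_algebra_k_times_cont_diff: "f \<in> bump_algebra \<Longrightarrow> k_times_cont_diff k f"
proof (induction k arbitrary: f)
  case 0
  then show ?case
    using bump_algebra_has_derivative[OF 0]
    by (auto simp: continuous_on_eq_continuous_within dest!: spec intro: has_derivative_continuous)
next
  case (Suc k)
  obtain D where D: "\<And>x. (f has_derivative D x) (at x)" "\<And>i. (\<lambda>x. D x i) \<in> bump_algebra"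
    using bump_algebra_has_derivative[OF Suc.prems] by blast
  have "partial_deriv i f = (\<lambda>x. D x i)" for i
    using D(1) by (simp add: partial_deriv_def fun_eq_iff frechet_derivative_at[OF D(1), symmetric])
  with D Suc.IH show ?case by (auto simp: differentiable_def)
qed

text \<open>In a convolution the kernel is tested as a function of the integration variable, hence
  reflected and shifted.\<close>

lemma bump_algebra_reflect: "f \<in> bump_algebra \<Longrightarrow> (\<lambda>w. f (p - w)) \<in> bump_algebra"
proof (induction rule: bump_algebra.induct)
  case (flat q a s b)
  have "(\<lambda>w. flat q (a + s * ((p - w) \<bullet> b))) = (\<lambda>w. flat q ((a + s * (p \<bullet> b)) + (- s) * (w \<bullet> b)))"
    by (simp add: algebra_simps)
  then show ?case using bump_algebra.flat[of q "a + s * (p \<bullet> b)" "- s" b] by simp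
qed (auto intro: bump_algebra.intros)

lemma bump_algebra_prod:
  "finite I \<Longrightarrow> (\<And>i. i \<in> I \<Longrightarrow> f i \<in> bump_algebra) \<Longrightarrow> (\<lambda>x. \<Prod>i\<in>I. f i x) \<in> bump_algebra"
  by (induction rule: finite_induct) (auto intro: bump_algebra.intros)

lemma bump_algebra_test_function:
  assumes f: "f \<in> bump_algebra" and z: "\<And>x. e \<le> norm x \<Longrightarrow> f x = 0" and S: "cball p e \<subseteq> S"
  shows "(\<lambda>w. f (p - w)) \<in> test_functions S"
proof -
  have "{w. f (p - w) \<noteq> 0} \<subseteq> cball p e"
    using z by (force simp: dist_norm)
  then have "closure {w. f (p - w) \<noteq> 0} \<subseteq> cball p e"
    by (meson closed_cball closure_minimal)
  then show ?thesis
    using S bump_algebra_k_times_cont_diff[OF bump_algebra_reflect[OF f]] compact_cball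
    unfolding test_functions_def
    by (auto intro: compact_closure[THEN iffD2] bounded_subset[OF bounded_cball] closure_subset)
      (meson bounded_cball bounded_subset closure_subset compact_closure dual_order.trans)
qed

lemma emeasure_lborel_ball_pos:
  assumes "0 < r" shows "0 < emeasure lborel (ball (c::'a::euclidean_space) r)"
  using assms open_not_negligible[of "ball c r"] 
  by (auto simp: negligible_iff_null_sets null_sets_def zero_less_iff_neq_zero emeasure_completion)

lemma mollifier_exists:
  assumes "0 < e"
  shows "\<exists>f\<in>bump_algebra. (\<forall>x::'a::euclidean_space. 0 \<le> f x) \<and> (\<forall>x. e \<le> norm x \<longrightarrow> f x = 0) \<and>
    integrable lborel f \<and> (LINT x|lborel. f x) = 1"
proof -
  \<comment> \<open>Each factor of \<open>f\<close> below is positive exactly when its argument is,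
    so \<open>f\<close> lives on the open cube of half side \<open>d\<close>. The Euclidean norm is
    at most the sum of the absolute coordinates; dividing \<open>e\<close> by the dimension
    therefore puts the cube into the ball of radius \<open>e\<close>.\<close>
  define d where "d = e / DIM('a)"
  have d: "d > 0" using assms by (simp add: d_def)
  define f where "f x = (\<Prod>b\<in>Basis. flat 1 (d + (-1) * (x \<bullet> b)) * flat 1 (d + 1 * (x \<bullet> b)))" for x :: 'a
  have fB: "f \<in> bump_algebra" unfolding f_def
    by (intro bump_algebra_prod bump_algebra.mult bump_algebra.flat) auto
  have nn: "0 \<le> f x" for x unfolding f_def by (intro prod_nonneg) (auto simp: flat_def)
  have z: "f x = 0" if "e \<le> norm x" for x
  proof (rule ccontr)
    assume "f x \<noteq> 0"
    then have *: "\<bar>x \<bullet> b\<bar> < d" if "b \<in> Basis" for b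
      using that by (auto simp: f_def flat_def split: if_splits)
    have "norm x \<le> (\<Sum>b\<in>Basis. \<bar>x \<bullet> b\<bar>)" by (rule norm_le_l1)
    also have "\<dots> < (\<Sum>b\<in>(Basis::'a set). d)" by (intro sum_strict_mono) (use * in auto)
    also have "\<dots> = e" by (simp add: d_def)
    finally show False using that by simp
  qed
  have cont: "continuous_on UNIV f"
    using bump_algebra_k_times_cont_diff[OF fB, of 0] by simp
  have "set_integrable lborel (cball 0 e) f"
    unfolding set_integrable_def
    by (rule borel_integrable_compact) (auto intro: continuous_on_subset[OF cont])
  moreover have "(\<lambda>x. indicator (cball 0 e) x *\<^sub>R f x) = f"
    using z by (force simp: fun_eq_iff indicator_def dist_norm)
  ultimately have int: "integrable lborel f" by (simp add: set_integrable_def)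
  have "f 0 > 0" unfolding f_def using d by (intro prod_pos) (auto simp: flat_def)
  then obtain r where r: "r > 0" "\<And>x. dist x 0 < r \<Longrightarrow> f x > f 0 / 2"
  proof -
    have "isCont f 0" using cont by (simp add: continuous_on_eq_continuous_at)
    then have "eventually (\<lambda>x. f x > f 0 / 2) (nhds 0)"
      using \<open>f 0 > 0\<close> order_tendstoD(1)[of f "f 0" "nhds 0" "f 0 / 2"] 
      by (simp add: isCont_def tendsto_at_iff_tendsto_nhds)
    then show ?thesis using that by (auto simp: eventually_nhds_metric)
  qed
  have "(LINT x|lborel. f x) > 0"
  proof (rule ccontr)
    assume "\<not> ?thesis"
    then have "(LINT x|lborel. f x) = 0" using nn
      by (smt (verit) AE_I2 integral_nonneg_AE)
    then have "AE x in lborel. f x = 0" using integral_nonneg_eq_0_iff_AE[OF int] nn by auto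
    then have "emeasure lborel (ball (0::'a) r) = 0"
    proof -
      have "AE x in lborel. \<not> x \<in> ball (0::'a) r"
        using \<open>AE x in lborel. f x = 0\<close> by eventually_elim (use r(2) \<open>f 0 > 0\<close> in \<open>force simp: dist_commute\<close>)
      from emeasure_eq_0_AE[OF this] show ?thesis by (simp add: ball_def)
    qed
    then show False using emeasure_lborel_ball_pos[OF \<open>r > 0\<close>, of "0::'a"] by simp
  qed
  then show ?thesis
    using nn z int bump_algebra.mult[OF bump_algebra.const[of "1 / (LINT x|lborel. f x)"] fB]
    by (intro bexI[of _ "\<lambda>x. (1 / (LINT x|lborel. f x)) * f x"]) auto
qed

subsection \<open>Integrals along segments\<close>

lemma nn_integral_lborel_affine:
  fixes f :: "'a::euclidean_space \<Rightarrow> ennreal"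
  assumes [measurable]: "f \<in> borel_measurable borel" and "c \<noteq> 0"
  shows "(\<integral>\<^sup>+x. f x \<partial>lborel) = ennreal (\<bar>c\<bar> ^ DIM('a)) * (\<integral>\<^sup>+x. f (t + c *\<^sub>R x) \<partial>lborel)"
  by (subst lborel_affine[OF \<open>c \<noteq> 0\<close>, of t])
    (simp add: nn_integral_density nn_integral_distr nn_integral_cmult)

lemma nn_integral_lborel_translate:
  fixes f :: "'a::euclidean_space \<Rightarrow> ennreal"
  assumes "f \<in> borel_measurable borel"
  shows "(\<integral>\<^sup>+x. f (x - t) \<partial>lborel) = (\<integral>\<^sup>+x. f x \<partial>lborel)"
    "(\<integral>\<^sup>+x. f (t - x) \<partial>lborel) = (\<integral>\<^sup>+x. f x \<partial>lborel)"
  using nn_integral_lborel_affine[OF assms, of 1 "-t"]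
    nn_integral_lborel_affine[OF assms, of "-1" t] by simp_all

text \<open>For fixed \<open>t\<close> one of the coefficients \<open>1 - t\<close> of
  \<open>x\<close> and \<open>t\<close> of \<open>y\<close> is at least 1/2. Substituting in that
  variable costs at most \<open>2 ^ DIM('a)\<close>, uniformly in \<open>t\<close>, and the other
  variable contributes only the measure of its set. One substitution for all \<open>t\<close> would
  leave a Jacobian that is not integrable at one end of the segment.\<close>

lemma nn_integral_segments_le:
  fixes A B :: "'a::euclidean_space set" and G :: "'a \<Rightarrow> ennreal"
  assumes [measurable]: "A \<in> sets borel" "B \<in> sets borel" "G \<in> borel_measurable borel"
  shows "(\<integral>\<^sup>+x\<in>A. (\<integral>\<^sup>+y\<in>B. (\<integral>\<^sup>+t\<in>{0..1::real}. G (x + t *\<^sub>R (y - x)) \<partial>lborel) \<partial>lborel) \<partial>lborel)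
    \<le> ennreal (2 ^ DIM('a)) * (emeasure lborel A + emeasure lborel B) * (\<integral>\<^sup>+x. G x \<partial>lborel)"
proof -
  let ?I = "\<integral>\<^sup>+x. G x \<partial>lborel" and ?n = "ennreal (2 ^ DIM('a))"
  define F where "F x y t = G (x + t *\<^sub>R (y - x)) * indicator {0..1} t * indicator A x * indicator B y"
    for x y and t :: real
  have F[measurable]: "(\<lambda>(x, y, t). F x y t) \<in> borel_measurable (borel \<Otimes>\<^sub>M borel \<Otimes>\<^sub>M borel)"
    unfolding F_def by measurable
  have *: "(\<integral>\<^sup>+z. G (p + c *\<^sub>R z) \<partial>lborel) \<le> ?n * ?I" if "c \<ge> 1/2" for c p
  proof -
    have "1 \<le> (2 * c) ^ DIM('a)" using that by (intro one_le_power) auto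
    then have "1 \<le> ?n * ennreal (c ^ DIM('a))"
      using that by (simp add: power_mult_distrib flip: ennreal_mult' ennreal_1)
    then have "(\<integral>\<^sup>+z. G (p + c *\<^sub>R z) \<partial>lborel) \<le> (?n * ennreal (c ^ DIM('a))) * (\<integral>\<^sup>+z. G (p + c *\<^sub>R z) \<partial>lborel)"
      using mult_right_mono[of 1 "?n * ennreal (c ^ DIM('a))" "\<integral>\<^sup>+z. G (p + c *\<^sub>R z) \<partial>lborel"] by simp
    also have "\<dots> = ?n * ?I"
      using that nn_integral_lborel_affine[of G c p] by (simp add: mult.assoc)
    finally show ?thesis .
  qed
  have inner: "(\<integral>\<^sup>+x. (\<integral>\<^sup>+y. F x y t \<partial>lborel) \<partial>lborel)
      \<le> ?n * (emeasure lborel A + emeasure lborel B) * ?I * indicator {0..1} t" for t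
  proof (cases "t \<in> {0..1}")
    case t: True
    show ?thesis
    proof (cases "t \<ge> 1/2")
      case True
      have "(\<integral>\<^sup>+y. F x y t \<partial>lborel) \<le> ?n * ?I * indicator A x" for x
      proof -
        have "(\<integral>\<^sup>+y. F x y t \<partial>lborel) \<le> (\<integral>\<^sup>+y. G (((1 - t) *\<^sub>R x) + t *\<^sub>R y) * indicator A x \<partial>lborel)"
          by (intro nn_integral_mono) (auto simp: F_def indicator_def algebra_simps)
        also have "\<dots> \<le> ?n * ?I * indicator A x"
          using *[OF True, of "(1 - t) *\<^sub>R x"] by (auto simp: indicator_def)
        finally show ?thesis .
      qed
      then have "(\<integral>\<^sup>+x. (\<integral>\<^sup>+y. F x y t \<partial>lborel) \<partial>lborel) \<le> (\<integral>\<^sup>+x. ?n * ?I * indicator A x \<partial>lborel)"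
        by (intro nn_integral_mono)
      also have "\<dots> = ?n * ?I * emeasure lborel A" by (simp add: nn_integral_cmult)
      also have "\<dots> \<le> ?n * ?I * (emeasure lborel A + emeasure lborel B)" by (intro mult_left_mono) auto
      finally show ?thesis using t by (simp add: mult_ac)
    next
      case False
      then have c: "1 - t \<ge> 1/2" by simp
      have "(\<integral>\<^sup>+x. F x y t \<partial>lborel) \<le> ?n * ?I * indicator B y" for y
      proof -
        have "(\<integral>\<^sup>+x. F x y t \<partial>lborel) \<le> (\<integral>\<^sup>+x. G ((t *\<^sub>R y) + (1 - t) *\<^sub>R x) * indicator B y \<partial>lborel)"
          by (intro nn_integral_mono) (auto simp: F_def indicator_def algebra_simps)
        also have "\<dots> \<le> ?n * ?I * indicator B y"
          using *[OF c, of "t *\<^sub>R y"] by (auto simp: indicator_def)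
        finally show ?thesis .
      qed
      then have "(\<integral>\<^sup>+y. (\<integral>\<^sup>+x. F x y t \<partial>lborel) \<partial>lborel) \<le> (\<integral>\<^sup>+y. ?n * ?I * indicator B y \<partial>lborel)"
        by (intro nn_integral_mono)
      also have "\<dots> = ?n * ?I * emeasure lborel B" by (simp add: nn_integral_cmult)
      also have "\<dots> \<le> ?n * ?I * (emeasure lborel A + emeasure lborel B)" by (intro mult_left_mono) auto
      also have "(\<integral>\<^sup>+y. (\<integral>\<^sup>+x. F x y t \<partial>lborel) \<partial>lborel) = (\<integral>\<^sup>+x. (\<integral>\<^sup>+y. F x y t \<partial>lborel) \<partial>lborel)"
        unfolding F_def by (rule lborel_pair.Fubini') measurable
      finally show ?thesis using t by (simp add: mult_ac)
    qed
  qed (simp add: F_def)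
  have "(\<integral>\<^sup>+x\<in>A. (\<integral>\<^sup>+y\<in>B. (\<integral>\<^sup>+t\<in>{0..1::real}. G (x + t *\<^sub>R (y - x)) \<partial>lborel) \<partial>lborel) \<partial>lborel)
      = (\<integral>\<^sup>+x. (\<integral>\<^sup>+y. (\<integral>\<^sup>+t. F x y t \<partial>lborel) \<partial>lborel) \<partial>lborel)"
    unfolding F_def
    by (auto simp: indicator_def intro!: nn_integral_cong)
  also have "\<dots> = (\<integral>\<^sup>+x. (\<integral>\<^sup>+t. (\<integral>\<^sup>+y. F x y t \<partial>lborel) \<partial>lborel) \<partial>lborel)"
    unfolding F_def by (intro nn_integral_cong lborel_pair.Fubini') measurable
  also have "\<dots> = (\<integral>\<^sup>+t. (\<integral>\<^sup>+x. (\<integral>\<^sup>+y. F x y t \<partial>lborel) \<partial>lborel) \<partial>lborel)"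
    unfolding F_def by (rule lborel_pair.Fubini') measurable
  also have "\<dots> \<le> (\<integral>\<^sup>+t. ?n * (emeasure lborel A + emeasure lborel B) * ?I * indicator {0..1::real} t \<partial>lborel)"
    by (intro nn_integral_mono inner)
  also have "\<dots> = ?n * (emeasure lborel A + emeasure lborel B) * ?I"
    by (simp add: nn_integral_cmult)
  finally show ?thesis .
qed

text \<open>Tonelli with a kernel of mass one. Applied to the squared norm of the gradient, it keeps
  the bound independent of the kernel.\<close>

lemma nn_integral_mollified:
  fixes f :: "'a::euclidean_space \<Rightarrow> ennreal" and \<eta> :: "'a \<Rightarrow> real"
  assumes [measurable]: "f \<in> borel_measurable borel" "\<eta> \<in> borel_measurable borel"
    and \<eta>: "\<And>x. 0 \<le> \<eta> x" "integrable lborel \<eta>" "(LINT x|lborel. \<eta> x) = 1"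
  shows "(\<integral>\<^sup>+p. (\<integral>\<^sup>+w. f w * ennreal (\<eta> (p - w)) \<partial>lborel) \<partial>lborel) = (\<integral>\<^sup>+w. f w \<partial>lborel)"
proof -
  have 1: "(\<integral>\<^sup>+x. ennreal (\<eta> x) \<partial>lborel) = 1"
    using \<eta> by (simp add: nn_integral_eq_integral)
  have "(\<integral>\<^sup>+p. (\<integral>\<^sup>+w. f w * ennreal (\<eta> (p - w)) \<partial>lborel) \<partial>lborel) =
      (\<integral>\<^sup>+w. (\<integral>\<^sup>+p. f w * ennreal (\<eta> (p - w)) \<partial>lborel) \<partial>lborel)"
    by (rule lborel_pair.Fubini') measurable
  also have "\<dots> = (\<integral>\<^sup>+w. f w \<partial>lborel)"
    by (simp add: nn_integral_cmult nn_integral_lborel_translate(1)[of "\<lambda>x. ennreal (\<eta> x)"] 1)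
  finally show ?thesis .
qed

subsection \<open>Mollification of weakly differentiable functions\<close>

lemma bump_algebra_bounded:
  fixes f :: "'a::euclidean_space \<Rightarrow> real"
  assumes f: "f \<in> bump_algebra" and z: "\<And>x. e \<le> norm x \<Longrightarrow> f x = 0"
  obtains M where "\<And>x. \<bar>f x\<bar> \<le> M"
proof -
  have "continuous_on UNIV f" using bump_algebra_k_times_cont_diff[OF f, of 0] by simp
  then have "compact (f ` cball 0 e)"
    by (intro compact_continuous_image compact_cball) (auto intro: continuous_on_subset)
  then obtain M where "\<forall>y\<in>f ` cball 0 e. norm y \<le> M"
    using compact_imp_bounded bounded_iff by metis
  then have "\<bar>f x\<bar> \<le> \<bar>M\<bar>" for x
    using z[of x] by (cases "norm x \<le> e") force+
  then show ?thesis using that by blast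
qed

text \<open>Outside the ball the function vanishes on an open set, so its derivative does too;
  inside, compactness bounds it. The bound dominates the exchange of integrals in
  \<open>mollified_increment\<close>.\<close>

lemma bounded_derivative_of_compact_support:
  fixes f :: "'a::euclidean_space \<Rightarrow> real"
  assumes f: "f \<in> bump_algebra" and z: "\<And>x. e \<le> norm x \<Longrightarrow> f x = 0" 
    and D: "\<And>x. (f has_derivative D x) (at x)" "\<And>i. (\<lambda>x. D x i) \<in> bump_algebra"
  obtains M where "\<And>x. \<bar>D x u\<bar> \<le> M" "M \<ge> 0" "continuous_on UNIV (\<lambda>x. D x u)"
proof -
  have cont: "continuous_on UNIV (\<lambda>x. D x u)"
    using bump_algebra_k_times_cont_diff[OF D(2), of 0] by simp
  have "compact ((\<lambda>x. D x u) ` cball 0 e)"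
    by (intro compact_continuous_image compact_cball continuous_on_subset[OF cont]) auto
  then obtain M where "\<forall>y\<in>(\<lambda>x. D x u) ` cball 0 e. norm y \<le> M"
    using compact_imp_bounded bounded_iff by metis
  then have M: "\<bar>D x u\<bar> \<le> M" if "x \<in> cball 0 e" for x
    using that by simp
  have "D x u = 0" if "x \<notin> cball 0 e" for x
  proof -
    have "((\<lambda>_. 0) has_derivative (\<lambda>_. 0)) (at x)" by simp
    then have "(f has_derivative (\<lambda>_. 0)) (at x)"
      by (rule has_derivative_transform_within_open[of _ _ _ _ "- cball 0 e"])
        (use that z in \<open>auto simp: dist_norm\<close>)
    from has_derivative_unique[OF D(1) this] show ?thesis by simp
  qed
  with M have "\<bar>D x u\<bar> \<le> \<bar>M\<bar>" for x by (cases "x \<in> cball 0 e") force+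
  then show ?thesis using that cont by (metis abs_ge_zero)
qed

lemma integrable_mult_bounded:
  fixes f h :: "'a \<Rightarrow> real"
  assumes "integrable M f" "h \<in> borel_measurable M" "\<And>x. \<bar>h x\<bar> \<le> C"
  shows "integrable M (\<lambda>x. f x * h x)"
proof (rule Bochner_Integration.integrable_bound[of M "\<lambda>x. C * f x"])
  show "AE x in M. norm (f x * h x) \<le> norm (C * f x)"
  proof (intro AE_I2)
    fix x
    have "0 \<le> C" using assms(3)[of x] by linarith
    then show "norm (f x * h x) \<le> norm (C * f x)"
      using mult_left_mono[OF assms(3)[of x], of "\<bar>f x\<bar>"] by (simp add: abs_mult mult.commute)
  qed
qed (use assms in auto)

lemma ennreal_abs_integral_le:
  fixes f :: "'a \<Rightarrow> real"
  shows "ennreal \<bar>LINT x|M. f x\<bar> \<le> (\<integral>\<^sup>+x. ennreal \<bar>f x\<bar> \<partial>M)"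
  using integral_norm_bound_ennreal[of M f]
  by (cases "integrable M f") (auto simp: not_integrable_integral_eq)

text \<open>Differentiability of the convolution is never established. For fixed \<open>w\<close>
  the fundamental theorem is applied to the kernel along the segment, the integrals are exchanged,
  and at each point of the segment the weak gradient is tested with the reflected kernel. The
  hypothesis on the segment keeps all these kernels supported in \<open>S\<close>.\<close>

lemma mollified_increment:
  fixes v :: "'a::euclidean_space \<Rightarrow> real" and g :: "'a \<Rightarrow> 'a"
  assumes v: "integrable lborel v" and g: "integrable lborel g"
    and weak: "\<And>\<phi> i. \<phi> \<in> test_functions S \<Longrightarrow> i \<in> Basis \<Longrightarrow>
      (LINT w|lborel. v w * partial_deriv i \<phi> w) = - (LINT w|lborel. (g w \<bullet> i) * \<phi> w)"
    and f: "f \<in> bump_algebra" and z: "\<And>x. e \<le> norm x \<Longrightarrow> f x = 0" and nn: "\<And>x. 0 \<le> f x"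
    and int: "integrable lborel f" "(LINT x|lborel. f x) = 1"
    and seg: "\<And>p. p \<in> closed_segment x y \<Longrightarrow> cball p e \<subseteq> S"
  shows "(ennreal \<bar>(LINT w|lborel. v w * f (y - w)) - (LINT w|lborel. v w * f (x - w))\<bar>)\<^sup>2 \<le>
     ennreal ((norm (y - x))\<^sup>2) * (\<integral>\<^sup>+t\<in>{0..1::real}.
        (\<integral>\<^sup>+w. ennreal ((norm (g w))\<^sup>2) * ennreal (f (x + t *\<^sub>R (y - x) - w)) \<partial>lborel) \<partial>lborel)"
proof -
  define u where "u = y - x"
  define P where "P t = x + t *\<^sub>R u" for t :: real
  obtain D where D: "\<And>x. (f has_derivative D x) (at x)" "\<And>i. (\<lambda>x. D x i) \<in> bump_algebra"
    using bump_algebra_has_derivative[OF f] by blast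
  have contf: "continuous_on UNIV f" using bump_algebra_k_times_cont_diff[OF f, of 0] by simp
  have fm[measurable]: "f \<in> borel_measurable borel" using contf by (rule borel_measurable_continuous_onI)
  have vm[measurable]: "v \<in> borel_measurable borel" and gm[measurable]: "g \<in> borel_measurable borel"
    using v g by (auto dest: borel_measurable_integrable)
  obtain Mf where Mf: "\<And>x. \<bar>f x\<bar> \<le> Mf"
    using bump_algebra_bounded[OF f z] by metis
  have vf: "integrable lborel (\<lambda>w. v w * f (p - w))" for p
    by (rule integrable_mult_bounded[OF v, where C=Mf]) (use Mf in auto)
  have gf: "integrable lborel (\<lambda>w. (g w \<bullet> i) * f (p - w))" for p i
    by (rule integrable_mult_bounded[where C=Mf]) (use Mf g in auto)
  have Dm[measurable]: "(\<lambda>x. D x i) \<in> borel_measurable borel" for i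
    using bump_algebra_k_times_cont_diff[OF D(2), of 0] by (auto intro: borel_measurable_continuous_onI)
  have vD: "integrable lborel (\<lambda>w. v w * D (p - w) i)" for p i
  proof -
    obtain M where "\<And>x. \<bar>D x i\<bar> \<le> M" 
      using bounded_derivative_of_compact_support[OF f z D, where u=i] by metis
    then show ?thesis by (intro integrable_mult_bounded[OF v, where C=M]) auto
  qed
  \<comment> \<open>The reflection flips the sign of the derivative of the kernel, which cancels the
    minus sign in the definition of the weak gradient.\<close>
  have 1: "(LINT w|lborel. v w * D (p - w) i) = (LINT w|lborel. (g w \<bullet> i) * f (p - w))"
    if p: "cball p e \<subseteq> S" and i: "i \<in> Basis" for p i
  proof -
    have "((\<lambda>w. f (p - w)) has_derivative (\<lambda>h. D (p - w) (- h))) (at w)" for w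
      by (rule has_derivative_compose[of "\<lambda>w. p - w" "\<lambda>h. - h", OF _ D(1)])
        (auto intro!: derivative_eq_intros)
    then have "partial_deriv i (\<lambda>w. f (p - w)) w = D (p - w) (- i)" for w
      unfolding partial_deriv_def by (metis frechet_derivative_at)
    moreover have "D (p - w) (- i) = - D (p - w) i" for w
      using linear_neg[OF has_derivative_linear[OF D(1)]] by blast
    ultimately have "partial_deriv i (\<lambda>w. f (p - w)) w = - D (p - w) i" for w by simp
    then show ?thesis
      using weak[OF bump_algebra_test_function[OF f z p] i] by simp
  qed
  have 2: "(LINT w|lborel. v w * D (p - w) u) = (LINT w|lborel. (g w \<bullet> u) * f (p - w))"
    if p: "cball p e \<subseteq> S" for p
  proof -
    have Du: "D q u = (\<Sum>i\<in>Basis. (u \<bullet> i) * D q i)" for q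
    proof -
      have "D q u = D q (\<Sum>i\<in>Basis. (u \<bullet> i) *\<^sub>R i)" by (simp add: euclidean_representation)
      also have "\<dots> = (\<Sum>i\<in>Basis. (u \<bullet> i) * D q i)"
        using has_derivative_linear[OF D(1)[of q]] by (simp add: linear_sum linear_cmul)
      finally show ?thesis .
    qed
    have "(LINT w|lborel. v w * D (p - w) u) = (LINT w|lborel. (\<Sum>i\<in>Basis. (u \<bullet> i) * (v w * D (p - w) i)))"
      by (simp add: Du sum_distrib_left mult_ac)
    also have "\<dots> = (\<Sum>i\<in>Basis. (u \<bullet> i) * (LINT w|lborel. v w * D (p - w) i))"
      using vD by simp
    also have "\<dots> = (\<Sum>i\<in>Basis. (u \<bullet> i) * (LINT w|lborel. (g w \<bullet> i) * f (p - w)))"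
      using 1[OF p] by simp
    also have "\<dots> = (LINT w|lborel. (\<Sum>i\<in>Basis. (u \<bullet> i) * ((g w \<bullet> i) * f (p - w))))"
      using gf by simp
    also have "\<dots> = (LINT w|lborel. (g w \<bullet> u) * f (p - w))"
      by (simp add: euclidean_inner[of "g _" u] sum_distrib_right sum_distrib_left mult_ac)
    finally show ?thesis .
  qed
  obtain M where M: "\<And>x. \<bar>D x u\<bar> \<le> M" "M \<ge> 0" "continuous_on UNIV (\<lambda>x. D x u)"
    using bounded_derivative_of_compact_support[OF f z D, where u=u] by metis
  have ftc: "f (y - w) - f (x - w) = (LINT t|lborel. indicator {0..1} t * D (P t - w) u)" for w
  proof -
    have "((\<lambda>t. f (P t - w)) has_vector_derivative D (P t - w) u) (at t within {0..1})" for t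
    proof -
      have "((\<lambda>t. f (P t - w)) has_derivative (\<lambda>h. D (P t - w) (h *\<^sub>R u))) (at t within {0..1})"
        by (rule has_derivative_compose[of "\<lambda>t. P t - w" "\<lambda>h. h *\<^sub>R u", OF _ D(1)])
          (auto simp: P_def intro!: derivative_eq_intros)
      moreover have "D (P t - w) (h *\<^sub>R u) = h *\<^sub>R D (P t - w) u" for h
        using has_derivative_linear[OF D(1)] by (simp add: linear_cmul)
      ultimately show ?thesis by (simp add: has_vector_derivative_def)
    qed
    moreover have "continuous_on {0..1} (\<lambda>t. D (P t - w) u)"
      unfolding P_def by (intro continuous_on_compose2[OF M(3)] continuous_intros) auto
    ultimately have "(LINT t|lborel. indicator {0..1} t *\<^sub>R D (P t - w) u) = f (P 1 - w) - f (P 0 - w)"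
      by (intro integral_FTC_atLeastAtMost) auto
    then show ?thesis by (simp add: P_def u_def)
  qed
  have Pm[measurable]: "P \<in> borel_measurable borel" by (simp add: P_def[abs_def])
  define H where "H t w = v w * (indicator {0..1} t * D (P t - w) u)" for t w
  have Hm[measurable]: "(\<lambda>(t, w). H t w) \<in> borel_measurable (lborel \<Otimes>\<^sub>M lborel)"
    unfolding H_def by measurable
  \<comment> \<open>The integrand is signed, so Fubini needs integrability; it is dominated by
    \<open>M * \<bar>v w\<bar>\<close> on the unit interval.\<close>
  have Hint: "integrable (lborel \<Otimes>\<^sub>M lborel) (\<lambda>(t, w). H t w)"
  proof (rule Bochner_Integration.integrable_bound[of _ "\<lambda>(t, w). indicator {0..1} t * (M * \<bar>v w\<bar>)"])
    show "integrable (lborel \<Otimes>\<^sub>M lborel) (\<lambda>(t, w). indicator {0..1::real} t * (M * \<bar>v w\<bar>))"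
      using v by (intro lborel_pair.Fubini_integrable) (auto simp: abs_mult)
    show "AE p in lborel \<Otimes>\<^sub>M lborel. norm (case p of (t, w) \<Rightarrow> H t w)
        \<le> norm (case p of (t, w) \<Rightarrow> indicator {0..1::real} t * (M * \<bar>v w\<bar>))"
    proof (intro AE_I2, clarify)
      fix t :: real and w :: 'a
      show "norm (H t w) \<le> norm (indicator {0..1::real} t * (M * \<bar>v w\<bar>))"
        using mult_right_mono[OF M(1)[of "P t - w"], of "\<bar>v w\<bar>"] M(2)
        by (auto simp: H_def abs_mult indicator_def mult.commute)
    qed
  qed measurable
  have "(LINT w|lborel. v w * f (y - w)) - (LINT w|lborel. v w * f (x - w))
      = (LINT w|lborel. v w * (f (y - w) - f (x - w)))"
    using vf by (simp add: right_diff_distrib)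
  also have "\<dots> = (LINT w|lborel. LINT t|lborel. H t w)"
    unfolding ftc H_def by simp
  also have "\<dots> = (LINT t|lborel. LINT w|lborel. H t w)"
    using lborel_pair.Fubini_integral[OF Hint] by simp
  also have "\<dots> = (LINT t|lborel. indicator {0..1} t * (LINT w|lborel. (g w \<bullet> u) * f (P t - w)))"
  proof (intro Bochner_Integration.integral_cong refl)
    fix t :: real
    show "(LINT w|lborel. H t w) = indicator {0..1} t * (LINT w|lborel. (g w \<bullet> u) * f (P t - w))"
    proof (cases "t \<in> {0..1}")
      case True
      then have "P t \<in> closed_segment x y"
        unfolding in_segment by (intro exI[of _ t]) (auto simp: P_def u_def algebra_simps)
      from 2[OF seg[OF this]] True show ?thesis by (simp add: H_def)
    qed (simp add: H_def)
  qed
  finally have eq: "(LINT w|lborel. v w * f (y - w)) - (LINT w|lborel. v w * f (x - w)) =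
      (LINT t|lborel. indicator {0..1} t * (LINT w|lborel. (g w \<bullet> u) * f (P t - w)))" .
  \<comment> \<open>\<open>Q\<close> is a probability density in \<open>(t, w)\<close>.
    Cauchy-Schwarz then bounds the squared mean of \<open>norm (g w)\<close> by the mean of its
    square, with no loss of a constant. The square root \<open>R\<close> of \<open>Q\<close>,
    defined below, splits the weight between the two factors.\<close>
  define Q where "Q t w = ennreal (f (P t - w)) * indicator {0..1} t" for t w
  have Qm[measurable]: "(\<lambda>(t, w). Q t w) \<in> borel_measurable (lborel \<Otimes>\<^sub>M lborel)"
    unfolding Q_def by measurable
  have Q1: "(\<integral>\<^sup>+(t, w). Q t w \<partial>(lborel \<Otimes>\<^sub>M lborel)) = 1"
  proof -
    have "(\<integral>\<^sup>+x. ennreal (f x) \<partial>lborel) = 1"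
      using int nn by (simp add: nn_integral_eq_integral)
    then have "(\<integral>\<^sup>+w. Q t w \<partial>lborel) = indicator {0..1} t" for t
      unfolding Q_def
      by (simp add: nn_integral_multc nn_integral_lborel_translate(2)[of "\<lambda>x. ennreal (f x)"])
    then show ?thesis
      using lborel.nn_integral_fst[OF Qm] by simp
  qed
  define R where "R t w = ennreal (sqrt (f (P t - w))) * indicator {0..1} t" for t w
  have Rm[measurable]: "(\<lambda>(t, w). R t w) \<in> borel_measurable (lborel \<Otimes>\<^sub>M lborel)"
    unfolding R_def by measurable
  have RQ: "R t w * R t w = Q t w" for t w
    using nn[of "P t - w"] by (auto simp: R_def Q_def indicator_def simp flip: ennreal_mult)
  define I where "I = (\<integral>\<^sup>+(t, w). ennreal (norm (g w)) * Q t w \<partial>(lborel \<Otimes>\<^sub>M lborel))"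
  have I2: "I\<^sup>2 \<le> (\<integral>\<^sup>+(t, w). ennreal ((norm (g w))\<^sup>2) * Q t w \<partial>(lborel \<Otimes>\<^sub>M lborel))"
    using Cauchy_Schwarz_nn_integral[of "\<lambda>(t, w). ennreal (norm (g w)) * R t w" "lborel \<Otimes>\<^sub>M lborel" "\<lambda>(t, w). R t w"] Q1
    by (simp add: I_def case_prod_beta' power2_eq_square mult_ac RQ ennreal_mult)
  have "ennreal \<bar>(LINT w|lborel. v w * f (y - w)) - (LINT w|lborel. v w * f (x - w))\<bar>
      \<le> (\<integral>\<^sup>+t. ennreal \<bar>indicator {0..1} t * (LINT w|lborel. (g w \<bullet> u) * f (P t - w))\<bar> \<partial>lborel)"
    unfolding eq by (rule ennreal_abs_integral_le)
  also have "\<dots> \<le> (\<integral>\<^sup>+t. (\<integral>\<^sup>+w. ennreal (norm u) * (ennreal (norm (g w)) * Q t w) \<partial>lborel) \<partial>lborel)"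
  proof (intro nn_integral_mono)
    fix t :: real
    show "ennreal \<bar>indicator {0..1} t * (LINT w|lborel. (g w \<bullet> u) * f (P t - w))\<bar> \<le>
      (\<integral>\<^sup>+w. ennreal (norm u) * (ennreal (norm (g w)) * Q t w) \<partial>lborel)"
    proof (cases "t \<in> {0..1}")
      case True
      have "ennreal \<bar>LINT w|lborel. (g w \<bullet> u) * f (P t - w)\<bar> \<le> (\<integral>\<^sup>+w. ennreal \<bar>(g w \<bullet> u) * f (P t - w)\<bar> \<partial>lborel)"
        by (rule ennreal_abs_integral_le)
      also have "\<dots> \<le> (\<integral>\<^sup>+w. ennreal (norm u) * (ennreal (norm (g w)) * Q t w) \<partial>lborel)"
        using True nn Cauchy_Schwarz_ineq2[of _ u]
        by (intro nn_integral_mono)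
          (auto simp: Q_def abs_mult mult.assoc[symmetric] mult.commute[of "norm u"]
            intro!: ennreal_leI mult_right_mono simp flip: ennreal_mult)
      finally show ?thesis using True by simp
    qed simp
  qed
  also have "\<dots> = (\<integral>\<^sup>+t. ennreal (norm u) * (\<integral>\<^sup>+w. ennreal (norm (g w)) * Q t w \<partial>lborel) \<partial>lborel)"
    by (simp add: nn_integral_cmult Q_def)
  also have "\<dots> = ennreal (norm u) * (\<integral>\<^sup>+t. (\<integral>\<^sup>+w. ennreal (norm (g w)) * Q t w \<partial>lborel) \<partial>lborel)"
    unfolding Q_def by (rule nn_integral_cmult) measurable
  also have "(\<integral>\<^sup>+t. (\<integral>\<^sup>+w. ennreal (norm (g w)) * Q t w \<partial>lborel) \<partial>lborel) = I"
    using lborel.nn_integral_fst[of "\<lambda>(t, w). ennreal (norm (g w)) * Q t w" lborel] 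
    by (simp add: I_def)
  finally have "(ennreal \<bar>(LINT w|lborel. v w * f (y - w)) - (LINT w|lborel. v w * f (x - w))\<bar>)\<^sup>2
      \<le> (ennreal (norm u) * I)\<^sup>2"
    by (rule power_mono) simp
  also have "\<dots> = ennreal ((norm u)\<^sup>2) * I\<^sup>2"
    by (simp add: power_mult_distrib ennreal_power)
  also have "\<dots> \<le> ennreal ((norm u)\<^sup>2) * (\<integral>\<^sup>+(t, w). ennreal ((norm (g w))\<^sup>2) * Q t w \<partial>(lborel \<Otimes>\<^sub>M lborel))"
    by (intro mult_left_mono I2) simp
  also have "(\<integral>\<^sup>+(t, w). ennreal ((norm (g w))\<^sup>2) * Q t w \<partial>(lborel \<Otimes>\<^sub>M lborel)) =
      (\<integral>\<^sup>+t. (\<integral>\<^sup>+w. ennreal ((norm (g w))\<^sup>2) * Q t w \<partial>lborel) \<partial>lborel)"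
    using lborel.nn_integral_fst[of "\<lambda>(t, w). ennreal ((norm (g w))\<^sup>2) * Q t w" lborel] by simp
  also have "\<dots> = (\<integral>\<^sup>+t\<in>{0..1::real}.
        (\<integral>\<^sup>+w. ennreal ((norm (g w))\<^sup>2) * ennreal (f (x + t *\<^sub>R (y - x) - w)) \<partial>lborel) \<partial>lborel)"
    by (auto simp: Q_def P_def u_def indicator_def intro!: nn_integral_cong)
  finally show ?thesis by (simp add: u_def)
qed

text \<open>By approximation it suffices to treat the indicator of a set \<open>A\<close>. Take an
  open \<open>U\<close> around \<open>A\<close> with little excess, and inside it the closed set
  \<open>W n\<close> of points at distance at least \<open>1 / Suc n\<close> from the complement of
  \<open>U\<close>. A shift shorter than \<open>1 / Suc n\<close> changes the indicator only where
  the point or its translate lies in one of the small sets \<open>U - A\<close> and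
  \<open>U - W n\<close>.\<close>

lemma translation_L1_continuous:
  fixes v :: "'a::euclidean_space \<Rightarrow> real"
  assumes "integrable lborel v" "0 < e"
  shows "\<exists>d>0. \<forall>h. norm h < d \<longrightarrow> (\<integral>\<^sup>+x. ennreal \<bar>v (x - h) - v x\<bar> \<partial>lborel) \<le> ennreal e"
  using assms
proof (induction v arbitrary: e rule: integrable_induct)
  case (base A c)
  then have [measurable]: "A \<in> sets borel" by simp
  \<comment> \<open>Four integrals of indicators of measure below \<open>e'\<close> appear at the
    end; the added 1 covers \<open>c = 0\<close>.\<close>
  define e' where "e' = e / (4 * (\<bar>c\<bar> + 1))"
  have e': "e' > 0" using base by (simp add: e'_def)
  obtain U where U: "open U" "A \<subseteq> U" "emeasure lborel (U - A) < ennreal e'"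
    using outer_regular_lborel[OF _ e', of A] by auto
  have [measurable]: "U \<in> sets borel" using U by auto
  define W where "W n = {x. \<forall>y. y \<notin> U \<longrightarrow> 1 / Suc n \<le> dist x y}" for n
  have Wd: "1 / Suc n \<le> dist x y" if "x \<in> W n" "y \<notin> U" for x n y
    using that by (simp add: W_def)
  have "closed (W n)" for n
    unfolding W_def by (intro closed_Collect_all closed_Collect_imp closed_Collect_le continuous_intros) auto
  then have [measurable]: "W n \<in> sets borel" for n by auto
  have "emeasure lborel U \<le> emeasure lborel A + emeasure lborel (U - A)"
    using U by (intro order.trans[OF _ emeasure_subadditive] emeasure_mono) auto
  also have "\<dots> < \<infinity>" using base(2) order.strict_trans[OF U(3) ennreal_less_top] by simp
  finally have fin: "emeasure lborel U < \<infinity>" .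
  have "(\<lambda>n. emeasure lborel (U - W n)) \<longlonglongrightarrow> emeasure lborel (\<Inter>n. U - W n)"
  proof (rule Lim_emeasure_decseq)
    show "decseq (\<lambda>n. U - W n)"
    proof (intro decseq_SucI Diff_mono order.refl)
      fix n
      have "1 / real (Suc (Suc n)) \<le> 1 / real (Suc n)" by (simp add: field_simps)
      then show "W n \<subseteq> W (Suc n)" unfolding W_def by (auto intro: order.trans)
    qed
    show "emeasure lborel (U - W i) \<noteq> \<infinity>" for i
      using fin emeasure_mono[of "U - W i" U lborel] by auto
  qed auto
  also have "(\<Inter>n. U - W n) = {}"
  proof -
    have "\<exists>n. x \<in> W n" if xU: "x \<in> U" for x
    proof -
      obtain r where r: "r > 0" "ball x r \<subseteq> U" using U(1) xU open_contains_ball by metis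
      obtain n where "1 / Suc n < r" using nat_approx_posE[OF r(1)] by metis
      have "x \<in> W n" unfolding W_def
      proof (intro CollectI allI impI)
        fix y assume "y \<notin> U"
        then have "\<not> dist x y < r" using r(2) by auto
        then show "1 / real (Suc n) \<le> dist x y" using \<open>1 / Suc n < r\<close> by linarith
      qed
      then show ?thesis ..
    qed
    then show ?thesis by auto
  qed
  finally have "(\<lambda>n. emeasure lborel (U - W n)) \<longlonglongrightarrow> 0" by simp
  then have "eventually (\<lambda>n. emeasure lborel (U - W n) < ennreal e') sequentially"
    using e' by (intro order_tendstoD(2)) auto
  then obtain n where n: "emeasure lborel (U - W n) < ennreal e'"
    by (auto simp: eventually_sequentially)
  show ?case
  proof (intro exI[of _ "1 / Suc n"] conjI allI impI)
    fix h :: 'a assume h: "norm h < 1 / real (Suc n)"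
    let ?F = "\<lambda>x. indicator (U - A) x + indicator (U - W n) x :: ennreal"
    \<comment> \<open>If the indicator changes, one of the two points lies in \<open>A\<close>. The
      other one either stays in \<open>U\<close>, hence in \<open>U - A\<close>, or has left
      \<open>U\<close>, and then the first is too close to the complement to be in
      \<open>W n\<close>.\<close>
    have *: "ennreal \<bar>indicator A (x - h) *\<^sub>R c - indicator A x *\<^sub>R c\<bar> \<le> ennreal \<bar>c\<bar> * (?F x + ?F (x - h))" for x
    proof (cases "x \<in> A \<longleftrightarrow> x - h \<in> A")
      case False
      have "?F x + ?F (x - h) \<ge> 1"
      proof (cases "x \<in> A")
        case True
        then have "x - h \<notin> A" "x \<in> U" using False U by auto
        show ?thesis
        proof (cases "x - h \<in> U")
          case False
          then have "x \<notin> W n" using h Wd[of x n "x - h"] by (auto simp: dist_norm)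
          then show ?thesis using \<open>x \<in> U\<close> by (auto simp: indicator_def)
        qed (use \<open>x - h \<notin> A\<close> in \<open>auto simp: indicator_def\<close>)
      next
        case xA: False
        then have "x - h \<in> A" "x - h \<in> U" using False U by auto
        show ?thesis
        proof (cases "x \<in> U")
          case False
          then have "x - h \<notin> W n" using h Wd[of "x - h" n x] by (auto simp: dist_norm)
          then show ?thesis using \<open>x - h \<in> U\<close> by (auto simp: indicator_def)
        qed (use xA in \<open>auto simp: indicator_def\<close>)
      qed
      then have "ennreal \<bar>c\<bar> * 1 \<le> ennreal \<bar>c\<bar> * (?F x + ?F (x - h))" by (intro mult_left_mono) auto
      then show ?thesis using False by (auto simp: indicator_def)
    qed (auto simp: indicator_def)
    have "(\<integral>\<^sup>+x. ennreal \<bar>indicator A (x - h) *\<^sub>R c - indicator A x *\<^sub>R c\<bar> \<partial>lborel)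
        \<le> (\<integral>\<^sup>+x. ennreal \<bar>c\<bar> * (?F x + ?F (x - h)) \<partial>lborel)"
      by (intro nn_integral_mono *)
    also have "\<dots> = ennreal \<bar>c\<bar> * ((\<integral>\<^sup>+x. ?F x \<partial>lborel) + (\<integral>\<^sup>+x. ?F (x - h) \<partial>lborel))"
      by (subst nn_integral_cmult) (auto simp: nn_integral_add)
    also have "(\<integral>\<^sup>+x. ?F (x - h) \<partial>lborel) = (\<integral>\<^sup>+x. ?F x \<partial>lborel)"
      by (rule nn_integral_lborel_translate(1)) measurable
    also have "(\<integral>\<^sup>+x. ?F x \<partial>lborel) = emeasure lborel (U - A) + emeasure lborel (U - W n)"
      by (subst nn_integral_add) auto
    also have "ennreal \<bar>c\<bar> * (emeasure lborel (U - A) + emeasure lborel (U - W n) + 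
        (emeasure lborel (U - A) + emeasure lborel (U - W n))) \<le> ennreal \<bar>c\<bar> * (ennreal e' + ennreal e' + (ennreal e' + ennreal e'))"
      using U n by (intro mult_left_mono add_mono) auto
    also have "\<dots> = ennreal (\<bar>c\<bar> * (4 * e'))"
      using e' by (simp flip: ennreal_plus ennreal_mult)
    also have "\<dots> \<le> ennreal e"
      using base by (intro ennreal_leI) (simp add: e'_def field_simps)
    finally show "(\<integral>\<^sup>+x. ennreal \<bar>indicator A (x - h) *\<^sub>R c - indicator A x *\<^sub>R c\<bar> \<partial>lborel) \<le> ennreal e" .
  qed auto
next
  case (add f g)
  have [measurable]: "f \<in> borel_measurable borel" "g \<in> borel_measurable borel"
    using add.hyps by (auto dest: borel_measurable_integrable)
  obtain d1 d2 where d: "d1 > 0" "d2 > 0"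
    "\<And>h. norm h < d1 \<Longrightarrow> (\<integral>\<^sup>+x. ennreal \<bar>f (x - h) - f x\<bar> \<partial>lborel) \<le> ennreal (e / 2)"
    "\<And>h. norm h < d2 \<Longrightarrow> (\<integral>\<^sup>+x. ennreal \<bar>g (x - h) - g x\<bar> \<partial>lborel) \<le> ennreal (e / 2)"
    using add.IH(1)[of "e / 2"] add.IH(2)[of "e / 2"] add.prems by (auto)
  show ?case
  proof (intro exI[of _ "min d1 d2"] conjI allI impI)
    fix h :: 'a assume h: "norm h < min d1 d2"
    have "(\<integral>\<^sup>+x. ennreal \<bar>(f (x - h) + g (x - h)) - (f x + g x)\<bar> \<partial>lborel) \<le>
       (\<integral>\<^sup>+x. ennreal \<bar>f (x - h) - f x\<bar> + ennreal \<bar>g (x - h) - g x\<bar> \<partial>lborel)"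
      by (intro nn_integral_mono) (auto simp flip: ennreal_plus intro!: ennreal_leI)
    also have "\<dots> = (\<integral>\<^sup>+x. ennreal \<bar>f (x - h) - f x\<bar> \<partial>lborel) + (\<integral>\<^sup>+x. ennreal \<bar>g (x - h) - g x\<bar> \<partial>lborel)"
      by (rule nn_integral_add) auto
    also have "\<dots> \<le> ennreal (e / 2) + ennreal (e / 2)"
      using d h by (intro add_mono) auto
    also have "\<dots> = ennreal e" using add.prems by (simp flip: ennreal_plus)
    finally show "(\<integral>\<^sup>+x. ennreal \<bar>(f (x - h) + g (x - h)) - (f x + g x)\<bar> \<partial>lborel) \<le> ennreal e" .
  qed (use d in auto)
next
  case (lim f s)
  have [measurable]: "f \<in> borel_measurable borel" "\<And>i. s i \<in> borel_measurable borel"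
    using lim.hyps by (auto dest: borel_measurable_integrable)
  have "(\<lambda>i. \<integral>\<^sup>+x. ennreal (norm (f x - s i x)) \<partial>lborel) \<longlonglongrightarrow> 0"
  proof (rule Bochner_Integration.nn_integral_dominated_convergence_norm[where w="\<lambda>x. 2 * norm (f x)"])
    show "(\<integral>\<^sup>+x. ennreal (2 * norm (f x)) \<partial>lborel) < \<infinity>"
      using lim.hyps(4) by (simp add: integrable_iff_bounded ennreal_mult nn_integral_cmult ennreal_mult_less_top)
  qed (use lim.hyps in auto)
  then have "eventually (\<lambda>i. (\<integral>\<^sup>+x. ennreal (norm (s i x - f x)) \<partial>lborel) < ennreal (e / 3)) sequentially"
    using lim.prems by (intro order_tendstoD(2)[of _ 0]) (auto simp: abs_minus_commute)
  then obtain i where i: "(\<integral>\<^sup>+x. ennreal (norm (s i x - f x)) \<partial>lborel) < ennreal (e / 3)"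
    by (auto simp: eventually_sequentially)
  obtain d where d: "d > 0"
    "\<And>h. norm h < d \<Longrightarrow> (\<integral>\<^sup>+x. ennreal \<bar>s i (x - h) - s i x\<bar> \<partial>lborel) \<le> ennreal (e / 3)"
    using lim.IH[of "e / 3" i] lim.prems by auto
  show ?case
  proof (intro exI[of _ d] conjI allI impI)
    fix h :: 'a assume h: "norm h < d"
    have "(\<integral>\<^sup>+x. ennreal \<bar>f (x - h) - f x\<bar> \<partial>lborel) \<le>
       (\<integral>\<^sup>+x. (ennreal \<bar>s i (x - h) - f (x - h)\<bar> + ennreal \<bar>s i (x - h) - s i x\<bar>) + ennreal \<bar>s i x - f x\<bar> \<partial>lborel)"
      by (intro nn_integral_mono) (auto simp flip: ennreal_plus intro!: ennreal_leI)
    also have "\<dots> = ((\<integral>\<^sup>+x. ennreal \<bar>s i (x - h) - f (x - h)\<bar> \<partial>lborel) + (\<integral>\<^sup>+x. ennreal \<bar>s i (x - h) - s i x\<bar> \<partial>lborel))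
        + (\<integral>\<^sup>+x. ennreal \<bar>s i x - f x\<bar> \<partial>lborel)"
      by (simp add: nn_integral_add)
    also have "(\<integral>\<^sup>+x. ennreal \<bar>s i (x - h) - f (x - h)\<bar> \<partial>lborel) = (\<integral>\<^sup>+x. ennreal \<bar>s i x - f x\<bar> \<partial>lborel)"
      by (rule nn_integral_lborel_translate(1)[of "\<lambda>x. ennreal \<bar>s i x - f x\<bar>"]) measurable
    also have "(\<integral>\<^sup>+x. ennreal \<bar>s i x - f x\<bar> \<partial>lborel) + (\<integral>\<^sup>+x. ennreal \<bar>s i (x - h) - s i x\<bar> \<partial>lborel)
        + (\<integral>\<^sup>+x. ennreal \<bar>s i x - f x\<bar> \<partial>lborel) \<le> (ennreal (e / 3) + ennreal (e / 3)) + ennreal (e / 3)"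
      using d(2)[OF h] i by (intro add_mono) auto
    also have "\<dots> = ennreal e" using lim.prems by (simp flip: ennreal_plus)
    finally show "(\<integral>\<^sup>+x. ennreal \<bar>f (x - h) - f x\<bar> \<partial>lborel) \<le> ennreal e" .
  qed (use d in auto)
qed

text \<open>The mollified function is a mean of translates, weighted by a probability density
  supported where \<open>norm h < d\<close>. Each such translate is within \<open>e\<close> of
  \<open>v\<close> in the L1 sense, hence so is the mean.\<close>

lemma mollified_L1_approx:
  fixes v f :: "'a::euclidean_space \<Rightarrow> real"
  assumes v: "integrable lborel v"
    and d: "\<And>h. norm h < d \<Longrightarrow> (\<integral>\<^sup>+x. ennreal \<bar>v (x - h) - v x\<bar> \<partial>lborel) \<le> ennreal e"
    and f: "f \<in> borel_measurable borel" "\<And>x. 0 \<le> f x" "\<And>x. \<bar>f x\<bar> \<le> M"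
      "\<And>x. d \<le> norm x \<Longrightarrow> f x = 0" "integrable lborel f" "(LINT x|lborel. f x) = 1"
  shows "(\<integral>\<^sup>+x. ennreal \<bar>(LINT w|lborel. v w * f (x - w)) - v x\<bar> \<partial>lborel) \<le> ennreal e"
proof -
  note [measurable] = f(1)
  have [measurable]: "v \<in> borel_measurable borel" using v by (auto dest: borel_measurable_integrable)
  have f1: "(\<integral>\<^sup>+x. ennreal (f x) \<partial>lborel) = 1"
    using f by (simp add: nn_integral_eq_integral)
  have vf: "integrable lborel (\<lambda>w. v w * f (x - w))" for x
    by (rule integrable_mult_bounded[OF v, where C=M]) (use f in auto)
  have fx: "integrable lborel (\<lambda>w. f (x - w))" "(LINT w|lborel. f (x - w)) = 1" for x
  proof -
    have 1: "(\<integral>\<^sup>+w. ennreal (f (x - w)) \<partial>lborel) = 1"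
      using nn_integral_lborel_translate(2)[of "\<lambda>x. ennreal (f x)" x] f1 by simp
    then show "integrable lborel (\<lambda>w. f (x - w))"
      using f(2) by (intro integrableI_nonneg) auto
    show "(LINT w|lborel. f (x - w)) = 1"
      using 1 f(2) by (simp add: integral_eq_nn_integral)
  qed
  have "ennreal \<bar>(LINT w|lborel. v w * f (x - w)) - v x\<bar> \<le> (\<integral>\<^sup>+h. ennreal (f h) * ennreal \<bar>v (x - h) - v x\<bar> \<partial>lborel)" for x
  proof -
    have "(LINT w|lborel. v w * f (x - w)) - v x = (LINT w|lborel. v w * f (x - w) - v x * f (x - w))"
      using vf fx by simp
    then have "ennreal \<bar>(LINT w|lborel. v w * f (x - w)) - v x\<bar> \<le> (\<integral>\<^sup>+w. ennreal \<bar>v w * f (x - w) - v x * f (x - w)\<bar> \<partial>lborel)"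
      by (simp only: ennreal_abs_integral_le)
    also have "\<dots> = (\<integral>\<^sup>+w. ennreal (f (x - w)) * ennreal \<bar>v (x - (x - w)) - v x\<bar> \<partial>lborel)"
      using f(2) by (intro nn_integral_cong) (simp add: left_diff_distrib[symmetric] abs_mult mult.commute flip: ennreal_mult)
    also have "\<dots> = (\<integral>\<^sup>+h. ennreal (f h) * ennreal \<bar>v (x - h) - v x\<bar> \<partial>lborel)"
      by (rule nn_integral_lborel_translate(2)[of "\<lambda>h. ennreal (f h) * ennreal \<bar>v (x - h) - v x\<bar>"]) measurable
    finally show ?thesis .
  qed
  then have "(\<integral>\<^sup>+x. ennreal \<bar>(LINT w|lborel. v w * f (x - w)) - v x\<bar> \<partial>lborel) \<le>
     (\<integral>\<^sup>+x. (\<integral>\<^sup>+h. ennreal (f h) * ennreal \<bar>v (x - h) - v x\<bar> \<partial>lborel) \<partial>lborel)"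
    by (intro nn_integral_mono)
  also have "\<dots> = (\<integral>\<^sup>+h. (\<integral>\<^sup>+x. ennreal (f h) * ennreal \<bar>v (x - h) - v x\<bar> \<partial>lborel) \<partial>lborel)"
    by (rule lborel_pair.Fubini') measurable
  also have "\<dots> \<le> (\<integral>\<^sup>+h. ennreal (f h) * ennreal e \<partial>lborel)"
  proof (intro nn_integral_mono)
    fix h :: 'a
    show "(\<integral>\<^sup>+x. ennreal (f h) * ennreal \<bar>v (x - h) - v x\<bar> \<partial>lborel) \<le> ennreal (f h) * ennreal e"
    proof (cases "norm h < d")
      case True
      then show ?thesis using d by (simp add: nn_integral_cmult mult_left_mono)
    qed (use f(4) in simp)
  qed
  also have "\<dots> = ennreal e" using f1 by (simp add: nn_integral_multc)
  finally show ?thesis .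
qed

text \<open>For mollified functions this is \<open>mollified_increment\<close> integrated over all
  pairs, and the bound does not depend on the kernel. The mollified functions converge to
  \<open>v\<close> in the L1 sense, so a subsequence converges almost everywhere and Fatou's lemma
  transfers the bound. Nothing is required of \<open>v\<close> at the boundary of \<open>S\<close>,
  because all segments stay in the compact set \<open>T\<close>.\<close>

lemma weak_pair_inequality:
  fixes v :: "'a::euclidean_space \<Rightarrow> real" and g :: "'a \<Rightarrow> 'a"
  assumes v: "integrable lborel v" and g: "integrable lborel g"
    and weak: "\<And>\<phi> i. \<phi> \<in> test_functions S \<Longrightarrow> i \<in> Basis \<Longrightarrow>
      (LINT w|lborel. v w * partial_deriv i \<phi> w) = - (LINT w|lborel. (g w \<bullet> i) * \<phi> w)"
    and S: "open S" "compact T" "T \<subseteq> S"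
    and [measurable]: "A \<in> sets borel" "B \<in> sets borel"
    and seg: "\<And>x y. x \<in> A \<Longrightarrow> y \<in> B \<Longrightarrow> closed_segment x y \<subseteq> T"
    and h: "\<And>x y. x \<in> A \<Longrightarrow> y \<in> B \<Longrightarrow> dist x y \<le> h"
  shows "(\<integral>\<^sup>+x\<in>A. (\<integral>\<^sup>+y\<in>B. ennreal ((v x - v y)\<^sup>2) \<partial>lborel) \<partial>lborel) \<le>
    ennreal (h\<^sup>2 * 2 ^ DIM('a)) * (emeasure lborel A + emeasure lborel B) * (\<integral>\<^sup>+x. ennreal ((norm (g x))\<^sup>2) \<partial>lborel)"
    (is "_ \<le> ?C")
proof -
  have [measurable]: "v \<in> borel_measurable borel" "g \<in> borel_measurable borel"
    using v g by (auto dest: borel_measurable_integrable)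
  \<comment> \<open>Compactness of \<open>T\<close> yields one kernel radius that is admissible
    along all segments at once.\<close>
  obtain d where d: "d > 0" "\<And>p. p \<in> T \<Longrightarrow> cball p d \<subseteq> S"
  proof -
    obtain d where "d > 0" "(\<Union>x\<in>T. cball x d) \<subseteq> S"
      using compact_subset_open_imp_cball_epsilon_subset[OF S(2,1,3)] by auto
    then show ?thesis using that by blast
  qed
  have "\<forall>n. \<exists>f. f \<in> bump_algebra \<and> (\<forall>x. 0 \<le> f x) \<and> (\<forall>x. d \<le> norm x \<longrightarrow> f x = 0) \<and>
      integrable lborel f \<and> (LINT x|lborel. f x) = 1 \<and> 
      (\<integral>\<^sup>+x. ennreal \<bar>(LINT w|lborel. v w * f (x - w)) - v x\<bar> \<partial>lborel) \<le> ennreal ((1/2)^n)"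
  proof
    fix n :: nat
    obtain d' where d': "d' > 0" "\<And>h. norm h < d' \<Longrightarrow> (\<integral>\<^sup>+x. ennreal \<bar>v (x - h) - v x\<bar> \<partial>lborel) \<le> ennreal ((1/2)^n)"
      using translation_L1_continuous[OF v, of "(1/2)^n"] by auto
    obtain f :: "'a \<Rightarrow> real" where f: "f \<in> bump_algebra" "\<And>x. 0 \<le> f x" "\<And>x. min d d' \<le> norm x \<Longrightarrow> f x = 0"
      "integrable lborel f" "(LINT x|lborel. f x) = 1"
      using mollifier_exists[of "min d d'"] d d' by auto
    have "continuous_on UNIV f" using bump_algebra_k_times_cont_diff[OF f(1), of 0] by simp
    then have [measurable]: "f \<in> borel_measurable borel" by (rule borel_measurable_continuous_onI)
    obtain M where "\<And>x. \<bar>f x\<bar> \<le> M"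
      using bump_algebra_bounded[OF f(1,3)] by metis
    then have "(\<integral>\<^sup>+x. ennreal \<bar>(LINT w|lborel. v w * f (x - w)) - v x\<bar> \<partial>lborel) \<le> ennreal ((1/2)^n)"
      using f by (intro mollified_L1_approx[OF v d'(2), where M=M]) auto
    then show "\<exists>f. f \<in> bump_algebra \<and> (\<forall>x. 0 \<le> f x) \<and> (\<forall>x. d \<le> norm x \<longrightarrow> f x = 0) \<and>
      integrable lborel f \<and> (LINT x|lborel. f x) = 1 \<and> 
      (\<integral>\<^sup>+x. ennreal \<bar>(LINT w|lborel. v w * f (x - w)) - v x\<bar> \<partial>lborel) \<le> ennreal ((1/2)^n)"
      using f by (intro exI[of _ f]) auto
  qed
  from choice[OF this] obtain F where F: "\<And>n. F n \<in> bump_algebra" "\<And>n x. 0 \<le> F n x" "\<And>n x. d \<le> norm x \<Longrightarrow> F n x = 0"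
      "\<And>n. integrable lborel (F n)" "\<And>n. (LINT x|lborel. F n x) = 1"
      "\<And>n. (\<integral>\<^sup>+x. ennreal \<bar>(LINT w|lborel. v w * F n (x - w)) - v x\<bar> \<partial>lborel) \<le> ennreal ((1/2)^n)"
    by blast
  have "continuous_on UNIV (F n)" for n using bump_algebra_k_times_cont_diff[OF F(1), of 0] by simp
  then have [measurable]: "F n \<in> borel_measurable borel" for n by (rule borel_measurable_continuous_onI)
  define V where "V n x = (LINT w|lborel. v w * F n (x - w))" for n x
  have [measurable]: "V n \<in> borel_measurable borel" for n unfolding V_def by measurable
  have Vint: "integrable lborel (\<lambda>x. V n x - v x)" for n
    unfolding integrable_iff_bounded
    using F(6)[of n] by (auto simp: V_def intro: le_less_trans)
  have "(LINT x|lborel. norm (V n x - v x)) \<le> (1/2)^n" for n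
    using F(6)[of n] Vint[of n] unfolding V_def[symmetric]
    by (subst integral_eq_nn_integral) (auto intro!: enn2real_leI)
  then have "(\<lambda>n. (LINT x|lborel. norm (V n x - v x))) \<longlonglongrightarrow> 0"
    by (intro tendsto_sandwich[OF _ _ tendsto_const LIMSEQ_power_zero[of "1/2::real"]]
        always_eventually allI integral_nonneg) simp_all
  from tendsto_L1_AE_subseq[OF Vint this] obtain r where r: "strict_mono r"
    "AE x in lborel. (\<lambda>n. V (r n) x - v x) \<longlonglongrightarrow> 0" by blast
  define u where "u n x y = (ennreal \<bar>V (r n) y - V (r n) x\<bar>)\<^sup>2 * indicator B y * indicator A x" for n x y
  have um[measurable]: "(\<lambda>(x, y). u n x y) \<in> borel_measurable (borel \<Otimes>\<^sub>M borel)" for n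
    unfolding u_def by measurable
  have bound: "(\<integral>\<^sup>+x. (\<integral>\<^sup>+y. u n x y \<partial>lborel) \<partial>lborel) \<le> ?C" for n
  proof -
    define G where "G p = (\<integral>\<^sup>+w. ennreal ((norm (g w))\<^sup>2) * ennreal (F (r n) (p - w)) \<partial>lborel)" for p
    have [measurable]: "G \<in> borel_measurable borel" unfolding G_def by measurable
    have "u n x y \<le> ennreal (h\<^sup>2) * ((\<integral>\<^sup>+t\<in>{0..1::real}. G (x + t *\<^sub>R (y - x)) \<partial>lborel) * indicator B y * indicator A x)" for x y
    proof (cases "x \<in> A \<and> y \<in> B")
      case True
      then have "u n x y = (ennreal \<bar>V (r n) y - V (r n) x\<bar>)\<^sup>2" by (simp add: u_def)
      also have "\<dots> \<le> ennreal ((norm (y - x))\<^sup>2) * (\<integral>\<^sup>+t\<in>{0..1::real}. G (x + t *\<^sub>R (y - x)) \<partial>lborel)"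
        unfolding V_def G_def
        by (rule mollified_increment[OF v g weak F(1) F(3) F(2) F(4) F(5)]) (use d(2) seg True in auto)
      also have "\<dots> \<le> ennreal (h\<^sup>2) * (\<integral>\<^sup>+t\<in>{0..1::real}. G (x + t *\<^sub>R (y - x)) \<partial>lborel)"
        using h[of x y] True
        by (intro mult_right_mono ennreal_leI power_mono) (auto simp: dist_norm norm_minus_commute)
      finally show ?thesis using True by simp
    qed (auto simp: u_def)
    then have "(\<integral>\<^sup>+x. (\<integral>\<^sup>+y. u n x y \<partial>lborel) \<partial>lborel) \<le>
      (\<integral>\<^sup>+x. (\<integral>\<^sup>+y. ennreal (h\<^sup>2) * ((\<integral>\<^sup>+t\<in>{0..1::real}. G (x + t *\<^sub>R (y - x)) \<partial>lborel) * indicator B y * indicator A x) \<partial>lborel) \<partial>lborel)"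
      by (intro nn_integral_mono)
    also have "\<dots> = ennreal (h\<^sup>2) * (\<integral>\<^sup>+x\<in>A. (\<integral>\<^sup>+y\<in>B. (\<integral>\<^sup>+t\<in>{0..1::real}. G (x + t *\<^sub>R (y - x)) \<partial>lborel) \<partial>lborel) \<partial>lborel)"
      by (simp add: nn_integral_cmult nn_integral_multc)
    also have "\<dots> \<le> ennreal (h\<^sup>2) * (ennreal (2 ^ DIM('a)) * (emeasure lborel A + emeasure lborel B) * (\<integral>\<^sup>+x. G x \<partial>lborel))"
      by (intro mult_left_mono nn_integral_segments_le) auto
    also have "(\<integral>\<^sup>+x. G x \<partial>lborel) = (\<integral>\<^sup>+x. ennreal ((norm (g x))\<^sup>2) \<partial>lborel)"
      unfolding G_def by (rule nn_integral_mollified) (use F in auto)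
    finally show ?thesis by (simp add: ennreal_mult mult_ac)
  qed
  \<comment> \<open>Fatou is applied twice: here in \<open>y\<close> for almost every fixed
    \<open>x\<close>, and afterwards in \<open>x\<close>.\<close>
  have lim: "AE x in lborel. (\<integral>\<^sup>+y. ennreal ((v x - v y)\<^sup>2) * indicator B y \<partial>lborel) * indicator A x
      \<le> liminf (\<lambda>n. \<integral>\<^sup>+y. u n x y \<partial>lborel)"
    using r(2)
  proof eventually_elim
    case (elim x)
    then have x: "(\<lambda>n. V (r n) x) \<longlonglongrightarrow> v x" by (simp add: LIM_zero_iff)
    have "(\<integral>\<^sup>+y. ennreal ((v x - v y)\<^sup>2) * indicator B y \<partial>lborel) * indicator A x
        = (\<integral>\<^sup>+y. ennreal ((v x - v y)\<^sup>2) * indicator B y * indicator A x \<partial>lborel)"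
      by (simp add: nn_integral_multc)
    also have "\<dots> = (\<integral>\<^sup>+y. liminf (\<lambda>n. u n x y) \<partial>lborel)"
    proof (intro nn_integral_cong_AE)
      show "AE y in lborel. ennreal ((v x - v y)\<^sup>2) * indicator B y * indicator A x = liminf (\<lambda>n. u n x y)"
        using r(2)
      proof eventually_elim
        case (elim y)
        then have "(\<lambda>n. V (r n) y) \<longlonglongrightarrow> v y" by (simp add: LIM_zero_iff)
        then have "(\<lambda>n. ennreal (\<bar>V (r n) y - V (r n) x\<bar>\<^sup>2)) \<longlonglongrightarrow> ennreal (\<bar>v y - v x\<bar>\<^sup>2)"
          using x by (intro tendsto_intros tendsto_ennrealI)
        then have "(\<lambda>n. u n x y) \<longlonglongrightarrow> ennreal ((v x - v y)\<^sup>2) * indicator B y * indicator A x"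
          by (auto simp: u_def ennreal_power power2_commute[of "v x"] indicator_def)
        from lim_imp_Liminf[OF _ this] show ?case by simp
      qed
    qed
    also have "\<dots> \<le> liminf (\<lambda>n. \<integral>\<^sup>+y. u n x y \<partial>lborel)"
      by (rule nn_integral_liminf) measurable
    finally show ?case .
  qed
  have "(\<integral>\<^sup>+x\<in>A. (\<integral>\<^sup>+y\<in>B. ennreal ((v x - v y)\<^sup>2) \<partial>lborel) \<partial>lborel) \<le>
      (\<integral>\<^sup>+x. liminf (\<lambda>n. \<integral>\<^sup>+y. u n x y \<partial>lborel) \<partial>lborel)"
    by (intro nn_integral_mono_AE lim)
  also have "\<dots> \<le> liminf (\<lambda>n. \<integral>\<^sup>+x. (\<integral>\<^sup>+y. u n x y \<partial>lborel) \<partial>lborel)"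
    by (rule nn_integral_liminf) measurable
  also have "\<dots> \<le> ?C"
    using bound by (intro Liminf_le always_eventually) auto
  finally show ?thesis .
qed

subsection \<open>The Poincare inequality on star-shaped cells\<close>

lemma emeasure_lborel_ball_plane:
  fixes c :: point
  assumes "0 \<le> r" shows "emeasure lborel (ball c r) = ennreal (pi * r\<^sup>2)"
  using assms by (simp add: emeasure_ball unit_ball_vol_2)

text \<open>The ball is the image of the open star disc under the homothety with centre
  \<open>x\<close> and ratio \<open>t\<close>, which moves each point along a segment contained in
  \<open>K\<close>.\<close>

lemma star_shaped_ball_subset:
  assumes K: "star_shaped_wrt_disc K m r" and x: "x \<in> K" and t: "0 \<le> t" "t \<le> 1"
  shows "ball (x + t *\<^sub>R (m - x)) (t * r) \<subseteq> K"
proof (cases "t = 0")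
  case False
  then have t0: "t > 0" using t by simp
  show ?thesis
  proof
    fix q assume q: "q \<in> ball (x + t *\<^sub>R (m - x)) (t * r)"
    define y where "y = x + (1 / t) *\<^sub>R (q - x)"
    have "t *\<^sub>R (y - m) = q - (x + t *\<^sub>R (m - x))"
      using t0 by (simp add: y_def algebra_simps)
    then have "t * norm (y - m) < t * r"
      using q t0 by (metis abs_of_pos dist_commute dist_norm mem_ball norm_scaleR)
    then have y: "y \<in> cball m r" using t0 by (simp add: dist_norm norm_minus_commute)
    have "q = (1 - (1 - t)) *\<^sub>R y + (1 - t) *\<^sub>R x"
      using t0 by (simp add: y_def algebra_simps)
    then have "q \<in> closed_segment y x"
      unfolding in_segment using t by (intro exI[of _ "1 - t"]) auto
    then show "q \<in> K" using K x y unfolding star_shaped_wrt_disc_def by blast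
  qed
qed simp

lemma star_shaped_interior:
  assumes K: "star_shaped_wrt_disc K m r" and x: "x \<in> K" and t: "0 < t" "t \<le> 1"
  shows "x + t *\<^sub>R (m - x) \<in> interior K"
proof -
  have "0 < t * r" using K t by (simp add: star_shaped_wrt_disc_def)
  then show ?thesis
    using star_shaped_ball_subset[OF K x, of t] t by (meson centre_in_ball interiorI less_imp_le open_ball)
qed

text \<open>Origin of the constant: \<open>weak_pair_inequality\<close> contributes
  \<open>2 ^ 2 * h^2\<close> times the sum of the areas of cell and disc, and averaging over the
  disc divides by its area \<open>b\<close>. The cell has area at most \<open>pi * h^2\<close>,
  which is at most \<open>4 * \<sigma>^2 * b\<close> because \<open>h \<le> \<sigma> * r\<close> and
  the disc has radius \<open>r / 2\<close>.\<close>

lemma star_poincare: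
  fixes v :: "point \<Rightarrow> real" and g :: "point \<Rightarrow> point"
  assumes v: "integrable lborel v" and v2: "(\<integral>\<^sup>+x. ennreal ((v x)\<^sup>2) \<partial>lborel) < \<infinity>"
    and g: "integrable lborel g"
    and weak: "\<And>\<phi> i. \<phi> \<in> test_functions S \<Longrightarrow> i \<in> Basis \<Longrightarrow>
      (LINT w|lborel. v w * partial_deriv i \<phi> w) = - (LINT w|lborel. (g w \<bullet> i) * \<phi> w)"
    and S: "open S" "interior K \<subseteq> S"
    and K: "compact K" "star_shaped_wrt_disc K m r" "m \<in> K" "diameter K \<le> h" "h \<le> \<sigma> * r"
  shows "\<exists>c. (\<integral>\<^sup>+x\<in>interior K. ennreal ((v x - c)\<^sup>2) \<partial>lborel) \<le>
     ennreal (4 * (4 * \<sigma>\<^sup>2 + 1) * h\<^sup>2) * (\<integral>\<^sup>+x. ennreal ((norm (g x))\<^sup>2) \<partial>lborel)"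
proof -
  have [measurable]: "v \<in> borel_measurable borel" "g \<in> borel_measurable borel"
    using v g by (auto dest: borel_measurable_integrable)
  have r: "r > 0" using K by (simp add: star_shaped_wrt_disc_def)
  have bK: "bounded K" using K compact_imp_bounded by blast
  have h0: "h \<ge> 0" using diameter_ge_0[OF bK] K by linarith
  \<comment> \<open>Half the radius, so that \<open>B\<close> also lies in the contracted star discs
    of all the copies \<open>T n\<close>, whose ratios are at least 1/2.\<close>
  define B where "B = ball m (r / 2)"
  have [measurable]: "B \<in> sets borel" by (simp add: B_def)
  define b where "b = pi * (r / 2)\<^sup>2"
  have b: "b > 0" "emeasure lborel B = ennreal b"
    using r emeasure_lborel_ball_plane[of "r / 2" m] by (simp_all add: b_def B_def)
  define c where "c = (LINT y:B|lborel. v y) / b"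
  let ?G = "\<integral>\<^sup>+x. ennreal ((norm (g x))\<^sup>2) \<partial>lborel"
  let ?C = "ennreal (4 * (4 * \<sigma>\<^sup>2 + 1) * h\<^sup>2) * ?G"
  \<comment> \<open>Copies of \<open>K\<close> contracted towards \<open>m\<close>. They are compact
    in the interior of \<open>K\<close>, as mollification inside \<open>S\<close> demands, and they
    exhaust that interior. The offset 2 makes the first ratio 1/2.\<close>
  define T where "T n = (\<lambda>x. m + (1 - 1 / real (n + 2)) *\<^sub>R (x - m)) ` K" for n :: nat
  define l where "l n = 1 - 1 / real (n + 2)" for n :: nat
  have l: "1/2 \<le> l n" "l n < 1" "0 < l n" for n by (auto simp: l_def field_simps)
  have Tl: "T n = (\<lambda>x. m + l n *\<^sub>R (x - m)) ` K" for n by (simp add: T_def l_def)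
  have cT: "compact (T n)" for n
    unfolding Tl using K by (intro compact_continuous_image continuous_intros)
  then have [measurable]: "T n \<in> sets borel" for n by (simp add: borel_closed compact_imp_closed)
  have Tint: "T n \<subseteq> interior K" for n
  proof
    fix y assume "y \<in> T n"
    then obtain x where x: "x \<in> K" "y = m + l n *\<^sub>R (x - m)" by (auto simp: Tl)
    have "x + (1 - l n) *\<^sub>R (m - x) \<in> interior K"
      by (rule star_shaped_interior[OF K(2) x(1)]) (use l[of n] in auto)
    then show "y \<in> interior K" by (simp add: x algebra_simps)
  qed
  have seg: "closed_segment x y \<subseteq> T n" if x: "x \<in> T n" and y: "y \<in> B" for x y n
  proof -
    obtain x' where x': "x' \<in> K" "x = m + l n *\<^sub>R (x' - m)" using x by (auto simp: Tl)
    define y' where "y' = m + (1 / l n) *\<^sub>R (y - m)"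
    have y'2: "y = m + l n *\<^sub>R (y' - m)" using l(3)[of n] by (simp add: y'_def)
    have "norm (y - m) < r / 2" using y by (simp add: B_def dist_norm norm_minus_commute)
    also have "\<dots> \<le> r * l n" using l(1)[of n] r by (simp add: field_simps)
    finally have "norm (y - m) / l n \<le> r" using l(3)[of n] by (simp add: pos_divide_le_eq)
    moreover have "norm (y' - m) = norm (y - m) / l n" using l(3)[of n] by (simp add: y'_def)
    ultimately have "norm (y' - m) \<le> r" by simp
    then have "y' \<in> cball m r" by (simp add: dist_norm norm_minus_commute)
    then have sK: "closed_segment y' x' \<subseteq> K" using K(2) x'(1) by (simp add: star_shaped_wrt_disc_def)
    show ?thesis
    proof
      fix p assume "p \<in> closed_segment x y"
      then obtain u where u: "0 \<le> u" "u \<le> 1" "p = (1 - u) *\<^sub>R x + u *\<^sub>R y" by (auto simp: in_segment)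
      have "(1 - u) *\<^sub>R x' + u *\<^sub>R y' \<in> K"
        using sK u unfolding closed_segment_commute[of y'] by (force simp: in_segment)
      moreover have "p = m + l n *\<^sub>R (((1 - u) *\<^sub>R x' + u *\<^sub>R y') - m)"
        by (simp add: u x' y'2 algebra_simps)
      ultimately show "p \<in> T n" unfolding Tl by (intro image_eqI)
    qed
  qed
  have mK: "B \<subseteq> K"
    using star_shaped_ball_subset[OF K(2) K(3), of 1] r unfolding B_def by (auto simp: subset_iff)
  have KsB: "K \<subseteq> cball m h"
    using diameter_bounded_bound[OF bK K(3)] K(4) by force
  have eT: "emeasure lborel (T n) \<le> ennreal (pi * h\<^sup>2)" for n
  proof -
    have "emeasure lborel (T n) \<le> emeasure lborel (cball m h)"
      using Tint[of n] interior_subset[of K] KsB by (intro emeasure_mono) auto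
    also have "\<dots> = ennreal (pi * h\<^sup>2)" using h0 by (simp add: emeasure_cball unit_ball_vol_2)
    finally show ?thesis .
  qed
  have vB: "set_integrable lborel B v"
    using v unfolding set_integrable_def by (intro integrable_mult_indicator) auto
  \<comment> \<open>\<open>v x - c\<close> is the mean over \<open>B\<close> of
    \<open>v x - v y\<close>; Cauchy-Schwarz against the indicator of \<open>B\<close> gives the
    square.\<close>
  have jensen: "ennreal ((v x - c)\<^sup>2) * ennreal b \<le> (\<integral>\<^sup>+y\<in>B. ennreal ((v x - v y)\<^sup>2) \<partial>lborel)" for x
  proof -
    have cB: "set_integrable lborel B (\<lambda>_. v x)"
      unfolding set_integrable_def using b by (intro integrable_scaleR_left integrable_real_indicator) auto
    have "(LINT y:B|lborel. v x - v y) = (LINT y:B|lborel. v x) - (LINT y:B|lborel. v y)"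
      by (rule set_integral_diff(2)[OF cB vB])
    also have "(LINT y:B|lborel. v x) = b * v x"
      using b by (simp add: set_lebesgue_integral_def measure_def)
    also have "b * v x - (LINT y:B|lborel. v y) = b * (v x - c)"
      using b by (simp add: c_def field_simps)
    finally have eq: "b * (v x - c) = (LINT y|lborel. indicator B y *\<^sub>R (v x - v y))"
      by (simp add: set_lebesgue_integral_def)
    have "ennreal (b * \<bar>v x - c\<bar>) = ennreal \<bar>LINT y|lborel. indicator B y *\<^sub>R (v x - v y)\<bar>"
      unfolding eq[symmetric] using b by (simp add: abs_mult)
    also have "\<dots> \<le> (\<integral>\<^sup>+y. ennreal \<bar>indicator B y *\<^sub>R (v x - v y)\<bar> \<partial>lborel)"
      by (rule ennreal_abs_integral_le)
    also have "\<dots> = (\<integral>\<^sup>+y. (ennreal \<bar>v x - v y\<bar> * indicator B y) * indicator B y \<partial>lborel)"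
      by (intro nn_integral_cong) (auto simp: indicator_def)
    finally have "(ennreal (b * \<bar>v x - c\<bar>))\<^sup>2 \<le> (\<integral>\<^sup>+y. (ennreal \<bar>v x - v y\<bar> * indicator B y) * indicator B y \<partial>lborel)\<^sup>2"
      by (rule power_mono) simp
    also have "\<dots> \<le> (\<integral>\<^sup>+y. (ennreal \<bar>v x - v y\<bar> * indicator B y)\<^sup>2 \<partial>lborel) * (\<integral>\<^sup>+y. (indicator B y)\<^sup>2 \<partial>lborel)"
      by (rule Cauchy_Schwarz_nn_integral) measurable
    also have "(\<integral>\<^sup>+y. (ennreal \<bar>v x - v y\<bar> * indicator B y)\<^sup>2 \<partial>lborel) = (\<integral>\<^sup>+y\<in>B. ennreal ((v x - v y)\<^sup>2) \<partial>lborel)"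
      by (intro nn_integral_cong) (auto simp: indicator_def ennreal_power)
    also have "(\<integral>\<^sup>+y. (indicator B y)\<^sup>2 \<partial>lborel) = (\<integral>\<^sup>+y. indicator B y \<partial>lborel)"
      by (intro nn_integral_cong) (auto simp: indicator_def)
    also have "\<dots> = ennreal b" using b by simp
    also have "(ennreal (b * \<bar>v x - c\<bar>))\<^sup>2 = ennreal b * (ennreal ((v x - c)\<^sup>2) * ennreal b)"
    proof -
      have "(ennreal (b * \<bar>v x - c\<bar>))\<^sup>2 = ennreal (b * ((v x - c)\<^sup>2 * b))"
        using b by (simp add: ennreal_power power_mult_distrib power2_eq_square[of b] mult_ac)
      then show ?thesis using b by (simp add: ennreal_mult)
    qed
    finally have "ennreal b * (ennreal ((v x - c)\<^sup>2) * ennreal b) \<le> ennreal b * (\<integral>\<^sup>+y\<in>B. ennreal ((v x - v y)\<^sup>2) \<partial>lborel)"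
      by (simp only: mult.commute[of _ "ennreal b"])
    then show ?thesis
      using b by (subst (asm) ennreal_mult_le_mult_iff) auto
  qed
  have T_bound: "(\<integral>\<^sup>+x\<in>T n. ennreal ((v x - c)\<^sup>2) \<partial>lborel) \<le> ?C" for n
  proof -
    have "(\<integral>\<^sup>+x\<in>T n. ennreal ((v x - c)\<^sup>2) \<partial>lborel) * ennreal b =
        (\<integral>\<^sup>+x. (ennreal ((v x - c)\<^sup>2) * ennreal b) * indicator (T n) x \<partial>lborel)"
      by (subst nn_integral_multc[symmetric]) (auto intro!: nn_integral_cong simp: mult_ac)
    also have "\<dots> \<le> (\<integral>\<^sup>+x\<in>T n. (\<integral>\<^sup>+y\<in>B. ennreal ((v x - v y)\<^sup>2) \<partial>lborel) \<partial>lborel)"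
      by (intro nn_integral_mono mult_right_mono jensen) auto
    also have "\<dots> \<le> ennreal (h\<^sup>2 * 2 ^ DIM(point)) * (emeasure lborel (T n) + emeasure lborel B) * ?G"
    proof (rule weak_pair_inequality[OF v g weak S(1) cT[of n]])
      show "T n \<subseteq> S" using Tint S by blast
      show "dist x y \<le> h" if "x \<in> T n" "y \<in> B" for x y
      proof -
        have "x \<in> K" "y \<in> K" using that Tint interior_subset mK by blast+
        then show ?thesis using diameter_bounded_bound[OF bK] K(4) by fastforce
      qed
    qed (use seg in auto)
    also have "\<dots> \<le> ennreal (h\<^sup>2 * 4) * (ennreal (pi * h\<^sup>2) + ennreal b) * ?G"
      using eT[of n] b by (intro mult_right_mono mult_mono add_mono) auto
    also have "\<dots> \<le> ennreal (h\<^sup>2 * 4) * ennreal ((4 * \<sigma>\<^sup>2 + 1) * b) * ?G"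
    proof (intro mult_right_mono mult_left_mono)
      have "h\<^sup>2 \<le> (\<sigma> * r)\<^sup>2" using K(5) h0 by (rule power_mono)
      then have "pi * h\<^sup>2 \<le> pi * (\<sigma> * r)\<^sup>2" by (intro mult_left_mono) auto
      also have "\<dots> = 4 * \<sigma>\<^sup>2 * b" by (simp add: b_def power_mult_distrib power_divide)
      finally have "pi * h\<^sup>2 + b \<le> (4 * \<sigma>\<^sup>2 + 1) * b" by (simp add: algebra_simps)
      then show "ennreal (pi * h\<^sup>2) + ennreal b \<le> ennreal ((4 * \<sigma>\<^sup>2 + 1) * b)"
        using b by (simp flip: ennreal_plus)
    qed auto
    also have "ennreal (h\<^sup>2 * 4) * ennreal ((4 * \<sigma>\<^sup>2 + 1) * b) = ennreal (4 * (4 * \<sigma>\<^sup>2 + 1) * h\<^sup>2) * ennreal b"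
      using b by (subst (1 2) ennreal_mult[symmetric]) (auto simp: mult_ac)
    also have "\<dots> * ?G = ?C * ennreal b" by (simp only: mult_ac)
    finally show ?thesis
      using b by (simp add: mult.commute[of _ "ennreal b"] ennreal_mult_le_mult_iff)
  qed
  \<comment> \<open>Each interior point belongs to \<open>T n\<close> for all large
    \<open>n\<close>, so Fatou carries the bound on the \<open>T n\<close>, uniform in
    \<open>n\<close>, over to the interior.\<close>
  have "(\<integral>\<^sup>+x\<in>interior K. ennreal ((v x - c)\<^sup>2) \<partial>lborel)
      \<le> (\<integral>\<^sup>+x. liminf (\<lambda>n. ennreal ((v x - c)\<^sup>2) * indicator (T n) x) \<partial>lborel)"
  proof (intro nn_integral_mono)
    fix x
    show "ennreal ((v x - c)\<^sup>2) * indicator (interior K) x \<le> liminf (\<lambda>n. ennreal ((v x - c)\<^sup>2) * indicator (T n) x)"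
    proof (cases "x \<in> interior K")
      case True
      have "(\<lambda>n. 1 / real (n + 2)) \<longlonglongrightarrow> 0"
        using LIMSEQ_ignore_initial_segment[OF lim_1_over_n, of 2] by simp
      then have "l \<longlonglongrightarrow> 1 - 0"
        unfolding l_def by (intro tendsto_diff tendsto_const)
      then have "(\<lambda>n. m + (1 / l n) *\<^sub>R (x - m)) \<longlonglongrightarrow> m + (1 / 1) *\<^sub>R (x - m)"
        by (intro tendsto_intros) auto
      then have "(\<lambda>n. m + (1 / l n) *\<^sub>R (x - m)) \<longlonglongrightarrow> x" by simp
      from topological_tendstoD[OF this open_interior True]
      have "eventually (\<lambda>n. x \<in> T n) sequentially"
      proof eventually_elim
        case (elim n)
        then have "m + (1 / l n) *\<^sub>R (x - m) \<in> K" using interior_subset by blast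
        then show ?case unfolding Tl
          by (rule rev_image_eqI) (use l(3)[of n] in simp)
      qed
      then show ?thesis
        using True by (intro Liminf_bounded) (auto elim!: eventually_mono)
    qed simp
  qed
  also have "\<dots> \<le> liminf (\<lambda>n. \<integral>\<^sup>+x\<in>T n. ennreal ((v x - c)\<^sup>2) \<partial>lborel)"
    by (rule nn_integral_liminf) measurable
  also have "\<dots> \<le> ?C"
    using T_bound by (intro Liminf_le always_eventually) auto
  finally show ?thesis by blast
qed

subsection \<open>Gluing along overlaps\<close>

text \<open>An arbitrary constant takes the place of the mean. This makes the notion monotone in the
  set and lets gluing keep the constant of one side; the mean returns only in
  \<open>L2_norm_minus_mean_le\<close>.\<close>

definition osc_le :: "('a::euclidean_space \<Rightarrow> real) \<Rightarrow> 'a set \<Rightarrow> ennreal \<Rightarrow> bool" where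
  "osc_le v A M \<longleftrightarrow> (\<exists>c. (\<integral>\<^sup>+x\<in>A. ennreal ((v x - c)\<^sup>2) \<partial>lborel) \<le> M)"

lemma osc_le_mono: "osc_le v A M \<Longrightarrow> B \<subseteq> A \<Longrightarrow> M \<le> M' \<Longrightarrow> osc_le v B M'"
proof -
  assume "osc_le v A M" and sub: "B \<subseteq> A" "M \<le> M'"
  then obtain c where c: "(\<integral>\<^sup>+x\<in>A. ennreal ((v x - c)\<^sup>2) \<partial>lborel) \<le> M" by (auto simp: osc_le_def)
  have "(\<integral>\<^sup>+x\<in>B. ennreal ((v x - c)\<^sup>2) \<partial>lborel) \<le> (\<integral>\<^sup>+x\<in>A. ennreal ((v x - c)\<^sup>2) \<partial>lborel)"
    using sub by (intro nn_integral_mono) (auto simp: indicator_def)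
  with c sub show ?thesis unfolding osc_le_def by (meson order.trans)
qed

text \<open>The constants \<open>c\<close> and \<open>d\<close> of the two sets are compared on the
  overlap, where both approximate \<open>v\<close>: the square of \<open>c - d\<close> times the
  measure of the overlap is at most \<open>2 * (a + b) * Z\<close>. The factor \<open>R\<close>
  extends this to all of \<open>B\<close>, and replacing \<open>d\<close> by \<open>c\<close> on
  \<open>B\<close> costs \<open>2 * b + 4 * R * (a + b)\<close>.\<close>

lemma osc_le_Un:
  fixes v :: "'a::euclidean_space \<Rightarrow> real"
  assumes [measurable]: "v \<in> borel_measurable borel" "A \<in> sets borel" "B \<in> sets borel"
    and A: "osc_le v A (ennreal a * Z)" and B: "osc_le v B (ennreal b * Z)"
    and ab: "0 \<le> a" "0 \<le> b" "0 \<le> R"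
    and R: "emeasure lborel B \<le> ennreal R * emeasure lborel (A \<inter> B)"
    and fin: "emeasure lborel B < \<infinity>"
  shows "osc_le v (A \<union> B) (ennreal (a + 2 * b + 4 * R * (a + b)) * Z)"
proof -
  obtain c where c: "(\<integral>\<^sup>+x\<in>A. ennreal ((v x - c)\<^sup>2) \<partial>lborel) \<le> ennreal a * Z"
    using A by (auto simp: osc_le_def)
  obtain d where d: "(\<integral>\<^sup>+x\<in>B. ennreal ((v x - d)\<^sup>2) \<partial>lborel) \<le> ennreal b * Z"
    using B by (auto simp: osc_le_def)
  have sq: "(p + q)\<^sup>2 \<le> 2 * p\<^sup>2 + 2 * q\<^sup>2" for p q :: real
    using sum_squares_bound[of p q] by (simp add: power2_sum)
  let ?e = "ennreal ((c - d)\<^sup>2)"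
  have "?e * emeasure lborel (A \<inter> B) = (\<integral>\<^sup>+x. ?e * indicator (A \<inter> B) x \<partial>lborel)"
    by (simp add: nn_integral_cmult)
  also have "\<dots> \<le> (\<integral>\<^sup>+x. 2 * (ennreal ((v x - c)\<^sup>2) * indicator A x) + 2 * (ennreal ((v x - d)\<^sup>2) * indicator B x) \<partial>lborel)"
  proof (intro nn_integral_mono)
    fix x
    have "ennreal ((c - d)\<^sup>2) \<le> ennreal (2 * (v x - c)\<^sup>2 + 2 * (v x - d)\<^sup>2)"
      using sq[of "c - v x" "v x - d"] by (intro ennreal_leI) (simp add: power2_commute[of c])
    also have "\<dots> = 2 * ennreal ((v x - c)\<^sup>2) + 2 * ennreal ((v x - d)\<^sup>2)"
      by (simp add: ennreal_mult)
    finally show "?e * indicator (A \<inter> B) x \<le>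
        2 * (ennreal ((v x - c)\<^sup>2) * indicator A x) + 2 * (ennreal ((v x - d)\<^sup>2) * indicator B x)"
      by (auto simp: indicator_def)
  qed
  also have "\<dots> = 2 * (\<integral>\<^sup>+x\<in>A. ennreal ((v x - c)\<^sup>2) \<partial>lborel) + 2 * (\<integral>\<^sup>+x\<in>B. ennreal ((v x - d)\<^sup>2) \<partial>lborel)"
    by (simp add: nn_integral_add nn_integral_cmult)
  also have "\<dots> \<le> 2 * (ennreal a * Z) + 2 * (ennreal b * Z)"
    using c d by (intro add_mono mult_left_mono) auto
  also have "\<dots> = ennreal (2 * (a + b)) * Z"
    using ab by (simp add: ennreal_mult distrib_left distrib_right mult_ac)
  finally have 1: "?e * emeasure lborel (A \<inter> B) \<le> ennreal (2 * (a + b)) * Z" .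
  have "?e * emeasure lborel B \<le> ?e * (ennreal R * emeasure lborel (A \<inter> B))"
    using R by (intro mult_left_mono) auto
  also have "\<dots> = ennreal R * (?e * emeasure lborel (A \<inter> B))" by (simp only: mult_ac)
  also have "\<dots> \<le> ennreal R * (ennreal (2 * (a + b)) * Z)" using 1 by (intro mult_left_mono) auto
  finally have 2: "?e * emeasure lborel B \<le> ennreal R * (ennreal (2 * (a + b)) * Z)" .
  have "(\<integral>\<^sup>+x\<in>A \<union> B. ennreal ((v x - c)\<^sup>2) \<partial>lborel) \<le>
     (\<integral>\<^sup>+x. ennreal ((v x - c)\<^sup>2) * indicator A x + (2 * (ennreal ((v x - d)\<^sup>2) * indicator B x) + 2 * (?e * indicator B x)) \<partial>lborel)"
  proof (intro nn_integral_mono)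
    fix x
    have "ennreal ((v x - c)\<^sup>2) \<le> ennreal (2 * (v x - d)\<^sup>2 + 2 * (c - d)\<^sup>2)"
      using sq[of "v x - d" "d - c"] by (intro ennreal_leI) (simp add: power2_commute[of c])
    also have "\<dots> = 2 * ennreal ((v x - d)\<^sup>2) + 2 * ?e"
      by (simp add: ennreal_mult)
    finally show "ennreal ((v x - c)\<^sup>2) * indicator (A \<union> B) x \<le> ennreal ((v x - c)\<^sup>2) * indicator A x + 
        (2 * (ennreal ((v x - d)\<^sup>2) * indicator B x) + 2 * (?e * indicator B x))"
      by (auto simp: indicator_def)
  qed
  also have "\<dots> = (\<integral>\<^sup>+x\<in>A. ennreal ((v x - c)\<^sup>2) \<partial>lborel) + (2 * (\<integral>\<^sup>+x\<in>B. ennreal ((v x - d)\<^sup>2) \<partial>lborel) + 2 * (?e * emeasure lborel B))"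
    by (simp add: nn_integral_add nn_integral_cmult)
  also have "\<dots> \<le> ennreal a * Z + (2 * (ennreal b * Z) + 2 * (ennreal R * (ennreal (2 * (a + b)) * Z)))"
    using c d 2 by (intro add_mono mult_left_mono) auto
  also have "\<dots> = ennreal (a + 2 * b + 4 * R * (a + b)) * Z"
  proof -
    have "ennreal (a + 2 * b + 4 * R * (a + b)) = ennreal a + (2 * ennreal b + 2 * (ennreal R * ennreal (2 * (a + b))))"
      using ab by (simp add: ennreal_mult[symmetric] ennreal_plus[symmetric] ennreal_numeral[symmetric] del: ennreal_plus ennreal_numeral)
    then show ?thesis by (simp only: distrib_right mult.assoc)
  qed
  finally show ?thesis unfolding osc_le_def by blast
qed

text \<open>One step is two applications of \<open>osc_le_Un\<close>: \<open>y\<close> is the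
  constant after adding a connecting set, the result the one after adding the next cell. Both added
  sets have the constant \<open>a\<close>.\<close>

fun chain_const :: "real \<Rightarrow> real \<Rightarrow> nat \<Rightarrow> real" where
  "chain_const a R 0 = a"
| "chain_const a R (Suc n) =
    (let x = chain_const a R n; y = x + 2 * a + 4 * R * (x + a) in y + 2 * a + 4 * R * (y + a))"

lemma chain_const_nonneg: "0 \<le> a \<Longrightarrow> 0 \<le> R \<Longrightarrow> 0 \<le> chain_const a R n"
  by (induction n) (auto simp: Let_def)

lemma chain_const_mono: "0 \<le> a \<Longrightarrow> 0 \<le> R \<Longrightarrow> m \<le> n \<Longrightarrow> chain_const a R m \<le> chain_const a R n"
proof (rule lift_Suc_mono_le[of "chain_const a R"])
  fix n assume a: "0 \<le> a" "0 \<le> R"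
  note x = chain_const_nonneg[OF a, of n]
  then have "0 \<le> R * (chain_const a R n + a)" "0 \<le> R * (chain_const a R n + 2 * a + 4 * R * (chain_const a R n + a) + a)"
    using a by (auto intro!: mult_nonneg_nonneg add_nonneg_nonneg)
  then show "chain_const a R n \<le> chain_const a R (Suc n)"
    using a by (simp add: Let_def)
qed

text \<open>Cells are collected greedily. The hypothesis \<open>conn\<close> says that no proper
  nonempty subfamily is closed under links, so a cell can always be added through a connecting set
  \<open>D\<close>; overlap with one collected cell suffices, because overlap with their union is
  larger.\<close>

lemma osc_le_chain:
  fixes v :: "'a::euclidean_space \<Rightarrow> real"
  assumes v[measurable]: "v \<in> borel_measurable borel" and aR: "0 \<le> a" "0 \<le> R"
    and fin: "finite \<C>" "\<C> \<noteq> {}"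
    and C: "\<And>C. C \<in> \<C> \<Longrightarrow> P C \<in> sets borel \<and> emeasure lborel (P C) < \<infinity> \<and> osc_le v (P C) (ennreal a * Z)"
    and conn: "\<And>\<A>. \<A> \<subseteq> \<C> \<Longrightarrow> \<A> \<noteq> {} \<Longrightarrow> \<A> \<noteq> \<C> \<Longrightarrow> \<exists>C\<in>\<A>. \<exists>C'\<in>\<C> - \<A>. \<exists>D. D \<in> sets borel \<and>
      emeasure lborel D < \<infinity> \<and> osc_le v D (ennreal a * Z) \<and>
      emeasure lborel D \<le> ennreal R * emeasure lborel (P C \<inter> D) \<and>
      emeasure lborel (P C') \<le> ennreal R * emeasure lborel (D \<inter> P C')"
  shows "osc_le v (\<Union>C\<in>\<C>. P C) (ennreal (chain_const a R (card \<C>)) * Z)"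
proof -
  \<comment> \<open>The index of \<open>chain_const\<close> counts links, one less than the number
    of cells collected.\<close>
  have "\<exists>\<A>\<subseteq>\<C>. card \<A> = Suc k \<and> osc_le v (\<Union>C\<in>\<A>. P C) (ennreal (chain_const a R k) * Z)"
    if "Suc k \<le> card \<C>" for k
    using that
  proof (induction k)
    case 0
    obtain C0 where "C0 \<in> \<C>" using fin by blast
    then show ?case using C[of C0] by (intro exI[of _ "{C0}"]) auto
  next
    case (Suc k)
    then obtain \<A> where \<A>: "\<A> \<subseteq> \<C>" "card \<A> = Suc k" "osc_le v (\<Union>C\<in>\<A>. P C) (ennreal (chain_const a R k) * Z)"
      by auto
    then have "\<A> \<noteq> \<C>" "\<A> \<noteq> {}" using Suc.prems by auto
    from conn[OF \<A>(1) this(2,1)] obtain C C' D where *: "C \<in> \<A>" "C' \<in> \<C>" "C' \<notin> \<A>" and D[measurable]: "D \<in> sets borel" 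
      and D2: "emeasure lborel D < \<infinity>" "osc_le v D (ennreal a * Z)"
      and DC: "emeasure lborel D \<le> ennreal R * emeasure lborel (P C \<inter> D)"
      and DC': "emeasure lborel (P C') \<le> ennreal R * emeasure lborel (D \<inter> P C')" by blast
    have fA: "finite \<A>" using \<A> fin finite_subset by blast
    let ?A = "\<Union>C\<in>\<A>. P C"
    have [measurable]: "?A \<in> sets borel" using fA \<A> C by (intro sets.finite_UN) auto
    have [measurable]: "P C' \<in> sets borel" using C * by auto
    define x where "x = chain_const a R k"
    define y where "y = x + 2 * a + 4 * R * (x + a)"
    have x: "x \<ge> 0" using chain_const_nonneg[OF aR] by (simp add: x_def)
    then have y: "y \<ge> 0" using aR by (auto simp: y_def intro!: add_nonneg_nonneg mult_nonneg_nonneg)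
    have "emeasure lborel (P C \<inter> D) \<le> emeasure lborel (?A \<inter> D)"
      using * by (intro emeasure_mono) auto
    then have "emeasure lborel D \<le> ennreal R * emeasure lborel (?A \<inter> D)"
      using DC by (meson mult_left_mono order.trans zero_le)
    then have AD: "osc_le v (?A \<union> D) (ennreal y * Z)"
      unfolding y_def using \<A>(3) D2 x by (intro osc_le_Un[OF v _ D _ _ _ aR]) (auto simp: x_def)
    have "emeasure lborel (D \<inter> P C') \<le> emeasure lborel ((?A \<union> D) \<inter> P C')"
      by (intro emeasure_mono) auto
    then have "emeasure lborel (P C') \<le> ennreal R * emeasure lborel ((?A \<union> D) \<inter> P C')"
      using DC' by (meson mult_left_mono order.trans zero_le)
    then have "osc_le v ((?A \<union> D) \<union> P C') (ennreal (y + 2 * a + 4 * R * (y + a)) * Z)"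
      using C[of C'] * by (intro osc_le_Un[OF v _ _ AD _ y aR]) auto
    then have "osc_le v (\<Union>C\<in>insert C' \<A>. P C) (ennreal (chain_const a R (Suc k)) * Z)"
      by (rule osc_le_mono) (auto simp: x_def y_def Let_def)
    then show ?case using * \<A> fA by (intro exI[of _ "insert C' \<A>"]) auto
  qed
  moreover have "card \<C> > 0" using fin by (simp add: card_gt_0_iff)
  ultimately obtain \<A> where \<A>: "\<A> \<subseteq> \<C>" "card \<A> = card \<C>" 
    "osc_le v (\<Union>C\<in>\<A>. P C) (ennreal (chain_const a R (card \<C> - 1)) * Z)"
    by (metis Suc_diff_1 order.refl)
  have "\<A> = \<C>" using \<A> fin by (simp add: card_subset_eq)
  with \<A>(3) show ?thesis
    using chain_const_mono[OF aR, of "card \<C> - 1" "card \<C>"]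
    by (auto intro!: osc_le_mono[of v _ _ _ "ennreal (chain_const a R (card \<C>)) * Z"] mult_right_mono ennreal_leI)
qed

subsection \<open>Representatives of Sobolev functions\<close>

lemma borel_representative:
  fixes f :: "'a::euclidean_space \<Rightarrow> 'b::euclidean_space"
  assumes "f \<in> borel_measurable lebesgue"
  obtains g where "g \<in> borel_measurable borel" "AE x in lebesgue. f x = g x"
proof -
  have "\<forall>i\<in>Basis. \<exists>g. g \<in> borel_measurable borel \<and> (AE x in lebesgue. f x \<bullet> i = g x)"
  proof
    fix i :: 'b assume "i \<in> Basis"
    have "(\<lambda>x. f x \<bullet> i) \<in> borel_measurable lebesgue" using assms by simp
    from completion_ex_borel_measurable_real[OF this] show "\<exists>g. g \<in> borel_measurable borel \<and> (AE x in lebesgue. f x \<bullet> i = g x)"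
      by (auto simp: AE_completion_iff)
  qed
  from bchoice[OF this] obtain G where G: "\<And>i. i \<in> Basis \<Longrightarrow> G i \<in> borel_measurable borel"
    "\<And>i. i \<in> Basis \<Longrightarrow> AE x in lebesgue. f x \<bullet> i = G i x" by blast
  have "AE x in lebesgue. \<forall>i\<in>Basis. f x \<bullet> i = G i x"
    using G(2) by (intro AE_finite_allI) auto
  then have "AE x in lebesgue. f x = (\<Sum>i\<in>Basis. G i x *\<^sub>R i)"
  proof eventually_elim
    case (elim x)
    then have "(\<Sum>i\<in>Basis. G i x *\<^sub>R i) = (\<Sum>i\<in>Basis. (f x \<bullet> i) *\<^sub>R i)" by simp
    then show ?case by (simp add: euclidean_representation)
  qed
  then show ?thesis using that[of "\<lambda>x. \<Sum>i\<in>Basis. G i x *\<^sub>R i"] G by simp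
qed

text \<open>Extension by zero, changed on a null set to become Borel, moves all estimates to
  \<open>lborel\<close> on the whole plane. Integrability follows from
  \<open>s \<le> 1 + s^2\<close> and the boundedness of \<open>S\<close>.\<close>

lemma L2_representative:
  fixes f :: "'a::euclidean_space \<Rightarrow> 'b::euclidean_space"
  assumes f: "f \<in> L2 S" and S: "open S" "bounded S"
  obtains g where "integrable lborel g" "AE x in lebesgue. (if x \<in> S then f x else 0) = g x"
    "(\<integral>\<^sup>+x. ennreal ((norm (g x))\<^sup>2) \<partial>lborel) = ennreal ((L2_norm S f)\<^sup>2)"
proof -
  have fm: "f \<in> borel_measurable (lebesgue_on S)" and fi: "integrable (lebesgue_on S) (\<lambda>x. (norm (f x))\<^sup>2)"
    using f by (auto simp: L2_def)
  have SL[simp]: "S \<in> sets lebesgue" using S by auto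
  have [measurable]: "S \<in> sets borel" using S by auto
  have "(\<lambda>x. if x \<in> S then f x else 0) \<in> borel_measurable lebesgue"
    using fm by (rule borel_measurable_if_I) simp
  from borel_representative[OF this] obtain g where g[measurable]: "g \<in> borel_measurable borel"
    and ae: "AE x in lebesgue. (if x \<in> S then f x else 0) = g x" by blast
  have "(\<integral>\<^sup>+x. ennreal ((norm (g x))\<^sup>2) \<partial>lborel) = (\<integral>\<^sup>+x. ennreal ((norm (g x))\<^sup>2) \<partial>lebesgue)"
    by (simp add: nn_integral_completion)
  also have "\<dots> = (\<integral>\<^sup>+x. ennreal ((norm (f x))\<^sup>2) * indicator S x \<partial>lebesgue)"
    by (rule nn_integral_cong_AE) (use ae in \<open>eventually_elim, auto simp: indicator_def split: if_splits\<close>)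
  also have "\<dots> = (\<integral>\<^sup>+x. ennreal ((norm (f x))\<^sup>2) \<partial>lebesgue_on S)"
    by (simp add: nn_integral_restrict_space)
  also have "\<dots> = ennreal (LINT x|lebesgue_on S. (norm (f x))\<^sup>2)"
    using fi by (simp add: nn_integral_eq_integral)
  also have "\<dots> = ennreal ((L2_norm S f)\<^sup>2)"
    by (simp add: L2_norm_def)
  finally have n2: "(\<integral>\<^sup>+x. ennreal ((norm (g x))\<^sup>2) \<partial>lborel) = ennreal ((L2_norm S f)\<^sup>2)" .
  have "integrable lborel g"
  proof (rule integrableI_bounded)
    have "AE x in lborel. g x \<noteq> 0 \<longrightarrow> x \<in> S"
      using ae unfolding AE_completion_iff by eventually_elim (auto split: if_splits)
    then have "AE x in lborel. ennreal (norm (g x)) \<le> indicator S x + ennreal ((norm (g x))\<^sup>2)"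
    proof eventually_elim
      case (elim x)
      have "norm (g x) \<le> 1 + (norm (g x))\<^sup>2"
        using sum_squares_bound[of "norm (g x)" 1] norm_ge_zero[of "g x"]
        unfolding power_one mult_1_right by linarith
      then have "ennreal (norm (g x)) \<le> 1 + ennreal ((norm (g x))\<^sup>2)"
        by (simp flip: ennreal_1 ennreal_plus)
      then show ?case using elim by (cases "x \<in> S") auto
    qed
    then have "(\<integral>\<^sup>+x. ennreal (norm (g x)) \<partial>lborel) \<le> (\<integral>\<^sup>+x. indicator S x + ennreal ((norm (g x))\<^sup>2) \<partial>lborel)"
      by (rule nn_integral_mono_AE)
    also have "\<dots> = emeasure lborel S + ennreal ((L2_norm S f)\<^sup>2)"
      by (simp add: nn_integral_add n2)
    also have "\<dots> < \<infinity>" using emeasure_bounded_finite[OF S(2)] by simp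
    finally show "(\<integral>\<^sup>+x. ennreal (norm (g x)) \<partial>lborel) < \<infinity>" .
  qed simp
  then show ?thesis using that ae n2 by blast
qed

lemma integral_lebesgue_on_representative:
  fixes f w h :: "'a::euclidean_space \<Rightarrow> real"
  assumes S: "open S" and f: "f \<in> borel_measurable (lebesgue_on S)"
    and w[measurable]: "w \<in> borel_measurable borel" and h[measurable]: "h \<in> borel_measurable borel"
    and ae: "AE x in lebesgue. (if x \<in> S then f x else 0) = w x"
  shows "(LINT x|lebesgue_on S. f x * h x) = (LINT x|lborel. w x * h x)"
proof -
  have SL[simp]: "S \<in> sets lebesgue" using S by auto
  have m: "(\<lambda>x. if x \<in> S then f x else 0) \<in> borel_measurable lebesgue"
    using f by (rule borel_measurable_if_I) simp
  have "(LINT x|lebesgue_on S. f x * h x) = (LINT x|lebesgue. (if x \<in> S then f x else 0) * h x)"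
    by (auto simp: integral_restrict_space indicator_def intro!: Bochner_Integration.integral_cong)
  also have "\<dots> = (LINT x|lebesgue. w x * h x)"
  proof (rule integral_cong_AE)
    show "(\<lambda>x. (if x \<in> S then f x else 0) * h x) \<in> borel_measurable lebesgue"
      using m by (intro borel_measurable_times) (auto intro: measurable_completion)
    show "(\<lambda>x. w x * h x) \<in> borel_measurable lebesgue" by (auto intro!: measurable_completion)
  qed (use ae in \<open>eventually_elim, simp\<close>)
  also have "\<dots> = (LINT x|lborel. w x * h x)"
    by (rule integral_completion) measurable
  finally show ?thesis .
qed

lemma H1_weak_gradient:
  assumes "v \<in> H1 S"
  shows "weak_gradient S v \<in> L2 S" "is_weak_gradient S v (weak_gradient S v)"
  using assms someI_ex[of "\<lambda>g. g \<in> L2 S \<and> is_weak_gradient S v g"]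
  unfolding H1_def weak_gradient_def by auto

lemma H1_representative:
  fixes S :: "'a::euclidean_space set"
  assumes v: "v \<in> H1 S" and S: "open S" "bounded S"
  obtains w g where "integrable lborel w" "(\<integral>\<^sup>+x. ennreal ((w x)\<^sup>2) \<partial>lborel) < \<infinity>"
    "AE x in lebesgue. (if x \<in> S then v x else 0) = w x"
    "integrable lborel g" "(\<integral>\<^sup>+x. ennreal ((norm (g x))\<^sup>2) \<partial>lborel) = ennreal ((H1_seminorm S v)\<^sup>2)"
    "\<And>\<phi> i. \<phi> \<in> test_functions S \<Longrightarrow> i \<in> Basis \<Longrightarrow>
      (LINT x|lborel. w x * partial_deriv i \<phi> x) = - (LINT x|lborel. (g x \<bullet> i) * \<phi> x)"
proof -
  have vL: "v \<in> L2 S" using v by (simp add: H1_def)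
  let ?G = "weak_gradient S v"
  note G = H1_weak_gradient[OF v]
  obtain w where w: "integrable lborel w" "AE x in lebesgue. (if x \<in> S then v x else 0) = w x"
    "(\<integral>\<^sup>+x. ennreal ((norm (w x))\<^sup>2) \<partial>lborel) = ennreal ((L2_norm S v)\<^sup>2)"
    using L2_representative[OF vL S] by blast
  obtain g where g: "integrable lborel g" "AE x in lebesgue. (if x \<in> S then ?G x else 0) = g x"
    "(\<integral>\<^sup>+x. ennreal ((norm (g x))\<^sup>2) \<partial>lborel) = ennreal ((L2_norm S ?G)\<^sup>2)"
    using L2_representative[OF G(1) S] by blast
  have wm: "w \<in> borel_measurable borel" and gm[measurable]: "g \<in> borel_measurable borel"
    using w g by (auto dest: borel_measurable_integrable)
  have "(LINT x|lborel. w x * partial_deriv i \<phi> x) = - (LINT x|lborel. (g x \<bullet> i) * \<phi> x)"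
    if \<phi>: "\<phi> \<in> test_functions S" and i: "i \<in> Basis" for \<phi> i
  proof -
    have "k_times_cont_diff 1 \<phi>" and c0: "k_times_cont_diff 0 \<phi>" using \<phi> by (simp_all add: test_functions_def del: k_times_cont_diff.simps)
    then have "continuous_on UNIV (partial_deriv i \<phi>)" using i by (simp)
    then have m1: "partial_deriv i \<phi> \<in> borel_measurable borel" by (rule borel_measurable_continuous_onI)
    have m2: "\<phi> \<in> borel_measurable borel" using c0 by (simp add: borel_measurable_continuous_onI)
    have "AE x in lebesgue. (if x \<in> S then ?G x \<bullet> i else 0) = g x \<bullet> i"
      using g(2) by eventually_elim (auto split: if_splits)
    moreover have "(\<lambda>x. ?G x \<bullet> i) \<in> borel_measurable (lebesgue_on S)"
      using G(1) by (auto simp: L2_def)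
    ultimately have "(LINT x|lebesgue_on S. (?G x \<bullet> i) * \<phi> x) = (LINT x|lborel. (g x \<bullet> i) * \<phi> x)"
      by (intro integral_lebesgue_on_representative S m2) auto
    moreover have "(LINT x|lebesgue_on S. v x * partial_deriv i \<phi> x) = (LINT x|lborel. w x * partial_deriv i \<phi> x)"
      using vL by (intro integral_lebesgue_on_representative S m1 wm w(2)) (auto simp: L2_def)
    ultimately show ?thesis using G(2) \<phi> i by (simp add: is_weak_gradient_def)
  qed
  then show ?thesis using that[of w g] w g by (simp add: H1_seminorm_def)
qed

text \<open>The mean is the best constant: replacing it by \<open>c\<close> increases the integral
  of the square by exactly \<open>measure lebesgue S\<close> times the square of
  \<open>c - mean_value S v\<close>. No factor is lost on returning from \<open>osc_le\<close> to
  the mean.\<close>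

lemma L2_norm_minus_mean_le:
  fixes S :: "'a::euclidean_space set"
  assumes S: "open S" "bounded S" "S \<noteq> {}" and v: "v \<in> L2 S" and M: "0 \<le> M"
    and w[measurable]: "w \<in> borel_measurable borel"
    and ae: "AE x in lebesgue. (if x \<in> S then v x else 0) = w x"
    and osc: "osc_le w S (ennreal M)"
  shows "L2_norm S (\<lambda>x. v x - mean_value S v) \<le> sqrt M"
proof -
  have SL[simp]: "S \<in> sets lebesgue" using S by auto
  have [measurable]: "S \<in> sets borel" using S by auto
  let ?N = "lebesgue_on S" and ?\<mu> = "mean_value S v" and ?s = "measure lebesgue S"
  have SlS: "S \<in> lmeasurable" using S by (simp add: lmeasurable_open)
  interpret N: finite_measure ?N
    using SlS by (intro finite_measure_lebesgue_on) 
  have vm[measurable]: "v \<in> borel_measurable ?N" and v2: "integrable ?N (\<lambda>x. (v x)\<^sup>2)"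
    using v by (auto simp: L2_def)
  have vi: "integrable ?N v"
    using N.square_integrable_imp_integrable[OF vm v2] .
  have s: "?s > 0"
    using S open_not_negligible[of S] SlS by (simp add: zero_less_measure_iff negligible_iff_measure0)
  have sN: "measure ?N (space ?N) = ?s" by (simp add: measure_restrict_space)
  obtain c where c: "(\<integral>\<^sup>+x\<in>S. ennreal ((w x - c)\<^sup>2) \<partial>lborel) \<le> ennreal M"
    using osc by (auto simp: osc_le_def)
  have vci: "integrable ?N (\<lambda>x. (v x - d)\<^sup>2)" for d
    unfolding power2_diff using v2 vi by (intro Bochner_Integration.integrable_add Bochner_Integration.integrable_diff) auto
  have "ennreal (LINT x|?N. (v x - c)\<^sup>2) = (\<integral>\<^sup>+x. ennreal ((v x - c)\<^sup>2) \<partial>?N)"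
    using vci by (simp add: nn_integral_eq_integral)
  also have "\<dots> = (\<integral>\<^sup>+x\<in>S. ennreal ((v x - c)\<^sup>2) \<partial>lebesgue)"
    by (simp add: nn_integral_restrict_space)
  also have "\<dots> = (\<integral>\<^sup>+x\<in>S. ennreal ((w x - c)\<^sup>2) \<partial>lebesgue)"
    by (rule nn_integral_cong_AE) (use ae in \<open>eventually_elim, auto simp: indicator_def split: if_splits\<close>)
  also have "\<dots> \<le> ennreal M" using c by (simp add: nn_integral_completion)
  finally have cM: "(LINT x|?N. (v x - c)\<^sup>2) \<le> M" using M by simp
  have ex: "(LINT x|?N. (v x - d)\<^sup>2) = (LINT x|?N. (v x)\<^sup>2) + ?s * d\<^sup>2 - 2 * d * (?\<mu> * ?s)" for d
  proof -
    have "(LINT x|?N. (v x - d)\<^sup>2) = (LINT x|?N. ((v x)\<^sup>2 + d\<^sup>2) - 2 * d * v x)"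
      by (simp add: power2_diff mult_ac)
    also have "\<dots> = ((LINT x|?N. (v x)\<^sup>2) + (LINT x|?N. d\<^sup>2)) - 2 * d * (LINT x|?N. v x)"
      using v2 vi by simp
    also have "(LINT x|?N. v x) = ?\<mu> * ?s" using s by (simp add: mean_value_def)
    also have "(LINT x|?N. d\<^sup>2) = ?s * d\<^sup>2" using sN by simp
    finally show ?thesis .
  qed
  have "(LINT x|?N. (v x - c)\<^sup>2) - (LINT x|?N. (v x - ?\<mu>)\<^sup>2) = ?s * (c - ?\<mu>)\<^sup>2"
    unfolding ex by (simp add: algebra_simps power2_eq_square)
  then have "(LINT x|?N. (v x - ?\<mu>)\<^sup>2) \<le> M"
    using cM s by (smt (verit) mult_nonneg_nonneg zero_le_power2)
  then show ?thesis by (simp add: L2_norm_def)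
qed

subsection \<open>Chains of star-shaped cells\<close>

text \<open>The condition \<open>m \<in> C\<close> rules out the empty set, which is vacuously
  star-shaped with respect to every disc, and it forces the open disc to lie in
  \<open>C\<close>.\<close>

definition star_cell :: "real \<Rightarrow> point set \<Rightarrow> bool" where
  "star_cell \<sigma> C \<longleftrightarrow> compact C \<and>
     (\<exists>m r. star_shaped_wrt_disc C m r \<and> m \<in> C \<and> diameter C \<le> \<sigma> * r)"

text \<open>The asymmetry is intended: \<open>C\<close> is already collected and \<open>C'\<close>
  is about to be added. The disc has to be no larger than either cell to overlap it well, but only
  \<open>C'\<close> must be bounded by the disc.\<close>

definition linked :: "real \<Rightarrow> point set \<Rightarrow> point set \<Rightarrow> point set \<Rightarrow> bool" where
  "linked \<theta> U C C' \<longleftrightarrow> (\<exists>q r. q \<in> C \<inter> C' \<and> 0 < r \<and> ball q r \<subseteq> U \<and>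
     r \<le> diameter C \<and> r \<le> diameter C' \<and> \<theta> * diameter C' \<le> r)"

lemma star_shaped_subset_closure_interior:
  assumes "star_shaped_wrt_disc K m r" shows "K \<subseteq> closure (interior K)"
proof
  fix x assume x: "x \<in> K"
  have "(\<lambda>n. x + (1 / real (Suc n)) *\<^sub>R (m - x)) \<longlonglongrightarrow> x + 0 *\<^sub>R (m - x)"
    by (rule tendsto_add[OF tendsto_const tendsto_scaleR[OF LIMSEQ_Suc[OF lim_1_over_n] tendsto_const]])
  then have "(\<lambda>n. x + (1 / real (Suc n)) *\<^sub>R (m - x)) \<longlonglongrightarrow> x" by simp
  moreover have "x + (1 / real (Suc n)) *\<^sub>R (m - x) \<in> interior K" for n
    by (rule star_shaped_interior[OF assms x]) auto
  ultimately show "x \<in> closure (interior K)"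
    unfolding closure_sequential by (intro exI[of _ "\<lambda>n. x + (1 / real (Suc n)) *\<^sub>R (m - x)"] conjI allI)
qed

text \<open>A ray from the centre meets the frontier at most once, since every point strictly before
  a point of \<open>K\<close> is interior.\<close>

lemma star_shaped_negligible_frontier:
  assumes K: "closed K" "star_shaped_wrt_disc K m r" shows "negligible (frontier K)"
proof (rule starlike_negligible_strong[where a=m])
  fix c :: real and x assume c: "0 \<le> c" "c < 1" "m + x \<in> frontier K"
  then have "m + x \<in> K" using K by (simp add: frontier_def)
  from star_shaped_interior[OF K(2) this, of "1 - c"] c
  have "m + c *\<^sub>R x \<in> interior K" by (simp add: algebra_simps)
  then show "m + c *\<^sub>R x \<notin> frontier K" by (simp add: frontier_def)
qed simp

lemma star_shaped_disc_subset:
  assumes "star_shaped_wrt_disc K m r" "m \<in> K"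
  shows "ball m r \<subseteq> K"
  using star_shaped_ball_subset[OF assms, of 1] by simp

lemma star_shaped_diameter_ge:
  assumes "star_shaped_wrt_disc K m r" "m \<in> K" "bounded K"
  shows "2 * r \<le> diameter K"
proof -
  have "r > 0" using assms by (simp add: star_shaped_wrt_disc_def)
  then show ?thesis
    using diameter_subset[OF star_shaped_disc_subset[OF assms(1,2)] assms(3)] by simp
qed

lemma star_cellE:
  assumes C: "star_cell \<sigma> C"
  obtains m r where "compact C" "bounded C" "star_shaped_wrt_disc C m r" "m \<in> C" "0 < r"
    "diameter C \<le> \<sigma> * r" "2 * r \<le> diameter C" "0 < \<sigma>" "0 < diameter C"
proof -
  obtain m r where *: "compact C" "star_shaped_wrt_disc C m r" "m \<in> C" "diameter C \<le> \<sigma> * r"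
    using C by (auto simp: star_cell_def)
  then have r: "0 < r" "bounded C" by (auto simp: star_shaped_wrt_disc_def compact_imp_bounded)
  have d: "2 * r \<le> diameter C" using star_shaped_diameter_ge * r by blast
  then have "0 < \<sigma> * r" using * r by linarith
  then have "0 < \<sigma>" using r zero_less_mult_pos2 by blast
  then show ?thesis using that * r d by fastforce
qed

text \<open>Scaling the star disc of every cell towards \<open>z\<close> so that all cells appear with
  the same size gives disjoint discs of comparable area inside one disc around \<open>z\<close>.\<close>

lemma star_cells_card_le:
  assumes fin: "finite \<C>" and cells: "\<And>C. C \<in> \<C> \<Longrightarrow> star_cell \<sigma> C \<and> z \<in> C"
    and disj: "\<And>C C'. C \<in> \<C> \<Longrightarrow> C' \<in> \<C> \<Longrightarrow> C \<noteq> C' \<Longrightarrow> interior C \<inter> interior C' = {}"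
  shows "real (card \<C>) \<le> 4 * \<sigma>\<^sup>2"
proof (cases "\<C> = {}")
  case False
  define s where "s = Min (diameter ` \<C>)"
  have dpos: "diameter C > 0" "\<sigma> > 0" if "C \<in> \<C>" for C
  proof -
    have "star_cell \<sigma> C" using cells that by blast
    then show "diameter C > 0" "\<sigma> > 0" by (rule star_cellE; simp)+
  qed
  have s: "s > 0" "\<And>C. C \<in> \<C> \<Longrightarrow> s \<le> diameter C"
    using fin False dpos by (auto simp: s_def)
  have "\<exists>p. ball p (s / \<sigma>) \<subseteq> interior C \<inter> ball z (2 * s)" if C: "C \<in> \<C>" for C
  proof -
    have sc: "star_cell \<sigma> C" and z: "z \<in> C" using cells[OF C] by auto
    obtain m r where mr: "bounded C" "star_shaped_wrt_disc C m r" "m \<in> C" "0 < r"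
      "diameter C \<le> \<sigma> * r" "2 * r \<le> diameter C" using star_cellE[OF sc] by metis
    define t where "t = s / diameter C"
    have t: "0 \<le> t" "t \<le> 1" "t * diameter C = s" using s(2)[OF C] dpos[OF C] s(1) by (auto simp: t_def)
    have \<sigma>: "\<sigma> > 0" using dpos[OF C] by simp
    have "s = t * diameter C" using t by simp
    also have "\<dots> \<le> t * (\<sigma> * r)" using t mr by (intro mult_left_mono) auto
    finally have "s / \<sigma> \<le> t * r" using \<sigma> by (simp add: field_simps)
    then have "ball (z + t *\<^sub>R (m - z)) (s / \<sigma>) \<subseteq> ball (z + t *\<^sub>R (m - z)) (t * r)" by auto
    moreover have "ball (z + t *\<^sub>R (m - z)) (t * r) \<subseteq> interior C"
      by (intro interior_maximal star_shaped_ball_subset[OF mr(2) z]) (use t in auto)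
    moreover have "ball (z + t *\<^sub>R (m - z)) (t * r) \<subseteq> ball z (2 * s)"
    proof
      fix q assume "q \<in> ball (z + t *\<^sub>R (m - z)) (t * r)"
      then have 1: "dist (z + t *\<^sub>R (m - z)) q < t * r" by simp
      have "dist z (z + t *\<^sub>R (m - z)) = t * dist m z" using t by (simp add: dist_norm norm_minus_commute)
      also have "\<dots> \<le> t * diameter C"
        using diameter_bounded_bound[OF mr(1,3) z] t by (intro mult_left_mono) auto
      finally have 2: "dist z (z + t *\<^sub>R (m - z)) \<le> s" using t by simp
      have "t * r \<le> t * diameter C" using t mr by (intro mult_left_mono) auto
      then show "q \<in> ball z (2 * s)"
        using 1 2 t dist_triangle[of z q "z + t *\<^sub>R (m - z)"] by simp
    qed
    ultimately show ?thesis by blast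
  qed
  then obtain p where p: "\<And>C. C \<in> \<C> \<Longrightarrow> ball (p C) (s / \<sigma>) \<subseteq> interior C \<inter> ball z (2 * s)" by metis
  obtain C0 where "C0 \<in> \<C>" using False by blast
  then have \<sigma>: "\<sigma> > 0" using dpos by blast
  have "(\<Sum>C\<in>\<C>. emeasure lborel (ball (p C) (s / \<sigma>))) = emeasure lborel (\<Union>C\<in>\<C>. ball (p C) (s / \<sigma>))"
  proof (intro sum_emeasure fin)
    show "disjoint_family_on (\<lambda>C. ball (p C) (s / \<sigma>)) \<C>"
      unfolding disjoint_family_on_def
    proof (intro ballI impI)
      fix C C' assume "C \<in> \<C>" "C' \<in> \<C>" "C \<noteq> C'"
      with disj[OF this] p[of C] p[of C'] show "ball (p C) (s / \<sigma>) \<inter> ball (p C') (s / \<sigma>) = {}" by blast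
    qed
  qed auto
  also have "\<dots> \<le> emeasure lborel (ball z (2 * s))"
    using p by (intro emeasure_mono) auto
  also have "\<dots> = ennreal (pi * (2 * s)\<^sup>2)" using s by (intro emeasure_lborel_ball_plane) simp
  also have "(\<Sum>C\<in>\<C>. emeasure lborel (ball (p C) (s / \<sigma>))) = ennreal (real (card \<C>) * (pi * (s / \<sigma>)\<^sup>2))"
    using s \<sigma> by (simp add: emeasure_lborel_ball_plane ennreal_mult ennreal_of_nat_eq_real_of_nat del: power_divide)
  finally have "real (card \<C>) * (pi * (s / \<sigma>)\<^sup>2) \<le> pi * (2 * s)\<^sup>2" by simp
  then have "real (card \<C>) * s\<^sup>2 \<le> (4 * \<sigma>\<^sup>2) * s\<^sup>2"
    using \<sigma> by (simp add: power_divide power_mult_distrib field_simps)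
  then show ?thesis using s by simp
qed simp

text \<open>A homothety with centre \<open>q\<close> carries the star disc of \<open>C\<close> to a
  disc inside both sets. The ratio \<open>r / (2 * diameter C)\<close> keeps its centre within
  \<open>r / 2\<close> of \<open>q\<close> and its radius at most \<open>r / 2\<close>; the radius
  is also at least \<open>r / (2 * \<sigma>)\<close>, whence the factor
  \<open>4 * \<sigma>\<^sup>2\<close>.\<close>

lemma linked_overlap:
  assumes C: "star_cell \<sigma> C" and q: "q \<in> C" and r: "0 < r" "r \<le> diameter C"
  shows "ennreal (pi * r\<^sup>2) \<le> ennreal (4 * \<sigma>\<^sup>2) * emeasure lborel (interior C \<inter> ball q r)"
proof -
  obtain m \<rho> where m: "bounded C" "star_shaped_wrt_disc C m \<rho>" "m \<in> C" "0 < \<rho>"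
    "diameter C \<le> \<sigma> * \<rho>" "2 * \<rho> \<le> diameter C" "0 < \<sigma>" using star_cellE[OF C] by metis
  define t where "t = r / (2 * diameter C)"
  have d: "diameter C > 0" using m by linarith
  have t: "0 < t" "t \<le> 1" "t * diameter C = r / 2" using d r by (auto simp: t_def field_simps)
  have sub: "ball (q + t *\<^sub>R (m - q)) (t * \<rho>) \<subseteq> interior C \<inter> ball q r"
  proof (intro Int_greatest interior_maximal star_shaped_ball_subset[OF m(2) q])
    show "ball (q + t *\<^sub>R (m - q)) (t * \<rho>) \<subseteq> ball q r"
    proof
      fix x assume "x \<in> ball (q + t *\<^sub>R (m - q)) (t * \<rho>)"
      then have 1: "dist (q + t *\<^sub>R (m - q)) x < t * \<rho>" by simp
      have "dist q (q + t *\<^sub>R (m - q)) = t * dist m q" using t by (simp add: dist_norm norm_minus_commute)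
      also have "\<dots> \<le> t * diameter C"
        using diameter_bounded_bound[OF m(1,3) q] t by (intro mult_left_mono) auto
      finally have 2: "dist q (q + t *\<^sub>R (m - q)) \<le> r / 2" using t by simp
      have "t * \<rho> \<le> t * diameter C" using t m by (intro mult_left_mono) auto
      then show "x \<in> ball q r"
        using 1 2 t dist_triangle[of q x "q + t *\<^sub>R (m - q)"] by simp
    qed
  qed (use t in auto)
  have "r / 2 \<le> t * (\<sigma> * \<rho>)" using t m by (metis less_imp_le mult_left_mono)
  then have "r\<^sup>2 \<le> (2 * (t * (\<sigma> * \<rho>)))\<^sup>2" using r by (intro power_mono) auto
  then have "pi * r\<^sup>2 \<le> 4 * \<sigma>\<^sup>2 * (pi * (t * \<rho>)\<^sup>2)"
    using mult_left_mono[of "r\<^sup>2" "(2 * (t * (\<sigma> * \<rho>)))\<^sup>2" pi] by (simp add: power_mult_distrib mult_ac)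
  then have "ennreal (pi * r\<^sup>2) \<le> ennreal (4 * \<sigma>\<^sup>2) * ennreal (pi * (t * \<rho>)\<^sup>2)"
    by (simp add: ennreal_leI flip: ennreal_mult)
  also have "\<dots> = ennreal (4 * \<sigma>\<^sup>2) * emeasure lborel (ball (q + t *\<^sub>R (m - q)) (t * \<rho>))"
    using t m by (simp add: emeasure_lborel_ball_plane)
  also have "\<dots> \<le> ennreal (4 * \<sigma>\<^sup>2) * emeasure lborel (interior C \<inter> ball q r)"
    using sub by (intro mult_left_mono emeasure_mono) auto
  finally show ?thesis .
qed

lemma star_cells_poincare:
  fixes \<sigma> \<theta> :: real
  assumes \<sigma>: "2 \<le> \<sigma>" and \<theta>: "0 < \<theta>" "\<theta> \<le> 1"
  shows "\<exists>c>0. \<forall>\<C> z. finite \<C> \<longrightarrow> \<C> \<noteq> {} \<longrightarrow> (\<forall>C\<in>\<C>. star_cell \<sigma> C \<and> z \<in> C) \<longrightarrow>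
     (\<forall>C\<in>\<C>. \<forall>C'\<in>\<C>. C \<noteq> C' \<longrightarrow> interior C \<inter> interior C' = {}) \<longrightarrow>
     (\<forall>\<A>\<subseteq>\<C>. \<A> \<noteq> {} \<longrightarrow> \<A> \<noteq> \<C> \<longrightarrow> (\<exists>C\<in>\<A>. \<exists>C'\<in>\<C> - \<A>. linked \<theta> (interior (\<Union>\<C>)) C C')) \<longrightarrow>
     (\<forall>v\<in>H1 (interior (\<Union>\<C>)). L2_norm (interior (\<Union>\<C>)) (\<lambda>x. v x - mean_value (interior (\<Union>\<C>)) v)
        \<le> c * diameter (interior (\<Union>\<C>)) * H1_seminorm (interior (\<Union>\<C>)) v)"
proof -
  \<comment> \<open>\<open>a\<close> is the constant of \<open>star_poincare\<close> and
    \<open>n\<close> the bound on the number of cells. In \<open>R\<close> the factor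
    \<open>4 * \<sigma>\<^sup>2\<close> comes from \<open>linked_overlap\<close>; the division by
    \<open>\<theta>\<^sup>2\<close> compares the area of the new cell, whose diameter is at most
    \<open>r / \<theta>\<close>, with that of the connecting disc.\<close>
  define a where "a = 4 * (4 * \<sigma>\<^sup>2 + 1)"
  define R where "R = 4 * \<sigma>\<^sup>2 / \<theta>\<^sup>2"
  define n where "n = nat \<lfloor>4 * \<sigma>\<^sup>2\<rfloor>"
  have aR: "0 \<le> a" "0 \<le> R" "a > 0" by (auto simp: a_def R_def add_nonneg_pos)
  have R\<sigma>: "4 * \<sigma>\<^sup>2 \<le> R"
  proof -
    have "\<theta>\<^sup>2 \<le> 1" using \<theta> by (simp add: power_le_one)
    then show ?thesis unfolding R_def using \<theta> 
      by (simp add: le_divide_eq mult_left_le)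
  qed
  let ?k = "chain_const a R n"
  have k: "?k > 0" using chain_const_mono[OF aR(1,2), of 0 n] aR by simp
  show ?thesis
  proof (intro exI[of _ "sqrt ?k"] conjI allI impI ballI)
    show "0 < sqrt ?k" using k by simp
    fix \<C> :: "point set set" and z :: point and v
    let ?U = "interior (\<Union>\<C>)"
    assume fin: "finite \<C>" "\<C> \<noteq> {}" and cells: "\<forall>C\<in>\<C>. star_cell \<sigma> C \<and> z \<in> C"
      and disj: "\<forall>C\<in>\<C>. \<forall>C'\<in>\<C>. C \<noteq> C' \<longrightarrow> interior C \<inter> interior C' = {}"
      and conn: "\<forall>\<A>\<subseteq>\<C>. \<A> \<noteq> {} \<longrightarrow> \<A> \<noteq> \<C> \<longrightarrow> (\<exists>C\<in>\<A>. \<exists>C'\<in>\<C> - \<A>. linked \<theta> ?U C C')"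
      and v: "v \<in> H1 ?U"
    have "real (card \<C>) \<le> 4 * \<sigma>\<^sup>2"
      by (rule star_cells_card_le[OF fin(1)]) (use cells disj in auto)
    then have cardn: "card \<C> \<le> n" unfolding n_def by linarith
    have "bounded (\<Union>\<C>)" using fin cells by (auto simp: star_cell_def compact_imp_bounded)
    then have U: "open ?U" "bounded ?U" by (auto intro: bounded_subset[OF _ interior_subset])
    define h where "h = diameter ?U"
    obtain w g where wg: "integrable lborel w" "(\<integral>\<^sup>+x. ennreal ((w x)\<^sup>2) \<partial>lborel) < \<infinity>"
      "AE x in lebesgue. (if x \<in> ?U then v x else 0) = w x"
      "integrable lborel g" "(\<integral>\<^sup>+x. ennreal ((norm (g x))\<^sup>2) \<partial>lborel) = ennreal ((H1_seminorm ?U v)\<^sup>2)"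
      "\<And>\<phi> i. \<phi> \<in> test_functions ?U \<Longrightarrow> i \<in> Basis \<Longrightarrow>
        (LINT x|lborel. w x * partial_deriv i \<phi> x) = - (LINT x|lborel. (g x \<bullet> i) * \<phi> x)"
      using H1_representative[OF v U] by blast
    have wm: "w \<in> borel_measurable borel" using wg(1) by (auto dest: borel_measurable_integrable)
    \<comment> \<open>The scale is the diameter \<open>h\<close> of the whole patch. It dominates
      the diameters of all cells and connecting discs, so that one \<open>Z\<close> serves every set
      in the chain.\<close>
    define Z where "Z = ennreal (h\<^sup>2 * (H1_seminorm ?U v)\<^sup>2)"
    have star_osc: "osc_le w (interior K) (ennreal a * Z)"
      if K: "star_cell \<sigma> K" "interior K \<subseteq> ?U" for K
    proof -
      obtain m r where m: "compact K" "bounded K" "star_shaped_wrt_disc K m r" "m \<in> K" "0 < r"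
        "diameter K \<le> \<sigma> * r" "2 * r \<le> diameter K" using star_cellE[OF K(1)] by metis
      have "K \<subseteq> closure ?U"
        using star_shaped_subset_closure_interior[OF m(3)] closure_mono[OF K(2)] by blast
      then have Kh: "diameter K \<le> h"
        unfolding h_def using U(2) by (metis diameter_closure diameter_subset bounded_closure)
      have "0 \<le> diameter K" using m by linarith
      then have "(diameter K)\<^sup>2 \<le> h\<^sup>2" using Kh by (intro power_mono)
      then have le: "a * (diameter K)\<^sup>2 \<le> a * h\<^sup>2" using aR by (intro mult_left_mono) auto
      obtain c where "(\<integral>\<^sup>+x\<in>interior K. ennreal ((w x - c)\<^sup>2) \<partial>lborel) \<le>
          ennreal (a * (diameter K)\<^sup>2) * (\<integral>\<^sup>+x. ennreal ((norm (g x))\<^sup>2) \<partial>lborel)"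
        using star_poincare[OF wg(1,2,4,6) U(1) K(2) m(1,3,4) order.refl m(6)] unfolding a_def by blast
      also have "\<dots> \<le> ennreal (a * h\<^sup>2) * ennreal ((H1_seminorm ?U v)\<^sup>2)"
        unfolding wg(5) using le by (intro mult_right_mono ennreal_leI) auto
      also have "\<dots> = ennreal a * Z"
        using aR by (simp add: Z_def mult.assoc flip: ennreal_mult)
      finally show ?thesis unfolding osc_le_def by blast
    qed
    have CU: "interior C \<subseteq> ?U" if "C \<in> \<C>" for C using that by (intro interior_mono) auto
    have eball: "emeasure lborel (interior C) \<le> ennreal (pi * (diameter C)\<^sup>2)" if sc: "star_cell \<sigma> C" for C
    proof -
      obtain m r where m: "bounded C" "m \<in> C" using star_cellE[OF sc] by metis
      then have "interior C \<subseteq> cball m (diameter C)"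
        using diameter_bounded_bound[OF m] interior_subset[of C] by (auto simp: subset_iff)
      then have "emeasure lborel (interior C) \<le> emeasure lborel (cball m (diameter C))"
        by (intro emeasure_mono) auto
      then show ?thesis using diameter_ge_0[OF m(1)] by (simp add: emeasure_cball unit_ball_vol_2)
    qed
    have "osc_le w (\<Union>C\<in>\<C>. interior C) (ennreal (chain_const a R (card \<C>)) * Z)"
    proof (rule osc_le_chain[OF wm aR(1,2) fin])
      fix C assume C: "C \<in> \<C>"
      then show "interior C \<in> sets borel \<and> emeasure lborel (interior C) < \<infinity> \<and> osc_le w (interior C) (ennreal a * Z)"
        using star_osc[of C] CU[OF C] cells eball[of C] by (auto intro: le_less_trans)
    next
      fix \<A> assume "\<A> \<subseteq> \<C>" "\<A> \<noteq> {}" "\<A> \<noteq> \<C>"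
      with conn obtain C C' where CC: "C \<in> \<A>" "C \<in> \<C>" "C' \<in> \<C>" "C' \<notin> \<A>" "linked \<theta> ?U C C'" by blast
      then obtain q r where q: "q \<in> C" "q \<in> C'" "0 < r" "ball q r \<subseteq> ?U" "r \<le> diameter C" "r \<le> diameter C'"
        "\<theta> * diameter C' \<le> r" by (auto simp: linked_def)
      have sC: "star_cell \<sigma> C" "star_cell \<sigma> C'" using CC cells by auto
      \<comment> \<open>Here \<open>2 \<le> \<sigma>\<close> enters: a disc has diameter twice its
        radius.\<close>
      have sD: "star_cell \<sigma> (cball q r)"
      proof -
        have "star_shaped_wrt_disc (cball q r) q r"
          unfolding star_shaped_wrt_disc_def using q(3) convex_cball[of q r]
          by (auto dest: closed_segment_subset)
        then show ?thesis unfolding star_cell_def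
          using q(3) \<sigma> by (intro conjI exI[of _ q] exI[of _ r]) auto
      qed
      show "\<exists>C\<in>\<A>. \<exists>C'\<in>\<C> - \<A>. \<exists>D. D \<in> sets borel \<and>
        emeasure lborel D < \<infinity> \<and> osc_le w D (ennreal a * Z) \<and>
        emeasure lborel D \<le> ennreal R * emeasure lborel (interior C \<inter> D) \<and>
        emeasure lborel (interior C') \<le> ennreal R * emeasure lborel (D \<inter> interior C')"
      proof (rule bexI[of _ C], rule bexI[of _ C'], intro exI[of _ "ball q r"] conjI)
        show "osc_le w (ball q r) (ennreal a * Z)" using star_osc[OF sD] q by simp
        have eD: "emeasure lborel (ball q r) = ennreal (pi * r\<^sup>2)" using q by (simp add: emeasure_lborel_ball_plane)
        also have "\<dots> \<le> ennreal (4 * \<sigma>\<^sup>2) * emeasure lborel (interior C \<inter> ball q r)"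
          by (rule linked_overlap[OF sC(1) q(1,3,5)])
        also have "\<dots> \<le> ennreal R * emeasure lborel (interior C \<inter> ball q r)"
          using R\<sigma> by (intro mult_right_mono ennreal_leI) auto
        finally show "emeasure lborel (ball q r) \<le> ennreal R * emeasure lborel (interior C \<inter> ball q r)" .
        show "emeasure lborel (ball q r) < \<infinity>" using eD by simp
        have d0: "0 \<le> diameter C'" using q by linarith
        have "(\<theta> * diameter C')\<^sup>2 \<le> r\<^sup>2" using q d0 \<theta> by (intro power_mono) auto
        then have "(diameter C')\<^sup>2 \<le> r\<^sup>2 / \<theta>\<^sup>2" using \<theta> by (simp add: power_mult_distrib field_simps)
        then have "pi * (diameter C')\<^sup>2 \<le> pi * (r\<^sup>2 / \<theta>\<^sup>2)" by (intro mult_left_mono) auto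
        then have "emeasure lborel (interior C') \<le> ennreal (1 / \<theta>\<^sup>2 * (pi * r\<^sup>2))"
          using eball[OF sC(2)] by (auto intro: order.trans ennreal_leI)
        also have "\<dots> = ennreal (1 / \<theta>\<^sup>2) * ennreal (pi * r\<^sup>2)" by (rule ennreal_mult) auto
        also have "\<dots> \<le> ennreal (1 / \<theta>\<^sup>2) * (ennreal (4 * \<sigma>\<^sup>2) * emeasure lborel (interior C' \<inter> ball q r))"
          by (intro mult_left_mono linked_overlap[OF sC(2) q(2,3,6)]) auto
        also have "\<dots> = ennreal R * emeasure lborel (ball q r \<inter> interior C')"
          by (simp add: R_def Int_commute ennreal_mult[symmetric] mult.assoc[symmetric])
        finally show "emeasure lborel (interior C') \<le> ennreal R * emeasure lborel (ball q r \<inter> interior C')" .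
      qed (use CC in auto)
    qed
    then have osc: "osc_le w (\<Union>C\<in>\<C>. interior C) (ennreal ?k * Z)"
      by (rule osc_le_mono) (auto intro!: mult_right_mono ennreal_leI chain_const_mono aR cardn)
    \<comment> \<open>The chain covers only the interiors of the cells, while the patch also
      contains points of common edges; those lie on frontiers and form a null set.\<close>
    have "negligible (\<Union>C\<in>\<C>. frontier C)"
    proof (rule negligible_Union)
      show "finite (frontier ` \<C>)" using fin by simp
      fix t assume "t \<in> frontier ` \<C>"
      then obtain C where C: "C \<in> \<C>" "t = frontier C" by blast
      then have sc: "star_cell \<sigma> C" using cells by blast
      obtain m r where "compact C" "star_shaped_wrt_disc C m r" using star_cellE[OF sc] by metis
      then show "negligible t"
        unfolding C(2) using star_shaped_negligible_frontier compact_imp_closed by blast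
    qed
    then have "AE x in lebesgue. x \<notin> (\<Union>C\<in>\<C>. frontier C)"
      unfolding negligible_iff_null_sets by (rule AE_not_in)
    then have aeU: "AE x in lborel. x \<in> ?U \<longrightarrow> x \<in> (\<Union>C\<in>\<C>. interior C)"
      unfolding AE_completion_iff
    proof eventually_elim
      case (elim x)
      show ?case
      proof
        assume "x \<in> ?U"
        then obtain C where C: "C \<in> \<C>" "x \<in> C" using interior_subset by blast
        then have "x \<in> interior C" using elim closure_subset[of C] by (auto simp: frontier_def)
        then show "x \<in> (\<Union>C\<in>\<C>. interior C)" using C by blast
      qed
    qed
    from osc obtain c where c: "(\<integral>\<^sup>+x\<in>(\<Union>C\<in>\<C>. interior C). ennreal ((w x - c)\<^sup>2) \<partial>lborel) \<le> ennreal ?k * Z"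
      by (auto simp: osc_le_def)
    have "(\<integral>\<^sup>+x\<in>?U. ennreal ((w x - c)\<^sup>2) \<partial>lborel) \<le> (\<integral>\<^sup>+x\<in>(\<Union>C\<in>\<C>. interior C). ennreal ((w x - c)\<^sup>2) \<partial>lborel)"
      by (rule nn_integral_mono_AE) (use aeU in \<open>eventually_elim, auto simp: indicator_def\<close>)
    also note c
    also have "ennreal ?k * Z = ennreal (?k * (h * H1_seminorm ?U v)\<^sup>2)"
      using k by (simp add: Z_def power_mult_distrib flip: ennreal_mult)
    finally have oU: "osc_le w ?U (ennreal (?k * (h * H1_seminorm ?U v)\<^sup>2))"
      unfolding osc_le_def by blast
    have "?U \<noteq> {}"
    proof -
      obtain C0 where C0: "C0 \<in> \<C>" using fin by blast
      then have sc: "star_cell \<sigma> C0" using cells by blast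
      obtain m r where "star_shaped_wrt_disc C0 m r" "m \<in> C0" using star_cellE[OF sc] by metis
      then have "interior C0 \<noteq> {}" using star_shaped_interior[of C0 m r m 1] by auto
      then show ?thesis using CU[OF C0] by auto
    qed
    have "L2_norm ?U (\<lambda>x. v x - mean_value ?U v) \<le> sqrt (?k * (h * H1_seminorm ?U v)\<^sup>2)"
      by (rule L2_norm_minus_mean_le[OF U \<open>?U \<noteq> {}\<close> _ _ wm wg(3) oU]) (use v k in \<open>auto simp: H1_def\<close>)
    also have "\<dots> = sqrt ?k * h * H1_seminorm ?U v"
    proof -
      have "0 \<le> H1_seminorm ?U v" by (simp add: H1_seminorm_def L2_norm_def)
      moreover have "0 \<le> h" unfolding h_def using U by (simp add: diameter_ge_0)
      ultimately show ?thesis by (simp add: real_sqrt_mult)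
    qed
    finally show "L2_norm ?U (\<lambda>x. v x - mean_value ?U v) \<le> sqrt ?k * diameter ?U * H1_seminorm ?U v"
      by (simp add: h_def)
  qed
qed

subsection \<open>Planar triangles and segments\<close>

text \<open>The determinant of two plane vectors: length of \<open>u\<close> times the signed
  distance of \<open>w\<close> from the line spanned by \<open>u\<close>. Its sign tells the side of
  the line.\<close>

definition cross2 :: "point \<Rightarrow> point \<Rightarrow> real" where
  "cross2 u w = u $ 1 * w $ 2 - u $ 2 * w $ 1"

lemma cross2_simps:
  "cross2 u (w + w') = cross2 u w + cross2 u w'" "cross2 u (w - w') = cross2 u w - cross2 u w'"
  "cross2 u (s *\<^sub>R w) = s * cross2 u w" "cross2 u u = 0"
  "cross2 (u + u') w = cross2 u w + cross2 u' w" "cross2 (u - u') w = cross2 u w - cross2 u' w"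
  "cross2 (s *\<^sub>R u) w = s * cross2 u w"
  by (simp_all add: cross2_def algebra_simps)

lemma cross2_skew: "cross2 u w = - cross2 w u"
  by (simp add: cross2_def)

lemma inner_point: "(u::point) \<bullet> w = u $ 1 * w $ 1 + u $ 2 * w $ 2"
  by (simp add: inner_vec_def sum_2)

lemma cross2_square: "(cross2 u w)\<^sup>2 + (u \<bullet> w)\<^sup>2 = (norm u)\<^sup>2 * (norm w)\<^sup>2"
  unfolding power2_norm_eq_inner by (simp add: cross2_def inner_point algebra_simps power2_eq_square)

lemma abs_cross2_le: "\<bar>cross2 u w\<bar> \<le> norm u * norm w"
proof -
  have "(cross2 u w)\<^sup>2 \<le> (norm u * norm w)\<^sup>2"
    using cross2_square[of u w] zero_le_power2[of "u \<bullet> w"] unfolding power_mult_distrib by linarith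
  then show ?thesis by (simp add: abs_le_square_iff[symmetric] abs_mult)
qed

text \<open>With \<open>s\<close> the coefficient of the orthogonal projection of \<open>w\<close>,
  Lagrange's identity \<open>cross2_square\<close> has no inner product term left and becomes an
  equality between determinant and base times distance.\<close>

lemma cross2_ge_if_line_distance:
  assumes u: "u \<noteq> 0" and d: "\<And>s. \<eta> \<le> norm (w - s *\<^sub>R u)" and \<eta>: "0 \<le> \<eta>"
  shows "\<eta> * norm u \<le> \<bar>cross2 u w\<bar>"
proof -
  define s where "s = (u \<bullet> w) / (u \<bullet> u)"
  have uu: "u \<bullet> u \<noteq> 0" using u by simp
  have "u \<bullet> (w - s *\<^sub>R u) = 0" using uu by (simp add: s_def inner_diff_right)
  then have "(cross2 u w)\<^sup>2 = (norm u)\<^sup>2 * (norm (w - s *\<^sub>R u))\<^sup>2"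
    using cross2_square[of u "w - s *\<^sub>R u"] by (simp add: cross2_simps)
  then have "\<bar>cross2 u w\<bar>\<^sup>2 = (norm u * norm (w - s *\<^sub>R u))\<^sup>2"
    by (simp add: power_mult_distrib)
  then have "\<bar>cross2 u w\<bar> = norm u * norm (w - s *\<^sub>R u)"
    by (rule power2_eq_imp_eq) auto
  then show ?thesis using mult_left_mono[OF d[of s], of "norm u"] by (simp add: mult.commute)
qed

text \<open>Cramer's rule.\<close>

lemma cross2_decompose:
  assumes "cross2 u e \<noteq> 0"
  shows "w = (cross2 w e / cross2 u e) *\<^sub>R u + (cross2 u w / cross2 u e) *\<^sub>R e"
proof -
  have "cross2 u e *\<^sub>R w = cross2 w e *\<^sub>R u + cross2 u w *\<^sub>R e"
    by (simp add: vec_eq_iff forall_2 cross2_def algebra_simps)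
  then have "(1 / cross2 u e) *\<^sub>R (cross2 u e *\<^sub>R w) = (1 / cross2 u e) *\<^sub>R (cross2 w e *\<^sub>R u + cross2 u w *\<^sub>R e)"
    by simp
  then show ?thesis using assms by (simp add: scaleR_add_right)
qed

text \<open>In coordinates along base and median, \<open>x = q + \<alpha> u + \<beta> e\<close>, the
  triangle is given by \<open>0 \<le> \<beta>\<close> and
  \<open>2 * \<bar>\<alpha>\<bar> \<le> 1 - \<beta>\<close>. For a disc of radius \<open>r\<close>
  the height \<open>\<eta>\<close> bounds \<open>\<beta>\<close> by \<open>r / \<eta>\<close>, and
  then \<open>\<bar>\<alpha>\<bar> * dist a b\<close> is at most \<open>r + \<beta> * h\<close>,
  hence at most \<open>(1 + \<sigma>) * r\<close>. The radius is chosen to make this a quarter of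
  the base.\<close>

lemma half_disc_subset_triangle:
  fixes a b c :: point
  defines "q \<equiv> midpoint a b"
  assumes ab: "a \<noteq> b" and h: "dist c q \<le> h" "dist a b \<le> h" and \<eta>: "0 < \<eta>" "h \<le> \<sigma> * \<eta>"
    and height: "\<eta> * dist a b \<le> \<bar>cross2 (b - a) (c - q)\<bar>"
    and x: "dist x q \<le> dist a b / (4 * (1 + \<sigma>))" "0 \<le> cross2 (b - a) (x - q) * cross2 (b - a) (c - q)"
  shows "x \<in> convex hull {a, b, c}"
proof -
  let ?u = "b - a" and ?e = "c - q" and ?w = "x - q"
  let ?D = "cross2 ?u ?e"
  define \<alpha> where "\<alpha> = cross2 ?w ?e / ?D"
  define \<beta> where "\<beta> = cross2 ?u ?w / ?D"
  have l: "dist a b > 0" using ab by simp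
  then have D: "\<bar>?D\<bar> > 0" using height \<eta> by (smt (verit) mult_pos_pos)
  have \<sigma>: "\<sigma> > 0" using l h \<eta> by (smt (verit) zero_less_mult_pos2)
  have w: "?w = \<alpha> *\<^sub>R ?u + \<beta> *\<^sub>R ?e"
    unfolding \<alpha>_def \<beta>_def by (rule cross2_decompose) (use D in auto)
  have \<beta>0: "\<beta> \<ge> 0"
    using x(2) D unfolding \<beta>_def by (simp add: zero_le_divide_iff zero_le_mult_iff)
  define r where "r = dist a b / (4 * (1 + \<sigma>))"
  have r: "4 * r * (1 + \<sigma>) = dist a b" "r > 0" using \<sigma> l by (auto simp: r_def field_simps)
  have \<beta>r: "\<beta> * \<eta> \<le> r"
  proof -
    have "\<beta> = \<bar>cross2 ?u ?w\<bar> / \<bar>?D\<bar>" using \<beta>0 unfolding \<beta>_def by (metis abs_divide abs_of_nonneg)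
    then have "\<beta> * \<bar>?D\<bar> = \<bar>cross2 ?u ?w\<bar>" using D by simp
    also have "\<dots> \<le> norm ?u * norm ?w" by (rule abs_cross2_le)
    also have "\<dots> \<le> dist a b * r" using x(1) by (intro mult_mono) (auto simp: dist_norm norm_minus_commute r_def)
    finally have "\<beta> * (\<eta> * dist a b) \<le> dist a b * r"
      using mult_left_mono[OF height \<beta>0] by linarith
    then have "dist a b * (\<beta> * \<eta>) \<le> dist a b * r" by (simp add: mult_ac)
    then show ?thesis using l by (simp only: mult_le_cancel_left_pos)
  qed
  have \<beta>h: "\<beta> * h \<le> \<sigma> * r"
  proof -
    have "\<beta> * h \<le> \<beta> * (\<sigma> * \<eta>)" using \<eta> \<beta>0 by (intro mult_left_mono)
    also have "\<dots> = \<sigma> * (\<beta> * \<eta>)" by simp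
    also have "\<dots> \<le> \<sigma> * r" using \<beta>r \<sigma> by (intro mult_left_mono) auto
    finally show ?thesis .
  qed
  have \<beta>1: "\<beta> \<le> 1/2"
  proof -
    have "\<beta> * (\<sigma> * \<eta>) \<le> \<sigma> * r" using mult_left_mono[OF \<beta>r, of \<sigma>] \<sigma> by (simp add: mult_ac)
    also have "\<dots> \<le> dist a b / 4" using r by (simp add: algebra_simps)
    also have "\<dots> \<le> (1/4) * (\<sigma> * \<eta>)" using h \<eta> by simp
    finally have "\<beta> * (\<sigma> * \<eta>) \<le> (1/4) * (\<sigma> * \<eta>)" .
    then have "\<beta> \<le> 1/4" using \<sigma> \<eta> by (simp only: mult_le_cancel_right_pos mult_pos_pos)
    then show ?thesis by simp
  qed
  have "\<alpha> *\<^sub>R ?u = ?w - \<beta> *\<^sub>R ?e" using w by simp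
  then have "\<bar>\<alpha>\<bar> * dist a b = norm (?w - \<beta> *\<^sub>R ?e)"
    by (metis dist_norm norm_minus_commute norm_scaleR)
  also have "\<dots> \<le> norm ?w + \<beta> * norm ?e" using norm_triangle_ineq4[of ?w "\<beta> *\<^sub>R ?e"] \<beta>0 by simp
  also have "\<dots> \<le> r + \<beta> * h" using x(1) h \<beta>0 by (intro add_mono mult_left_mono) (auto simp: dist_norm r_def)
  also have "\<dots> \<le> r * (1 + \<sigma>)" using \<beta>h by (simp add: algebra_simps)
  also have "\<dots> = dist a b / 4" using r by simp
  finally have \<alpha>: "\<bar>\<alpha>\<bar> \<le> 1/4" using l by simp
  have \<alpha>': "4 * \<alpha> \<le> 1" "- 1 \<le> 4 * \<alpha>" using \<alpha> by (auto simp: abs_le_iff)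
  have "x = ((1 - \<beta>) / 2 - \<alpha>) *\<^sub>R a + ((1 - \<beta>) / 2 + \<alpha>) *\<^sub>R b + \<beta> *\<^sub>R c"
  proof -
    have "x = q + \<alpha> *\<^sub>R ?u + \<beta> *\<^sub>R ?e" using w by (simp add: algebra_simps)
    then show ?thesis unfolding q_def midpoint_def
      by (simp add: vec_eq_iff forall_2 field_simps)
  qed
  moreover have "0 \<le> (1 - \<beta>) / 2 - \<alpha>" using \<alpha>' \<beta>1 by (simp add: field_simps)
  moreover have "0 \<le> (1 - \<beta>) / 2 + \<alpha>" using \<alpha>' \<beta>1 by (simp add: field_simps)
  moreover have "((1 - \<beta>) / 2 - \<alpha>) + ((1 - \<beta>) / 2 + \<alpha>) + \<beta> = 1" by (simp add: field_simps)
  ultimately show ?thesis unfolding convex_hull_3 using \<beta>0 by blast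
qed

text \<open>Not overlapping, the two triangles lie on opposite sides of their base, so that
  their half discs complement each other.\<close>

lemma disc_subset_adjacent_triangles:
  fixes a b c c' :: point
  defines "q \<equiv> midpoint a b"
  assumes ab: "a \<noteq> b"
    and c: "dist c q \<le> h" "dist a b \<le> h" "0 < \<eta>" "h \<le> \<sigma> * \<eta>" "\<eta> * dist a b \<le> \<bar>cross2 (b - a) (c - q)\<bar>"
    and c': "dist c' q \<le> h'" "dist a b \<le> h'" "0 < \<eta>'" "h' \<le> \<sigma> * \<eta>'" "\<eta>' * dist a b \<le> \<bar>cross2 (b - a) (c' - q)\<bar>"
    and disj: "interior (convex hull {a, b, c}) \<inter> interior (convex hull {a, b, c'}) = {}"
  shows "ball q (dist a b / (4 * (1 + \<sigma>))) \<subseteq> convex hull {a, b, c} \<union> convex hull {a, b, c'}"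
proof -
  define r where "r = dist a b / (4 * (1 + \<sigma>))"
  define L where "L x = cross2 (b - a) (x - q)" for x
  have l: "dist a b > 0" using ab by simp
  have \<sigma>: "\<sigma> > 0" using l c by (smt (verit) zero_less_mult_pos2)
  have r: "r > 0" using l \<sigma> by (simp add: r_def)
  have Lc: "L c \<noteq> 0" using c l mult_pos_pos[of \<eta> "dist a b"] unfolding L_def by linarith
  have Lc': "L c' \<noteq> 0" using c' l mult_pos_pos[of \<eta>' "dist a b"] unfolding L_def by linarith
  have T: "x \<in> convex hull {a, b, c}" if "dist x q \<le> r" "0 \<le> L x * L c" for x
    using half_disc_subset_triangle[OF ab c(1)[unfolded q_def] c(2-4) c(5)[unfolded q_def], of x] that
    by (simp add: L_def r_def q_def)
  have T': "x \<in> convex hull {a, b, c'}" if "dist x q \<le> r" "0 \<le> L x * L c'" for x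
    using half_disc_subset_triangle[OF ab c'(1)[unfolded q_def] c'(2-4) c'(5)[unfolded q_def], of x] that
    by (simp add: L_def r_def q_def)
  have contL: "continuous_on UNIV L"
    unfolding L_def cross2_def by (intro continuous_intros)
  have "L c * L c' < 0"
  proof (rule ccontr)
    assume "\<not> L c * L c' < 0"
    then have pos: "L c * L c' > 0" using Lc Lc' by (simp add: less_le)
    define O' where "O' = ball q r \<inter> {x. 0 < L x * L c}"
    have "open O'" unfolding O'_def
      by (intro open_Int open_ball open_Collect_less continuous_intros continuous_on_subset[OF contL]) auto
    moreover have "O' \<subseteq> convex hull {a, b, c}" using T by (auto simp: O'_def dist_commute)
    moreover have "O' \<subseteq> convex hull {a, b, c'}"
    proof
      fix x assume "x \<in> O'"
      then have "dist x q \<le> r" "0 < L x * L c" by (auto simp: O'_def dist_commute)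
      moreover from this pos have "0 \<le> L x * L c'"
        by (auto simp: zero_less_mult_iff zero_le_mult_iff)
      ultimately show "x \<in> convex hull {a, b, c'}" by (intro T')
    qed
    ultimately have "O' \<subseteq> interior (convex hull {a, b, c}) \<inter> interior (convex hull {a, b, c'})"
      by (intro Int_greatest interior_maximal)
    then have O'0: "O' = {}" using disj by simp
    have "q + (r / (2 * (dist c q + 1))) *\<^sub>R (c - q) \<in> O'"
    proof -
      let ?t = "r / (2 * (dist c q + 1))"
      have t: "?t > 0" using r by (simp add: add_nonneg_pos)
      have d0: "0 < 2 * (dist c q + 1)" by (simp add: add_nonneg_pos)
      have "0 < dist c q + 2" by (simp add: add_nonneg_pos)
      then have d: "dist c q < 2 * (dist c q + 1)" by (simp add: algebra_simps)
      have "?t * dist c q < ?t * (2 * (dist c q + 1))" using t d by (intro mult_strict_left_mono) auto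
      also have "\<dots> = r" using d0 by simp
      finally have "?t * dist c q < r" .
      then have "dist q (q + ?t *\<^sub>R (c - q)) < r"
        using t r by (simp add: dist_norm)
      moreover have "L (q + ?t *\<^sub>R (c - q)) * L c = ?t * (L c * L c)"
        by (simp add: L_def cross2_simps)
      moreover have "?t * (L c * L c) > 0"
        using mult_pos_pos[OF t, of "L c * L c"] Lc not_real_square_gt_zero[of "L c"] by blast
      ultimately show ?thesis by (simp add: O'_def)
    qed
    then show False using O'0 by simp
  qed
  show ?thesis unfolding r_def[symmetric]
  proof
    fix x assume "x \<in> ball q r"
    then have x: "dist x q \<le> r" by (simp add: dist_commute)
    have "0 \<le> L x * L c \<or> 0 \<le> L x * L c'"
      using \<open>L c * L c' < 0\<close> by (simp add: mult_less_0_iff zero_le_mult_iff) linarith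
    then show "x \<in> convex hull {a, b, c} \<union> convex hull {a, b, c'}" using T T' x by blast
  qed
qed

text \<open>Two common points put both segments on one line. Measured there with \<open>a\<close> at
  0 and \<open>b\<close> at 1, the ends \<open>a'\<close> and \<open>b'\<close> sit at
  \<open>\<alpha>\<close> and \<open>\<alpha> + k\<close>. Two intervals that share more than a
  point, neither having an end strictly inside the other, coincide; the sign of \<open>k\<close>
  records the orientation.\<close>

lemma segments_eq_if_two_common_points:
  fixes a b a' b' :: "'a::real_vector"
  assumes ne: "a \<noteq> b" "a' \<noteq> b'"
    and nodes: "a \<notin> open_segment a' b'" "b \<notin> open_segment a' b'" "a' \<notin> open_segment a b" "b' \<notin> open_segment a b"
    and pq: "p \<noteq> q" "p \<in> closed_segment a b" "q \<in> closed_segment a b" "p \<in> closed_segment a' b'" "q \<in> closed_segment a' b'"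
  shows "closed_segment a b = closed_segment a' b'"
proof -
  obtain s1 s2 t1 t2 where s: "0 \<le> s1" "s1 \<le> 1" "p = (1 - s1) *\<^sub>R a + s1 *\<^sub>R b" "0 \<le> s2" "s2 \<le> 1" "q = (1 - s2) *\<^sub>R a + s2 *\<^sub>R b"
    and t: "0 \<le> t1" "t1 \<le> 1" "p = (1 - t1) *\<^sub>R a' + t1 *\<^sub>R b'" "0 \<le> t2" "t2 \<le> 1" "q = (1 - t2) *\<^sub>R a' + t2 *\<^sub>R b'"
    using pq by (auto simp: in_segment)
  have s12: "s1 \<noteq> s2" and t12: "t1 \<noteq> t2" using s t pq(1) by auto
  define k where "k = (s2 - s1) / (t2 - t1)"
  define \<alpha> where "\<alpha> = s1 - t1 * k"
  have k: "k \<noteq> 0" using s12 t12 by (simp add: k_def)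
  have "(t2 - t1) *\<^sub>R (b' - a') = q - p" unfolding t(3,6) by (simp add: algebra_simps)
  also have "\<dots> = (s2 - s1) *\<^sub>R (b - a)" unfolding s(3,6) by (simp add: algebra_simps)
  finally have "(1 / (t2 - t1)) *\<^sub>R (t2 - t1) *\<^sub>R (b' - a') = (1 / (t2 - t1)) *\<^sub>R (s2 - s1) *\<^sub>R (b - a)" by simp
  then have ba: "b' - a' = k *\<^sub>R (b - a)" using t12 by (simp add: k_def)
  have pa: "p = a' + t1 *\<^sub>R (b' - a')" unfolding t(3) by (simp add: algebra_simps)
  moreover have "p = a + s1 *\<^sub>R (b - a)" unfolding s(3) by (simp add: algebra_simps)
  ultimately have "a' = a + s1 *\<^sub>R (b - a) - t1 *\<^sub>R (b' - a')" by (metis add_diff_cancel_right')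
  then have a': "a' = a + \<alpha> *\<^sub>R (b - a)" unfolding ba by (simp add: \<alpha>_def algebra_simps)
  have "b' = a' + k *\<^sub>R (b - a)" by (simp flip: ba)
  then have b': "b' = a + (\<alpha> + k) *\<^sub>R (b - a)" unfolding a' by (simp add: scaleR_add_left)
  have n1: "\<not> (0 < \<alpha> \<and> \<alpha> < 1)"
  proof
    assume "0 < \<alpha> \<and> \<alpha> < 1"
    then have "a' \<in> open_segment a b"
      unfolding in_segment using ne(1) by (intro conjI exI[of _ \<alpha>]) (auto simp: a' algebra_simps)
    then show False using nodes by blast
  qed
  have n2: "\<not> (0 < \<alpha> + k \<and> \<alpha> + k < 1)"
  proof
    assume "0 < \<alpha> + k \<and> \<alpha> + k < 1"
    then have "b' \<in> open_segment a b"
      unfolding in_segment using ne(1) by (intro conjI exI[of _ "\<alpha> + k"]) (auto simp: b' algebra_simps)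
    then show False using nodes by blast
  qed
  have n3: "\<not> (0 < - \<alpha> / k \<and> - \<alpha> / k < 1)"
  proof
    assume *: "0 < - \<alpha> / k \<and> - \<alpha> / k < 1"
    have "(1 - (- \<alpha> / k)) *\<^sub>R a' + (- \<alpha> / k) *\<^sub>R b' = a' + (- \<alpha> / k) *\<^sub>R (b' - a')" by (simp add: algebra_simps)
    also have "\<dots> = a' + (- \<alpha>) *\<^sub>R (b - a)" using k by (simp add: ba)
    also have "\<dots> = a" unfolding a' by simp
    finally have "a \<in> open_segment a' b'"
      unfolding in_segment using * ne(2) by (intro conjI exI[of _ "- \<alpha> / k"]) auto
    then show False using nodes by blast
  qed
  have n4: "\<not> (0 < (1 - \<alpha>) / k \<and> (1 - \<alpha>) / k < 1)"
  proof
    assume *: "0 < (1 - \<alpha>) / k \<and> (1 - \<alpha>) / k < 1"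
    have "(1 - ((1 - \<alpha>) / k)) *\<^sub>R a' + ((1 - \<alpha>) / k) *\<^sub>R b' = a' + ((1 - \<alpha>) / k) *\<^sub>R (b' - a')" by (simp add: algebra_simps)
    also have "\<dots> = a' + (1 - \<alpha>) *\<^sub>R (b - a)" using k by (simp add: ba)
    also have "\<dots> = b" unfolding a' by (simp add: algebra_simps)
    finally have "b \<in> open_segment a' b'"
      unfolding in_segment using * ne(2) by (intro conjI exI[of _ "(1 - \<alpha>) / k"]) auto
    then show False using nodes by blast
  qed
  have s1: "s1 = \<alpha> + t1 * k" by (simp add: \<alpha>_def)
  have s2: "s2 = \<alpha> + t2 * k" 
  proof -
    have "k * (t2 - t1) = s2 - s1" using t12 by (simp add: k_def)
    then show ?thesis unfolding \<alpha>_def by (simp add: algebra_simps)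
  qed
  have "(\<alpha> = 0 \<and> \<alpha> + k = 1) \<or> (\<alpha> = 1 \<and> \<alpha> + k = 0)"
  proof (cases "k > 0")
    case True
    have b1: "\<alpha> \<le> s1" "s1 \<le> \<alpha> + k" "\<alpha> \<le> s2" "s2 \<le> \<alpha> + k"
      using True t unfolding s1 s2 by (simp_all add: mult_left_le_one_le)
    have "\<not> (\<alpha> < 0 \<and> 0 < \<alpha> + k)" "\<not> (\<alpha> < 1 \<and> 1 < \<alpha> + k)"
      using n3 n4 True by (auto simp: field_simps)
    then show ?thesis using n1 n2 b1 s s12 by linarith
  next
    case False
    then have k0: "k < 0" using k by simp
    have b1: "s1 \<le> \<alpha>" "\<alpha> + k \<le> s1" "s2 \<le> \<alpha>" "\<alpha> + k \<le> s2"
      using k0 t mult_left_le_one_le[of "-k" t1] mult_left_le_one_le[of "-k" t2]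
      unfolding s1 s2 by (auto simp: mult_nonneg_nonpos)
    have "\<not> (\<alpha> + k < 0 \<and> 0 < \<alpha>)" "\<not> (\<alpha> + k < 1 \<and> 1 < \<alpha>)"
      using n3 n4 k0 by (auto simp: field_simps)
    then show ?thesis using n1 n2 b1 s s12 by linarith
  qed
  then show ?thesis
  proof
    assume "\<alpha> = 0 \<and> \<alpha> + k = 1"
    then have "a' = a + 0 *\<^sub>R (b - a)" "b' = a + 1 *\<^sub>R (b - a)" using a' b' by metis+
    then have "a' = a" "b' = b" by simp_all
    then show ?thesis by simp
  next
    assume "\<alpha> = 1 \<and> \<alpha> + k = 0"
    then have "a' = a + 1 *\<^sub>R (b - a)" "b' = a + 0 *\<^sub>R (b - a)" using a' b' by metis+
    then have "a' = b" "b' = a" by simp_all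
    then show ?thesis by (simp add: closed_segment_commute)
  qed
qed

section \<open>Star discs and the lines of boundary edges\<close>

lemma star_shaped_interior_disc:
  assumes K: "star_shaped_wrt_disc K m r" and x: "x \<in> K" and y: "dist y m < r" and t: "0 < t" "t \<le> 1"
  shows "x + t *\<^sub>R (y - x) \<in> interior K"
proof -
  have "star_shaped_wrt_disc K y (r - dist y m)"
    unfolding star_shaped_wrt_disc_def
  proof (intro conjI ballI)
    fix p q assume "p \<in> cball y (r - dist y m)" "q \<in> K"
    moreover from this have "p \<in> cball m r"
      using dist_triangle[of m p y] by (simp add: dist_commute)
    ultimately show "closed_segment p q \<subseteq> K" using K by (simp add: star_shaped_wrt_disc_def)
  qed (use y in simp)
  from star_shaped_interior[OF this x t] show ?thesis .
qed

text \<open>If the line entered the open disc at \<open>p\<close>, the midpoint of the edge would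
  lie on the segment from \<open>p\<close> to the farther end of the edge, without being that end.
  Star-shapedness would then make the midpoint interior. The case \<open>s \<ge> 1/2\<close> is the
  one where \<open>a\<close> is the farther end.\<close>

lemma line_of_frontier_edge_misses_disc:
  assumes K: "closed K" "star_shaped_wrt_disc K m r"
    and E: "a \<noteq> b" "closed_segment a b \<subseteq> frontier K"
  shows "r \<le> dist (a + s *\<^sub>R (b - a)) m"
proof (rule ccontr)
  let ?p = "a + s *\<^sub>R (b - a)"
  assume "\<not> ?thesis"
  then have p: "dist ?p m < r" by simp
  have ab: "a \<in> K" "b \<in> K" using E K by (auto simp: frontier_def)
  have "midpoint a b \<in> interior K"
  proof (cases "s \<ge> 1/2")
    case True
    have "a + (1 / (2 * s)) *\<^sub>R (?p - a) \<in> interior K"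
      by (rule star_shaped_interior_disc[OF K(2) ab(1) p]) (use True in auto)
    moreover have "a + (1 / (2 * s)) *\<^sub>R (?p - a) = midpoint a b"
      using True by (simp add: midpoint_def vec_eq_iff field_simps)
    ultimately show ?thesis by simp
  next
    case False
    have "b + (1 / (2 * (1 - s))) *\<^sub>R (?p - b) \<in> interior K"
      by (rule star_shaped_interior_disc[OF K(2) ab(2) p]) (use False in auto)
    moreover have "b + (1 / (2 * (1 - s))) *\<^sub>R (?p - b) = midpoint a b"
    proof -
      have *: "?p - b = (1 - s) *\<^sub>R (a - b)" by (simp add: algebra_simps)
      have "1 / (2 * (1 - s)) * (1 - s) = 1 / 2" using False by (simp add: field_simps)
      then have "b + (1 / (2 * (1 - s))) *\<^sub>R (?p - b) = b + (1 / 2) *\<^sub>R (a - b)"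
        unfolding * scaleR_scaleR by simp
      also have "\<dots> = midpoint a b" by (simp add: midpoint_def vec_eq_iff field_simps)
      finally show ?thesis .
    qed
    ultimately show ?thesis by simp
  qed
  moreover have "midpoint a b \<in> frontier K" using E(2) midpoint_in_closed_segment by blast
  ultimately show False by (simp add: frontier_def)
qed

text \<open>The star radius bounds the height of the auxiliary triangle over its edge from below;
  this is how the triangles inherit shape regularity from the element.\<close>

lemma height_over_frontier_edge:
  assumes K: "closed K" "star_shaped_wrt_disc K m r"
    and E: "a \<noteq> b" "closed_segment a b \<subseteq> frontier K"
  shows "r * dist a b \<le> \<bar>cross2 (b - a) (m - a)\<bar>"
proof -
  have "r * norm (b - a) \<le> \<bar>cross2 (b - a) (m - a)\<bar>"
  proof (rule cross2_ge_if_line_distance)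
    fix s
    show "r \<le> norm (m - a - s *\<^sub>R (b - a))"
      using line_of_frontier_edge_misses_disc[OF K E, of s] by (simp add: dist_norm norm_minus_commute algebra_simps)
    show "0 \<le> r" using K by (simp add: star_shaped_wrt_disc_def)
  qed (use E in simp)
  then show ?thesis by (simp add: dist_norm norm_minus_commute)
qed

lemma cross2_midpoint: "cross2 (b - a) (c - midpoint a b) = cross2 (b - a) (c - a)"
  by (simp add: cross2_def midpoint_def field_simps)

text \<open>The witness is the disc inscribed in the half disc at the midpoint of the base.\<close>

lemma triangle_star_cell:
  fixes a b c :: point
  assumes ab: "a \<noteq> b" and h: "dist c (midpoint a b) \<le> h" "dist a b \<le> h" and \<eta>: "0 < \<eta>" "\<eta> \<le> h" "h \<le> \<sigma> * \<eta>"
    and height: "\<eta> * dist a b \<le> \<bar>cross2 (b - a) (c - a)\<bar>"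
    and diam: "diameter (convex hull {a, b, c}) \<le> h" and \<kappa>: "h \<le> \<kappa> * dist a b"
  shows "star_cell (8 * \<kappa> * \<sigma> * (1 + \<sigma>)) (convex hull {a, b, c})"
proof -
  define q where "q = midpoint a b"
  define r where "r = dist a b / (4 * (1 + \<sigma>))"
  have l: "dist a b > 0" using ab by simp
  have \<sigma>: "\<sigma> > 0" using \<eta> zero_less_mult_pos2[of \<sigma> \<eta>] by linarith
  have r: "r > 0" using l \<sigma> by (simp add: r_def)
  have hp: "h > 0" using \<eta> by linarith
  \<comment> \<open>The centre \<open>p\<close> is within \<open>r / 2\<close> of \<open>q\<close>
    and the radius \<open>t * \<eta>\<close> is at most \<open>r / 2\<close>, so the disc stays in
    the one of radius \<open>r\<close> around \<open>q\<close>. The distance of \<open>p\<close>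
    from the base is \<open>t\<close> times the height, at least \<open>t * \<eta>\<close>, so the
    disc does not cross the base.\<close>
  define t where "t = r / (2 * h)"
  have t: "t > 0" "t * h = r / 2" using r hp by (auto simp: t_def)
  define p where "p = q + t *\<^sub>R (c - q)"
  have height': "\<eta> * dist a b \<le> \<bar>cross2 (b - a) (c - q)\<bar>"
    unfolding q_def cross2_midpoint by (rule height)
  have sub: "cball p (t * \<eta>) \<subseteq> convex hull {a, b, c}"
  proof
    fix x assume "x \<in> cball p (t * \<eta>)"
    then have x: "norm (x - p) \<le> t * \<eta>" by (simp add: dist_norm norm_minus_commute)
    show "x \<in> convex hull {a, b, c}"
    proof (rule half_disc_subset_triangle[OF ab h \<eta>(1,3), folded q_def])
      show "\<eta> * dist a b \<le> \<bar>cross2 (b - a) (c - q)\<bar>" by (rule height')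
      have "norm (x - q) = norm ((x - p) + t *\<^sub>R (c - q))" by (simp add: p_def)
      also have "\<dots> \<le> norm (x - p) + norm (t *\<^sub>R (c - q))" by (rule norm_triangle_ineq)
      also have "\<dots> = norm (x - p) + t * norm (c - q)" using t by simp
      also have "\<dots> \<le> t * \<eta> + t * h"
        using x h t by (intro add_mono mult_left_mono) (auto simp: dist_norm q_def)
      also have "\<dots> \<le> t * h + t * h" using \<eta> t by (intro add_mono mult_left_mono) auto
      finally have "norm (x - q) \<le> r" using t(2) by linarith
      then show "dist x q \<le> dist a b / (4 * (1 + \<sigma>))" unfolding r_def dist_norm .
      let ?D = "cross2 (b - a) (c - q)"
      have "\<bar>cross2 (b - a) (x - p)\<bar> \<le> norm (b - a) * norm (x - p)" by (rule abs_cross2_le)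
      also have "\<dots> \<le> norm (b - a) * (t * \<eta>)" using x by (intro mult_left_mono) auto
      also have "\<dots> = t * (\<eta> * dist a b)" by (simp add: dist_norm norm_minus_commute)
      also have "\<dots> \<le> t * \<bar>?D\<bar>" using height' t by (intro mult_left_mono) auto
      finally have *: "\<bar>cross2 (b - a) (x - p)\<bar> \<le> t * \<bar>?D\<bar>" .
      have "cross2 (b - a) (x - q) = cross2 (b - a) (x - p) + t * ?D"
        by (simp add: p_def cross2_simps)
      then show "0 \<le> cross2 (b - a) (x - q) * ?D"
        using * t by (cases "?D \<ge> 0") (auto simp: zero_le_mult_iff)
    qed
  qed
  have "star_shaped_wrt_disc (convex hull {a, b, c}) p (t * \<eta>)"
    unfolding star_shaped_wrt_disc_def
  proof (intro conjI ballI closed_segment_subset convex_convex_hull)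
    fix y assume "y \<in> cball p (t * \<eta>)"
    then show "y \<in> convex hull {a, b, c}" using sub by blast
  qed (use t \<eta> in simp)
  moreover have "p \<in> convex hull {a, b, c}" using sub t \<eta> by (auto simp: subset_iff)
  \<comment> \<open>The quotient \<open>h / (t * \<eta>)\<close> equals
    \<open>2 * (h / r) * (h / \<eta>)\<close>. Here \<open>h / \<eta>\<close> is at most
    \<open>\<sigma>\<close>, and \<open>h / r\<close> is \<open>4 * (1 + \<sigma>)\<close> times
    \<open>h / dist a b\<close>, which is at most \<open>\<kappa>\<close>.\<close>
  moreover have "diameter (convex hull {a, b, c}) \<le> 8 * \<kappa> * \<sigma> * (1 + \<sigma>) * (t * \<eta>)"
  proof -
    have "\<kappa> * dist a b > 0" using \<kappa> hp by linarith
    then have \<kappa>0: "\<kappa> > 0" using l zero_less_mult_pos2 by blast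
    have "4 * (1 + \<sigma>) * r = dist a b" using \<sigma> by (simp add: r_def)
    then have "dist a b / r = 4 * (1 + \<sigma>)" using r by (simp add: field_simps)
    then have "8 * \<kappa> * \<sigma> * (1 + \<sigma>) * (t * \<eta>) = 2 * \<kappa> * (dist a b / r) * (\<sigma> * \<eta>) * t"
      by (simp add: algebra_simps)
    also have "\<dots> = (\<kappa> * dist a b / h) * (\<sigma> * \<eta>)" using r hp by (simp add: t_def field_simps)
    also have "\<dots> \<ge> 1 * h" 
      using \<kappa> hp \<eta> \<kappa>0 by (intro mult_mono) (auto simp: field_simps)
    finally show ?thesis using diam by simp
  qed
  moreover have "compact (convex hull {a, b, c})" by (simp add: finite_imp_compact compact_convex_hull)
  ultimately show ?thesis unfolding star_cell_def by blast
qed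

subsection \<open>Polygonal domains near a boundary point\<close>

definition ray :: "point \<Rightarrow> point \<Rightarrow> point set" where
  "ray z w = {z + s *\<^sub>R w |s. 0 \<le> s}"

lemma cross2_eq_0_parallel:
  assumes "cross2 u w = 0" "u \<noteq> 0"
  shows "w = ((u \<bullet> w) / (u \<bullet> u)) *\<^sub>R u"
proof -
  have "(u \<bullet> u) * w $ 1 - (u \<bullet> w) * u $ 1 = - u $ 2 * cross2 u w"
    "(u \<bullet> u) * w $ 2 - (u \<bullet> w) * u $ 2 = u $ 1 * cross2 u w"
    by (simp_all add: cross2_def inner_point algebra_simps)
  then have "(u \<bullet> u) *\<^sub>R w = (u \<bullet> w) *\<^sub>R u"
    using assms by (simp add: vec_eq_iff forall_2)
  then have "(1 / (u \<bullet> u)) *\<^sub>R (u \<bullet> u) *\<^sub>R w = (1 / (u \<bullet> u)) *\<^sub>R (u \<bullet> w) *\<^sub>R u" by simp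
  then show ?thesis using assms by simp
qed

text \<open>The set is starlike with respect to a point on the opposite ray.\<close>

lemma connected_ball_minus_ray:
  assumes w: "w \<noteq> 0" and d: "0 < d"
  shows "connected (ball z d - ray z w)"
proof (rule starlike_imp_connected)
  define e where "e = d / (2 * norm w)"
  have e: "e > 0" "e * norm w < d" using d w by (auto simp: e_def)
  define a where "a = z - e *\<^sub>R w"
  have "a \<in> ball z d" using e by (simp add: a_def dist_norm)
  moreover have "a \<notin> ray z w"
  proof
    assume "a \<in> ray z w"
    then obtain s where "0 \<le> s" "z - e *\<^sub>R w = z + s *\<^sub>R w" by (auto simp: a_def ray_def)
    then have "(s + e) *\<^sub>R w = 0" by (simp add: algebra_simps)
    then show False using e \<open>0 \<le> s\<close> w by simp
  qed
  moreover have "closed_segment a x \<subseteq> ball z d - ray z w" if x: "x \<in> ball z d - ray z w" for x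
  proof
    fix p assume p: "p \<in> closed_segment a x"
    have "p \<in> ball z d"
      using p x \<open>a \<in> ball z d\<close> convex_ball by (metis DiffD1 closed_segment_subset subsetD)
    moreover have "p \<notin> ray z w"
    proof
      assume "p \<in> ray z w"
      then obtain s where s: "0 \<le> s" "p = z + s *\<^sub>R w" by (auto simp: ray_def)
      obtain u where u: "0 \<le> u" "u \<le> 1" "p = (1 - u) *\<^sub>R a + u *\<^sub>R x" using p by (auto simp: in_segment)
      show False
      proof (cases "u = 0")
        case True
        then show False using u \<open>p \<in> ray z w\<close> \<open>a \<notin> ray z w\<close> by simp
      next
        case False
        have "u *\<^sub>R x = u *\<^sub>R z + (s + (1 - u) * e) *\<^sub>R w"
          using u(3) s(2) by (simp add: a_def algebra_simps)
        then have "(1 / u) *\<^sub>R u *\<^sub>R x = (1 / u) *\<^sub>R (u *\<^sub>R z + (s + (1 - u) * e) *\<^sub>R w)" by simp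
        then have "x = z + ((s + (1 - u) * e) / u) *\<^sub>R w" using False by (simp add: scaleR_add_right)
        moreover have "0 \<le> (s + (1 - u) * e) / u" using s u e by simp
        ultimately have "x \<in> ray z w" by (auto simp: ray_def)
        then show False using x by simp
      qed
    qed
    ultimately show "p \<in> ball z d - ray z w" by simp
  qed
  ultimately show "starlike (ball z d - ray z w)" unfolding starlike_def by blast
qed

lemma convex_cross2_halfspace: "convex {x. 0 < cross2 w (x - z)}" "convex {x. cross2 w (x - z) < 0}"
proof -
  have *: "{x. 0 < cross2 w (x - z)} = {x. cross2 w z < (vector [- (w $ 2), w $ 1] :: point) \<bullet> x}"
    "{x. cross2 w (x - z) < 0} = {x. (vector [- (w $ 2), w $ 1] :: point) \<bullet> x < cross2 w z}"
    by (auto simp: cross2_def inner_point algebra_simps)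
  show "convex {x. 0 < cross2 w (x - z)}" "convex {x. cross2 w (x - z) < 0}"
    unfolding * by (simp_all add: convex_halfspace_gt convex_halfspace_lt)
qed

text \<open>What matters is that there are at most two connected pieces; \<open>C1\<close> and
  \<open>C2\<close> may coincide. Opposite rays leave two half discs. Non-parallel rays leave a
  convex sector and its reflex counterpart, a union of two half discs that meet near
  \<open>z\<close> in the direction of \<open>- w1 - w2\<close>.\<close>

lemma ball_minus_two_rays:
  assumes w: "w1 \<noteq> 0" "w2 \<noteq> 0" and d: "0 < d"
  shows "\<exists>C1 C2. connected C1 \<and> connected C2 \<and> ball z d - (ray z w1 \<union> ray z w2) = C1 \<union> C2"
proof (cases "cross2 w1 w2 = 0")
  case True
  define k where "k = (w1 \<bullet> w2) / (w1 \<bullet> w1)"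
  have w2: "w2 = k *\<^sub>R w1" unfolding k_def by (rule cross2_eq_0_parallel[OF True w(1)])
  then have k: "k \<noteq> 0" using w by auto
  show ?thesis
  proof (cases "k > 0")
    case True
    have "ray z w2 \<subseteq> ray z w1"
    proof
      fix x assume "x \<in> ray z w2"
      then obtain s where "0 \<le> s" "x = z + s *\<^sub>R w2" by (auto simp: ray_def)
      then have "x = z + (s * k) *\<^sub>R w1" "0 \<le> s * k" using True by (auto simp: w2)
      then show "x \<in> ray z w1" unfolding ray_def by blast
    qed
    then have "ray z w1 \<union> ray z w2 = ray z w1" by blast
    then show ?thesis using connected_ball_minus_ray[OF w(1) d] by (metis sup.idem)
  next
    case False
    then have k: "k < 0" using k by simp
    let ?C1 = "ball z d \<inter> {x. 0 < cross2 w1 (x - z)}" and ?C2 = "ball z d \<inter> {x. cross2 w1 (x - z) < 0}"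
    have on: "x \<in> ray z w1 \<union> ray z w2 \<longleftrightarrow> cross2 w1 (x - z) = 0" for x
    proof
      assume "x \<in> ray z w1 \<union> ray z w2"
      then show "cross2 w1 (x - z) = 0" by (auto simp: ray_def w2 cross2_simps)
    next
      assume 0: "cross2 w1 (x - z) = 0"
      define s where "s = (w1 \<bullet> (x - z)) / (w1 \<bullet> w1)"
      have "x - z = s *\<^sub>R w1" unfolding s_def by (rule cross2_eq_0_parallel[OF 0 w(1)])
      then have x: "x = z + s *\<^sub>R w1" by (simp add: algebra_simps)
      show "x \<in> ray z w1 \<union> ray z w2"
      proof (cases "s \<ge> 0")
        case True
        then show ?thesis using x by (auto simp: ray_def)
      next
        case False
        have "x = z + (s / k) *\<^sub>R w2" using x k by (simp add: w2)
        moreover have "0 \<le> s / k" using False k by (simp add: divide_nonpos_neg)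
        ultimately show ?thesis unfolding ray_def by blast
      qed
    qed
    have "ball z d - (ray z w1 \<union> ray z w2) = ?C1 \<union> ?C2" using on by force
    moreover have "connected ?C1" "connected ?C2"
      by (intro convex_connected convex_Int convex_ball convex_cross2_halfspace)+
    ultimately show ?thesis by blast
  qed
next
  case False
  let ?D = "cross2 w1 w2"
  define \<alpha> where "\<alpha> x = cross2 (x - z) w2 / ?D" for x
  define \<beta> where "\<beta> x = cross2 w1 (x - z) / ?D" for x
  have dec: "x - z = \<alpha> x *\<^sub>R w1 + \<beta> x *\<^sub>R w2" for x
    unfolding \<alpha>_def \<beta>_def by (rule cross2_decompose[OF False])
  have val: "\<alpha> (z + p *\<^sub>R w1 + q *\<^sub>R w2) = p" "\<beta> (z + p *\<^sub>R w1 + q *\<^sub>R w2) = q" for p q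
    using False by (simp_all add: \<alpha>_def \<beta>_def cross2_simps)
  have cvx: "convex {x. 0 < \<beta> x}" "convex {x. \<beta> x < 0}" "convex {x. 0 < \<alpha> x}" "convex {x. \<alpha> x < 0}"
  proof -
    have skew: "cross2 (x - z) w2 = - cross2 w2 (x - z)" for x by (rule cross2_skew)
    show "convex {x. 0 < \<beta> x}" "convex {x. \<beta> x < 0}" "convex {x. 0 < \<alpha> x}" "convex {x. \<alpha> x < 0}"
      using convex_cross2_halfspace[of w1 z] convex_cross2_halfspace[of w2 z] False
      unfolding \<alpha>_def \<beta>_def skew
      by (cases "?D > 0"; simp add: zero_less_divide_iff divide_less_0_iff)+
  qed
  let ?C1 = "ball z d \<inter> ({x. 0 < \<alpha> x} \<inter> {x. 0 < \<beta> x})"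
  let ?C2 = "(ball z d \<inter> {x. \<alpha> x < 0}) \<union> (ball z d \<inter> {x. \<beta> x < 0})"
  have "connected ?C1" by (intro convex_connected convex_Int convex_ball cvx)
  moreover have "connected ?C2"
  proof (rule connected_Un)
    define e where "e = d / (2 * (norm (w1 + w2) + 1))"
    have e: "e > 0" using d by (simp add: e_def add_nonneg_pos)
    have "e * norm (w1 + w2) < e * (2 * (norm (w1 + w2) + 1))"
    proof (rule mult_strict_left_mono[OF _ e])
      have "0 < norm (w1 + w2) + 2" by (simp add: add_nonneg_pos)
      then show "norm (w1 + w2) < 2 * (norm (w1 + w2) + 1)" by simp
    qed
    also have "\<dots> = d"
    proof -
      have "0 < norm (w1 + w2) + 1" by (simp add: add_nonneg_pos)
      then show ?thesis by (simp add: e_def)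
    qed
    finally have ed: "e * norm (w1 + w2) < d" .
    let ?x = "z + (- e) *\<^sub>R w1 + (- e) *\<^sub>R w2"
    have "dist z ?x = norm (e *\<^sub>R (w1 + w2))" by (simp add: dist_norm algebra_simps)
    then have "?x \<in> ball z d" using e ed by simp
    then have "?x \<in> (ball z d \<inter> {x. \<alpha> x < 0}) \<inter> (ball z d \<inter> {x. \<beta> x < 0})"
      using e val[of "- e" "- e"] by simp
    then show "(ball z d \<inter> {x. \<alpha> x < 0}) \<inter> (ball z d \<inter> {x. \<beta> x < 0}) \<noteq> {}" by blast
  qed (intro convex_connected convex_Int convex_ball cvx)+
  moreover have "ball z d - (ray z w1 \<union> ray z w2) = ?C1 \<union> ?C2"
  proof -
    have r1: "x \<in> ray z w1 \<longleftrightarrow> \<beta> x = 0 \<and> 0 \<le> \<alpha> x" for x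
    proof
      assume "x \<in> ray z w1"
      then obtain s where "0 \<le> s" "x = z + s *\<^sub>R w1 + 0 *\<^sub>R w2" by (auto simp: ray_def)
      then show "\<beta> x = 0 \<and> 0 \<le> \<alpha> x" using val[of s 0] by simp
    next
      assume *: "\<beta> x = 0 \<and> 0 \<le> \<alpha> x"
      then have "x = z + \<alpha> x *\<^sub>R w1" using dec[of x] by (simp add: algebra_simps)
      then show "x \<in> ray z w1" using * unfolding ray_def by blast
    qed
    have r2: "x \<in> ray z w2 \<longleftrightarrow> \<alpha> x = 0 \<and> 0 \<le> \<beta> x" for x
    proof
      assume "x \<in> ray z w2"
      then obtain s where "0 \<le> s" "x = z + 0 *\<^sub>R w1 + s *\<^sub>R w2" by (auto simp: ray_def)
      then show "\<alpha> x = 0 \<and> 0 \<le> \<beta> x" using val[of 0 s] by simp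
    next
      assume *: "\<alpha> x = 0 \<and> 0 \<le> \<beta> x"
      then have "x = z + \<beta> x *\<^sub>R w2" using dec[of x] by (simp add: algebra_simps)
      then show "x \<in> ray z w2" using * unfolding ray_def by blast
    qed
    show ?thesis using r1 r2 by (auto simp: not_less not_le)
  qed
  ultimately show ?thesis by blast
qed

text \<open>The radius \<open>d\<close> stays below the distance from \<open>z\<close> to the
  segments that miss it and to all endpoints other than \<open>z\<close>. A segment that meets the
  ball then passes through \<open>z\<close>, and each of its nontrivial halves fills a whole radius
  of the ball.\<close>

lemma segments_radial:
  fixes z :: point
  assumes P: "finite P" and J: "J = (\<Union>(a, b)\<in>P. closed_segment a b)"
  obtains d where "0 < d" "finite (sgn ` ((\<lambda>x. x - z) ` (J \<inter> ball z d)))"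
    "\<And>x s. x \<in> J \<inter> ball z d \<Longrightarrow> x \<noteq> z \<Longrightarrow> 0 \<le> s \<Longrightarrow> z + s *\<^sub>R (x - z) \<in> ball z d \<Longrightarrow> z + s *\<^sub>R (x - z) \<in> J"
proof -
  have "\<exists>d>0. (z \<notin> closed_segment a b \<longrightarrow> closed_segment a b \<inter> ball z d = {}) \<and>
      (a \<noteq> z \<longrightarrow> d \<le> norm (a - z)) \<and> (b \<noteq> z \<longrightarrow> d \<le> norm (b - z))" for a b :: point
  proof -
    have "\<exists>d1>0. z \<notin> closed_segment a b \<longrightarrow> closed_segment a b \<inter> ball z d1 = {}"
    proof (cases "z \<in> closed_segment a b")
      case False
      have "open (- closed_segment a b)" using compact_segment compact_imp_closed open_Compl by blast
      then obtain d1 where "d1 > 0" "ball z d1 \<subseteq> - closed_segment a b"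
        using False openE[of "- closed_segment a b" z] by blast
      then show ?thesis by blast
    qed (auto intro: exI[of _ 1])
    then obtain d1 where d1: "d1 > 0" "z \<notin> closed_segment a b \<longrightarrow> closed_segment a b \<inter> ball z d1 = {}" by blast
    \<comment> \<open>An endpoint equal to \<open>z\<close> imposes no restriction; 1 is a
      placeholder for it.\<close>
    define d where "d = min d1 (min (if a = z then 1 else norm (a - z)) (if b = z then 1 else norm (b - z)))"
    have "d > 0" "d \<le> d1" "a \<noteq> z \<longrightarrow> d \<le> norm (a - z)" "b \<noteq> z \<longrightarrow> d \<le> norm (b - z)"
      using d1 by (auto simp: d_def)
    moreover from this d1(2) have "z \<notin> closed_segment a b \<longrightarrow> closed_segment a b \<inter> ball z d = {}"
      using subset_ball[of d d1 z] by blast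
    ultimately show ?thesis by blast
  qed
  then obtain \<delta> where \<delta>: "\<And>a b. 0 < \<delta> a b" "\<And>a b. z \<notin> closed_segment a b \<Longrightarrow> closed_segment a b \<inter> ball z (\<delta> a b) = {}"
    "\<And>a b. a \<noteq> z \<Longrightarrow> \<delta> a b \<le> norm (a - z)" "\<And>a b. b \<noteq> z \<Longrightarrow> \<delta> a b \<le> norm (b - z)" by metis
  define d where "d = Min (insert 1 ((\<lambda>(a, b). \<delta> a b) ` P))"
  have d: "d > 0" "\<And>a b. (a, b) \<in> P \<Longrightarrow> d \<le> \<delta> a b"
    using P \<delta>(1) by (auto simp: d_def intro!: Min_le)
  have key: "\<exists>a b e u. (a, b) \<in> P \<and> e \<in> {a, b} \<and> 0 < u \<and> x = z + u *\<^sub>R (e - z) \<and> e \<noteq> z \<and> closed_segment z e \<subseteq> J \<and> d \<le> norm (e - z)"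
    if x: "x \<in> J \<inter> ball z d" "x \<noteq> z" for x
  proof -
    obtain a b where ab: "(a, b) \<in> P" "x \<in> closed_segment a b" using x J by auto
    have "z \<in> closed_segment a b"
    proof (rule ccontr)
      assume "z \<notin> closed_segment a b"
      then have "closed_segment a b \<inter> ball z (\<delta> a b) = {}" by (rule \<delta>(2))
      then show False using ab x d(2)[OF ab(1)] by auto
    qed
    then have un: "closed_segment z a \<union> closed_segment z b = closed_segment a b"
      using Un_closed_segment by (metis closed_segment_commute)
    have dn: "d \<le> norm (e - z)" if "e \<in> {a, b}" "e \<noteq> z" for e
      using d(2)[OF ab(1)] \<delta>(3,4) that by (auto intro: order.trans)
    obtain e where e: "e \<in> {a, b}" "x \<in> closed_segment z e" using un ab(2) by auto
    then obtain u where u: "0 \<le> u" "u \<le> 1" "x = (1 - u) *\<^sub>R z + u *\<^sub>R e" by (auto simp: in_segment)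
    then have x': "x = z + u *\<^sub>R (e - z)" by (simp add: algebra_simps)
    then have "u \<noteq> 0" "e \<noteq> z" using x(2) by auto
    moreover have "closed_segment z e \<subseteq> J" using un e ab(1) J by auto
    ultimately show ?thesis using ab(1) e(1) u(1) x' dn by force
  qed
  show ?thesis
  proof (rule that[OF d(1)])
    have "sgn ` ((\<lambda>x. x - z) ` (J \<inter> ball z d)) \<subseteq> insert 0 ((\<lambda>e. sgn (e - z)) ` (fst ` P \<union> snd ` P))"
    proof
      fix y assume "y \<in> sgn ` ((\<lambda>x. x - z) ` (J \<inter> ball z d))"
      then obtain x where x: "x \<in> J \<inter> ball z d" "y = sgn (x - z)" by auto
      show "y \<in> insert 0 ((\<lambda>e. sgn (e - z)) ` (fst ` P \<union> snd ` P))"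
      proof (cases "x = z")
        case False
        from key[OF x(1) False] obtain a b e u where *: "(a, b) \<in> P" "e \<in> {a, b}" "0 < u" "x = z + u *\<^sub>R (e - z)" by blast
        then have "y = sgn (e - z)" using x(2) by (simp add: sgn_scaleR)
        moreover have "e \<in> fst ` P \<union> snd ` P" using * by force
        ultimately show ?thesis by blast
      qed (use x in simp)
    qed
    then show "finite (sgn ` ((\<lambda>x. x - z) ` (J \<inter> ball z d)))" by (rule finite_subset) (use P in simp)
  next
    fix x and s :: real
    assume x: "x \<in> J \<inter> ball z d" "x \<noteq> z" and s: "0 \<le> s" "z + s *\<^sub>R (x - z) \<in> ball z d"
    from key[OF x] obtain e u where e: "0 < u" "x = z + u *\<^sub>R (e - z)" "e \<noteq> z" "closed_segment z e \<subseteq> J" "d \<le> norm (e - z)" by blast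
    have eq: "z + s *\<^sub>R (x - z) = z + (s * u) *\<^sub>R (e - z)" by (simp add: e(2))
    have "dist z (z + (s * u) *\<^sub>R (e - z)) = s * u * norm (e - z)" using s e by (simp add: dist_norm abs_mult)
    then have "s * u * norm (e - z) < norm (e - z)" using s(2) eq e(5) by simp
    then have "s * u < 1" using e(3) by simp
    then have "z + (s * u) *\<^sub>R (e - z) \<in> closed_segment z e"
      unfolding in_segment using s e by (intro exI[of _ "s * u"]) (auto simp: algebra_simps)
    then show "z + s *\<^sub>R (x - z) \<in> J" using eq e(4) by auto
  qed
qed

text \<open>The direction seen from \<open>z\<close> is continuous on \<open>A\<close> and takes
  finitely many values, so it is constant.\<close>

lemma connected_subset_ray:
  assumes "connected A" "A \<subseteq> J \<inter> ball z d" "z \<notin> A" "finite (sgn ` ((\<lambda>x. x - z) ` (J \<inter> ball z d)))" "y \<in> A"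
  shows "A \<subseteq> ray z (y - z)"
proof
  fix x assume x: "x \<in> A"
  let ?f = "\<lambda>x. sgn (x - z)"
  have "continuous_on A ?f"
    using assms(3) by (intro continuous_on_sgn continuous_intros) auto
  then have "connected (?f ` A)" using assms(1) by (rule connected_continuous_image)
  moreover have "finite (?f ` A)"
    using assms(2,4) by (auto intro: finite_subset[rotated] simp: image_image)
  ultimately obtain c where "?f ` A = {c}"
    using connected_finite_iff_sing x by (metis image_is_empty empty_iff)
  then have "?f x = ?f y" using x assms(5) by (metis image_eqI singletonD)
  then have "norm (x - z) *\<^sub>R sgn (x - z) = norm (x - z) *\<^sub>R sgn (y - z)" by simp
  then have "x - z = (norm (x - z) / norm (y - z)) *\<^sub>R (y - z)"
    by (simp add: norm_sgn sgn_div_norm) (metis norm_eq_zero right_inverse scaleR_one scaleR_scaleR divide_inverse scaleR_zero_right)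
  then have "x = z + (norm (x - z) / norm (y - z)) *\<^sub>R (y - z)" by (metis add.commute diff_add_cancel)
  moreover have "0 \<le> norm (x - z) / norm (y - z)" by simp
  ultimately show "x \<in> ray z (y - z)" unfolding ray_def by blast
qed

text \<open>The loop is shifted to start at \<open>z\<close>. Its initial and final pieces are
  connected and stay near \<open>z\<close> by continuity; the piece in between is compact and avoids
  \<open>z\<close>, so it stays away from a small ball.\<close>

lemma simple_loop_two_connected_ends:
  fixes g :: "real \<Rightarrow> point"
  assumes g: "simple_path g" "pathfinish g = pathstart g" and z: "z \<in> path_image g" and d: "0 < d"
  obtains A1 A2 e where "connected A1" "connected A2" "A1 \<noteq> {}" "A2 \<noteq> {}"
    "A1 \<union> A2 \<subseteq> path_image g \<inter> ball z d - {z}" "0 < e" "path_image g \<inter> ball z e - {z} \<subseteq> A1 \<union> A2"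
proof -
  obtain a where a: "a \<in> {0..1}" "g a = z" using z by (auto simp: path_image_def)
  define k where "k = shiftpath a g"
  have k: "simple_path k" "path_image k = path_image g" "k 0 = z" "k 1 = z"
    using simple_path_shiftpath[OF g] path_image_shiftpath[OF a(1) g(2)] a
      pathstart_shiftpath[of a g] pathfinish_shiftpath[OF _ g(2), of a]
    by (auto simp: k_def pathstart_def pathfinish_def)
  have contk: "continuous_on {0..1} k" using k(1) by (simp add: simple_path_def path_def)
  have kz: "k t \<noteq> z" if "0 < t" "t < 1" for t
  proof
    assume "k t = z"
    then have "k t = k 0" using k by simp
    then show False
      using k(1) that unfolding simple_path_def loop_free_def by force
  qed
  obtain \<delta>1 where d1: "\<delta>1 > 0" "\<And>t. t \<in> {0..1} \<Longrightarrow> dist t 0 < \<delta>1 \<Longrightarrow> dist (k t) (k 0) < d"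
    using contk d unfolding continuous_on_iff by (metis atLeastAtMost_iff order.refl zero_le_one)
  obtain \<delta>2 where d2: "\<delta>2 > 0" "\<And>t. t \<in> {0..1} \<Longrightarrow> dist t 1 < \<delta>2 \<Longrightarrow> dist (k t) (k 1) < d"
    using contk d unfolding continuous_on_iff by (metis atLeastAtMost_iff order.refl zero_le_one)
  define \<delta> where "\<delta> = min (1/2) (min \<delta>1 \<delta>2) / 2"
  have \<delta>: "0 < \<delta>" "\<delta> < 1/2" "\<delta> < \<delta>1" "\<delta> < \<delta>2" using d1 d2 by (auto simp: \<delta>_def min_def)
  define A1 where "A1 = k ` {0<..\<delta>}"
  define A2 where "A2 = k ` {1-\<delta>..<1}"
  have c: "connected A1" "connected A2" unfolding A1_def A2_def
    by (rule connected_continuous_image[OF continuous_on_subset[OF contk]]; use \<delta> in auto)+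
  have ne: "A1 \<noteq> {}" "A2 \<noteq> {}" using \<delta> by (auto simp: A1_def A2_def)
  have sub: "A1 \<union> A2 \<subseteq> path_image g \<inter> ball z d - {z}"
  proof
    fix x assume "x \<in> A1 \<union> A2"
    then consider t where "0 < t" "t \<le> \<delta>" "x = k t" | t where "1 - \<delta> \<le> t" "t < 1" "x = k t"
      by (auto simp: A1_def A2_def)
    then show "x \<in> path_image g \<inter> ball z d - {z}"
    proof cases
      case 1
      then have "dist (k t) (k 0) < d" using \<delta> by (intro d1) (auto simp: dist_real_def)
      moreover have "k t \<in> path_image k" unfolding path_image_def using 1 \<delta> by auto
      ultimately show ?thesis using 1 \<delta> kz[of t] k by (simp add: dist_commute)
    next
      case 2
      then have "dist (k t) (k 1) < d" using \<delta> by (intro d2) (auto simp: dist_real_def)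
      moreover have "k t \<in> path_image k" unfolding path_image_def using 2 \<delta> by auto
      ultimately show ?thesis using 2 \<delta> kz[of t] k by (simp add: dist_commute)
    qed
  qed
  have "compact (k ` {\<delta>..1-\<delta>})"
    using \<delta> by (intro compact_continuous_image continuous_on_subset[OF contk]) auto
  moreover have "z \<notin> k ` {\<delta>..1-\<delta>}"
  proof
    assume "z \<in> k ` {\<delta>..1-\<delta>}"
    then obtain t where "\<delta> \<le> t" "t \<le> 1 - \<delta>" "k t = z" by auto
    then show False using kz[of t] \<delta>(1) by simp
  qed
  ultimately have "open (- (k ` {\<delta>..1-\<delta>}))" "z \<in> - (k ` {\<delta>..1-\<delta>})"
    using compact_imp_closed open_Compl by blast+
  then obtain e where e: "e > 0" "ball z e \<subseteq> - (k ` {\<delta>..1-\<delta>})" using openE by blast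
  have "path_image g \<inter> ball z e - {z} \<subseteq> A1 \<union> A2"
  proof
    fix x assume x: "x \<in> path_image g \<inter> ball z e - {z}"
    then have "x \<in> k ` {0..1}" using k(2) by (simp add: path_image_def)
    then obtain t where t: "0 \<le> t" "t \<le> 1" "x = k t" by auto
    have "t \<noteq> 0" "t \<noteq> 1" using t x k by auto
    moreover have "t \<notin> {\<delta>..1-\<delta>}" using e x t by blast
    ultimately show "x \<in> A1 \<union> A2" unfolding A1_def A2_def using t by force
  qed
  then show ?thesis using that c ne sub e(1) by blast
qed

text \<open>The two arcs of the loop at \<open>z\<close> are connected and show finitely many
  directions, so each runs along one ray. The radial property of unions of segments then puts both
  rays, up to radius \<open>d\<close>, into \<open>J\<close>.\<close>

lemma closed_polygon_local_rays:
  assumes J: "simple_closed_polygon J" "z \<in> J" and e: "0 < e"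
  obtains d where "0 < d" "d \<le> e" "J \<inter> ball z d = {z}"
  | d w1 w2 where "0 < d" "d \<le> e" "w1 \<noteq> 0" "w2 \<noteq> 0" "J \<inter> ball z d = (ray z w1 \<union> ray z w2) \<inter> ball z d"
proof -
  obtain g where g: "simple_path g" "pathfinish g = pathstart g" "path_image g = J"
    using J by (auto simp: simple_closed_polygon_def)
  obtain P where P: "finite P" "J = (\<Union>(a, b)\<in>P. closed_segment a b)"
    using J by (auto simp: simple_closed_polygon_def)
  obtain d1 where d1: "0 < d1" "finite (sgn ` ((\<lambda>x. x - z) ` (J \<inter> ball z d1)))"
    and rad: "\<And>x s. x \<in> J \<inter> ball z d1 \<Longrightarrow> x \<noteq> z \<Longrightarrow> 0 \<le> s \<Longrightarrow> z + s *\<^sub>R (x - z) \<in> ball z d1 \<Longrightarrow> z + s *\<^sub>R (x - z) \<in> J"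
    using segments_radial[OF P, of z] by metis
  obtain A1 A2 d2 where A: "connected A1" "connected A2" "A1 \<noteq> {}" "A2 \<noteq> {}"
    "A1 \<union> A2 \<subseteq> J \<inter> ball z d1 - {z}" "0 < d2" "J \<inter> ball z d2 - {z} \<subseteq> A1 \<union> A2"
    using simple_loop_two_connected_ends[OF g(1,2), of z d1] J(2) d1(1) g(3) by metis
  obtain y1 y2 where y: "y1 \<in> A1" "y2 \<in> A2" using A by blast
  have ray1: "A1 \<subseteq> ray z (y1 - z)"
    by (rule connected_subset_ray[OF A(1) _ _ d1(2) y(1)]) (use A(5) in auto)
  have ray2: "A2 \<subseteq> ray z (y2 - z)"
    by (rule connected_subset_ray[OF A(2) _ _ d1(2) y(2)]) (use A(5) in auto)
  define d where "d = min e (min d1 d2)"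
  have d: "0 < d" "d \<le> e" "d \<le> d1" "d \<le> d2" using e d1 A by (auto simp: d_def)
  have ynz: "y1 - z \<noteq> 0" "y2 - z \<noteq> 0" using y A(5) by auto
  have whole: "ray z (y - z) \<inter> ball z d \<subseteq> J" if y: "y \<in> J \<inter> ball z d1" "y \<noteq> z" for y
  proof
    fix x assume x: "x \<in> ray z (y - z) \<inter> ball z d"
    then obtain s where s: "0 \<le> s" "x = z + s *\<^sub>R (y - z)" by (auto simp: ray_def)
    then show "x \<in> J" using rad[OF y s(1)] x d by simp
  qed
  have w: "ray z (y1 - z) \<inter> ball z d \<subseteq> J" "ray z (y2 - z) \<inter> ball z d \<subseteq> J"
  proof -
    have "y1 \<in> J \<inter> ball z d1" "y1 \<noteq> z" "y2 \<in> J \<inter> ball z d1" "y2 \<noteq> z" using y A(5) by blast+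
    then show "ray z (y1 - z) \<inter> ball z d \<subseteq> J" "ray z (y2 - z) \<inter> ball z d \<subseteq> J" using whole by blast+
  qed
  have "J \<inter> ball z d = (ray z (y1 - z) \<union> ray z (y2 - z)) \<inter> ball z d"
  proof
    show "J \<inter> ball z d \<subseteq> (ray z (y1 - z) \<union> ray z (y2 - z)) \<inter> ball z d"
    proof
      fix x assume x: "x \<in> J \<inter> ball z d"
      show "x \<in> (ray z (y1 - z) \<union> ray z (y2 - z)) \<inter> ball z d"
      proof (cases "x = z")
        case True
        then have "x = z + 0 *\<^sub>R (y1 - z)" by simp
        then show ?thesis using x unfolding ray_def by blast
      next
        case False
        then have "x \<in> A1 \<union> A2" using A(7) x d subset_ball[of d d2 z] by auto
        then show ?thesis using ray1 ray2 x by blast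
      qed
    qed
  qed (use w in blast)
  then show ?thesis using that(2)[OF d(1,2) ynz] by blast
qed

section \<open>The domain near a boundary point, by Jordan separation\<close>

lemma simple_closed_polygon_separation:
  assumes "simple_closed_polygon J"
  shows "\<not> connected (- J)" "T \<in> components (- J) \<Longrightarrow> frontier T = J" "closed J"
proof -
  obtain g where g: "simple_path g" "pathfinish g = pathstart g" "path_image g = J"
    using assms by (auto simp: simple_closed_polygon_def)
  have "J homeomorphic sphere (0::complex) 1"
    using homeomorphic_simple_path_image_circle[OF g(1,2), of 1 0] g(3) by simp
  moreover have "sphere (0::complex) 1 homeomorphic sphere (0::point) 1"
    by (rule homeomorphic_spheres_gen) auto
  ultimately have h: "J homeomorphic sphere (0::point) 1" using homeomorphic_trans by blast
  show "\<not> connected (- J)" using Jordan_Brouwer_separation[OF h] by simp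
  show "T \<in> components (- J) \<Longrightarrow> frontier T = J" using Jordan_Brouwer_frontier[OF h] by simp
  show "closed J" using g closed_simple_path_image by blast
qed

text \<open>At a boundary point only one boundary polygon \<open>J\<close> is near, and it cuts a
  small ball into at most two connected pieces. A piece that avoids the frontier lies either inside
  or outside the domain, and the pieces are not all inside. What remains of the domain in the ball
  is thus one piece or nothing.\<close>

lemma polygonal_domain_locally_connected:
  assumes \<Omega>: "polygonal_domain \<Omega>" and z: "z \<in> closure \<Omega>" and e: "0 < e"
  obtains d where "0 < d" "d \<le> e" "connected (\<Omega> \<inter> ball z d - {z})"
proof (cases "z \<in> \<Omega>")
  case True
  have "open \<Omega>" using \<Omega> by (simp add: polygonal_domain_def)
  then obtain d where d: "0 < d" "ball z d \<subseteq> \<Omega>" using True openE by blast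
  have "connected (ball z (min d e) - {z})"
    by (rule connected_punctured_convex) (use d e in \<open>auto simp: aff_dim_open\<close>)
  moreover have "\<Omega> \<inter> ball z (min d e) = ball z (min d e)" using d by auto
  ultimately show ?thesis using that[of "min d e"] d e by simp
next
  case False
  note result = that
  have op: "open \<Omega>" and con: "connected \<Omega>" and neO: "\<Omega> \<noteq> {}" using \<Omega> by (auto simp: polygonal_domain_def)
  obtain F where F: "finite F" "pairwise disjnt F" "\<And>J. J \<in> F \<Longrightarrow> simple_closed_polygon J" "frontier \<Omega> = \<Union>F"
    using \<Omega> by (auto simp: polygonal_domain_def)
  have "z \<in> frontier \<Omega>" using z False op by (simp add: frontier_def interior_open)
  then obtain J where J: "J \<in> F" "z \<in> J" using F(4) by blast
  have scJ: "simple_closed_polygon J" using F J by blast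
  have "closed (\<Union>(F - {J}))" using F simple_closed_polygon_separation(3) by (intro closed_Union) auto
  moreover have "z \<notin> \<Union>(F - {J})" using F(2) J by (auto simp: pairwise_def disjnt_def)
  ultimately obtain d0 where d0: "d0 > 0" "ball z d0 \<subseteq> - \<Union>(F - {J})"
    using openE[of "- \<Union>(F - {J})" z] open_Compl by blast
  have dis: "\<Omega> \<inter> frontier \<Omega> = {}" using op by (simp add: frontier_def interior_open)
  have OJ: "\<Omega> \<inter> J = {}" using dis F(4) J by blast
  have good: thesis if d: "0 < d" "d \<le> min e d0" and C: "connected C1" "connected C2" "ball z d - J = C1 \<union> C2" for d C1 C2
  proof -
    have fr: "ball z d \<inter> frontier \<Omega> = ball z d \<inter> J"
      using d0(2) d subset_ball[of d d0 z] F(4) J by auto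
    have OB: "\<Omega> \<inter> ball z d - {z} = \<Omega> \<inter> (C1 \<union> C2)" using C(3) OJ J by blast
    have sub: "C \<subseteq> \<Omega>" if "connected C" "C \<subseteq> ball z d - J" "C \<inter> \<Omega> \<noteq> {}" for C
    proof (rule ccontr)
      assume "\<not> C \<subseteq> \<Omega>"
      then have "C \<inter> frontier \<Omega> \<noteq> {}" using connected_Int_frontier[OF that(1,3)] by blast
      then show False using that(2) fr by blast
    qed
    \<comment> \<open>Being connected, the domain lies in one component \<open>T\<close> of the
      complement of \<open>J\<close>. Separation provides a second component, whose frontier is
      again all of \<open>J\<close> and which therefore reaches into the ball at \<open>z\<close>;
      the domain cannot fill both.\<close>
    have nall: "\<not> C1 \<union> C2 \<subseteq> \<Omega>"
    proof
      assume all: "C1 \<union> C2 \<subseteq> \<Omega>"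
      have "\<Omega> \<subseteq> - J" using OJ by blast
      then obtain T where T: "T \<in> components (- J)" "\<Omega> \<subseteq> T"
        using exists_component_superset[OF _ _ con] neO by blast
      have "T \<noteq> - J" using simple_closed_polygon_separation(1)[OF scJ] T(1) in_components_connected by blast
      moreover have "T \<subseteq> - J" using T(1) in_components_subset by blast
      ultimately obtain y where "y \<in> - J" "y \<notin> T" by blast
      then obtain T' where T': "T' \<in> components (- J)" "y \<in> T'" using Union_components by blast
      have "T' \<noteq> T" using T' \<open>y \<notin> T\<close> by blast
      then have "T' \<inter> T = {}" using T T' components_nonoverlap by blast
      have "z \<in> closure T'"
        using simple_closed_polygon_separation(2)[OF scJ T'(1)] J(2) by (auto simp: frontier_def)
      then have "T' \<inter> ball z d \<noteq> {}" using d(1) closure_iff_nhds_not_empty by (metis centre_in_ball open_ball Int_commute interior_open order.refl)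
      then obtain x where "x \<in> T'" "x \<in> ball z d" by blast
      then have "x \<in> C1 \<union> C2" using C(3) T'(1) in_components_subset by blast
      then have "x \<in> T" using all T by blast
      then show False using \<open>x \<in> T'\<close> \<open>T' \<inter> T = {}\<close> by blast
    qed
    have s1: "C1 \<inter> \<Omega> = {} \<or> C1 \<subseteq> \<Omega>" and s2: "C2 \<inter> \<Omega> = {} \<or> C2 \<subseteq> \<Omega>"
      using sub C by blast+
    then have "\<Omega> \<inter> (C1 \<union> C2) = {} \<or> \<Omega> \<inter> (C1 \<union> C2) = C1 \<or> \<Omega> \<inter> (C1 \<union> C2) = C2"
      using nall by blast
    then have "connected (\<Omega> \<inter> ball z d - {z})" using C OB by (metis connected_empty)
    then show thesis using result[of d] d by simp
  qed
  have m: "0 < min e d0" using e d0 by simp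
  show ?thesis
  proof (rule closed_polygon_local_rays[OF scJ J(2) m])
    fix d assume d: "0 < d" "d \<le> min e d0" "J \<inter> ball z d = {z}"
    have "connected (ball z d - {z})"
      by (rule connected_punctured_convex) (use d in \<open>auto simp: aff_dim_open\<close>)
    moreover have "ball z d - J = (ball z d - {z}) \<union> (ball z d - {z})" using d(3) by blast
    ultimately show thesis using good d(1,2) by blast
  next
    fix d w1 w2 assume d: "0 < d" "d \<le> min e d0" "w1 \<noteq> 0" "w2 \<noteq> 0"
      "J \<inter> ball z d = (ray z w1 \<union> ray z w2) \<inter> ball z d"
    obtain C1 C2 where "connected C1" "connected C2" "ball z d - (ray z w1 \<union> ray z w2) = C1 \<union> C2"
      using ball_minus_two_rays[OF d(3,4,1)] by blast
    moreover have "ball z d - J = ball z d - (ray z w1 \<union> ray z w2)" using d(5) by blast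
    ultimately show thesis using good d(1,2) by metis
  qed
qed

subsection \<open>Elements and triangles around a node\<close>

lemma diameter_closed_segment: "diameter (closed_segment a b) = dist a (b::'a::euclidean_space)"
proof (rule antisym)
  show "diameter (closed_segment a b) \<le> dist a b"
  proof (rule diameter_le)
    fix x y assume "x \<in> closed_segment a b" "y \<in> closed_segment a b"
    then obtain s t where s: "0 \<le> s" "s \<le> 1" "x = (1 - s) *\<^sub>R a + s *\<^sub>R b" "0 \<le> t" "t \<le> 1" "y = (1 - t) *\<^sub>R a + t *\<^sub>R b"
      by (auto simp: in_segment)
    have "x - y = (s - t) *\<^sub>R (b - a)" unfolding s(3,6) by (simp add: algebra_simps)
    then have "norm (x - y) = \<bar>s - t\<bar> * dist a b" by (simp add: dist_norm norm_minus_commute)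
    also have "\<dots> \<le> 1 * dist a b" using s by (intro mult_right_mono) auto
    finally show "norm (x - y) \<le> dist a b" by simp
  qed simp
  show "dist a b \<le> diameter (closed_segment a b)"
    by (rule diameter_bounded_bound) (auto simp: bounded_closed_segment)
qed

definition tri :: "(point set \<Rightarrow> point) \<Rightarrow> point \<Rightarrow> point set \<Rightarrow> point \<Rightarrow> point set" where
  "tri ctr z K b = convex hull {z, b, ctr K}"

locale regular_polygonal_mesh =
  fixes \<sigma> \<kappa> :: real and \<Omega> \<K> N ctr
  assumes dom: "polygonal_domain \<Omega>" and reg: "regular_mesh \<sigma> \<kappa> \<Omega> \<K> N ctr"
begin

lemma mesh: "finite \<K>" "finite N" "\<Union>\<K> = closure \<Omega>" "N \<subseteq> (\<Union>K\<in>\<K>. frontier K)"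
proof -
  have "polygonal_mesh \<Omega> \<K> N" using reg by (simp add: regular_mesh_def)
  note pm = this[unfolded polygonal_mesh_def]
  show "finite \<K>" by (rule pm[THEN conjunct1])
  show "finite N" by (rule pm[THEN conjunct2, THEN conjunct1])
  show "\<Union>\<K> = closure \<Omega>" by (rule pm[THEN conjunct2, THEN conjunct2, THEN conjunct2, THEN conjunct1])
  show "N \<subseteq> (\<Union>K\<in>\<K>. frontier K)"
    by (rule pm[THEN conjunct2, THEN conjunct2, THEN conjunct2, THEN conjunct2, THEN conjunct2, THEN conjunct1])
qed

lemma interiors_disjoint: "K \<in> \<K> \<Longrightarrow> L \<in> \<K> \<Longrightarrow> K \<noteq> L \<Longrightarrow> interior K \<inter> interior L = {}"
  using reg by (auto simp: regular_mesh_def polygonal_mesh_def)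

lemma frontier_edges: "K \<in> \<K> \<Longrightarrow> frontier K = \<Union>(edges_of N K)"
  using reg by (auto simp: regular_mesh_def polygonal_mesh_def)

text \<open>Closedness comes from the polygon with its inside, boundedness from the domain whose
  closure contains the element.\<close>

lemma compact_element:
  assumes "K \<in> \<K>" shows "compact K"
proof -
  have "polygonal_element K" using assms reg by (auto simp: regular_mesh_def polygonal_mesh_def)
  then obtain g where g: "simple_path g" "K = path_image g \<union> inside (path_image g)"
    unfolding polygonal_element_def simple_closed_polygon_def by blast
  then have "closed K" using closed_path_image_Un_inside simple_path_imp_path by blast
  moreover have "bounded (closure \<Omega>)"  using dom bounded_closure unfolding polygonal_domain_def by blast
  then have "bounded K" using assms mesh(3) by (metis Union_upper bounded_subset)
  ultimately show ?thesis by (simp add: compact_eq_bounded_closed)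
qed

lemma element_star:
  assumes "K \<in> \<K>"
  obtains \<rho> where "star_shaped_wrt_disc K (ctr K) \<rho>" "0 < \<rho>" "diameter K \<le> \<sigma> * \<rho>" "ctr K \<in> K"
    "2 * \<rho> \<le> diameter K"
proof -
  obtain \<rho> where r: "star_shaped_wrt_disc K (ctr K) \<rho>" "diameter K / \<rho> < \<sigma>"
    using reg assms by (auto simp: regular_mesh_def maximal_star_disc_def)
  then have \<rho>: "0 < \<rho>" by (simp add: star_shaped_wrt_disc_def)
  then have d: "diameter K \<le> \<sigma> * \<rho>" using r(2) by (simp add: pos_divide_less_eq)
  have "polygonal_element K" using assms reg by (auto simp: regular_mesh_def polygonal_mesh_def)
  then have "K \<noteq> {}" unfolding polygonal_element_def simple_closed_polygon_def
    using path_image_nonempty by blast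
  then obtain x where "x \<in> K" by blast
  then have "closed_segment (ctr K) x \<subseteq> K" using r(1) \<rho> by (auto simp: star_shaped_wrt_disc_def)
  then have c: "ctr K \<in> K" by auto
  show ?thesis
    using that[OF r(1) \<rho> d c] star_shaped_diameter_ge[OF r(1) c] compact_element[OF assms] compact_imp_bounded by blast
qed

lemma star_cell_element: "K \<in> \<K> \<Longrightarrow> star_cell \<sigma> K"
  using element_star[of K] compact_element[of K] unfolding star_cell_def by metis

lemma diameter_element_le: "K \<in> \<K> \<Longrightarrow> x \<in> K \<Longrightarrow> y \<in> K \<Longrightarrow> dist x y \<le> diameter K"
  using compact_element compact_imp_bounded diameter_bounded_bound by blast

lemma frontier_element_subset: "K \<in> \<K> \<Longrightarrow> frontier K \<subseteq> K"
  using compact_element compact_imp_closed frontier_subset_eq by blast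

lemma element_subset_closure_interior: "K \<in> \<K> \<Longrightarrow> K \<subseteq> closure (interior K)"
  using element_star star_shaped_subset_closure_interior by metis

text \<open>\<open>L\<close> is the closure of its interior as far as its own points are concerned,
  so a point of \<open>L\<close> interior to \<open>K\<close> would make the two interiors
  meet.\<close>

lemma common_point_in_frontier:
  assumes K: "K \<in> \<K>" "L \<in> \<K>" "K \<noteq> L" "p \<in> K" "p \<in> L"
  shows "p \<in> frontier K"
proof -
  have "p \<notin> interior K"
  proof
    assume "p \<in> interior K"
    moreover have "p \<in> closure (interior L)" using element_subset_closure_interior K by blast
    ultimately have "interior K \<inter> interior L \<noteq> {}"
      using open_Int_closure_eq_empty[OF open_interior] by blast
    then show False using interiors_disjoint K by blast
  qed
  then show ?thesis using K(4) closure_subset by (auto simp: frontier_def)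
qed

lemma node_in_frontier:
  assumes z: "z \<in> N" "K \<in> \<K>" "z \<in> K"
  shows "z \<in> frontier K"
proof -
  obtain L where L: "L \<in> \<K>" "z \<in> frontier L" using z(1) mesh(4) by blast
  show ?thesis
  proof (cases "L = K")
    case False
    then show ?thesis using common_point_in_frontier z L frontier_element_subset by blast
  qed (use L in simp)
qed

lemma elements_at_node: "z \<in> N \<Longrightarrow> {K\<in>\<K>. z \<in> nodes_of N K} = {K\<in>\<K>. z \<in> K}"
  using node_in_frontier frontier_element_subset by (auto simp: nodes_of_def)

lemma edge_at_nodeE:
  assumes E: "E \<in> edges_of N K" "z \<in> E" "z \<in> N"
  obtains b where "E = closed_segment z b" "b \<noteq> z" "b \<in> N"
proof -
  obtain a b where ab: "E = closed_segment a b" "a \<in> N" "b \<in> N" "a \<noteq> b" "open_segment a b \<inter> N = {}"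
    using E(1) by (auto simp: edges_of_def nodes_of_def)
  then have "z = a \<or> z = b" using E(2,3) by (auto simp: open_segment_def)
  then show ?thesis using ab that[of b] that[of a] by (auto simp: closed_segment_commute)
qed

text \<open>An edge is only a set of points; its endpoints, and with them the properties recorded in
  \<open>edges_of\<close>, are recovered up to order from the segment.\<close>

lemma edge_facts:
  assumes "closed_segment z b \<in> edges_of N K" "z \<in> N"
  shows "closed_segment z b \<subseteq> frontier K" "open_segment z b \<inter> N = {}" "z \<noteq> b" "b \<in> N"
proof -
  obtain a c where ab: "closed_segment z b = closed_segment a c" "a \<in> N" "c \<in> N" "a \<noteq> c"
    "open_segment a c \<inter> N = {}" "closed_segment a c \<subseteq> frontier K"
    using assms(1) by (auto simp: edges_of_def nodes_of_def)
  then have "{z, b} = {a, c}" using closed_segment_eq by (metis)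
  then show "z \<noteq> b" "b \<in> N" using ab by (metis doubleton_eq_iff)+
  show "closed_segment z b \<subseteq> frontier K" unfolding ab(1) by (rule ab(6))
  show "open_segment z b \<inter> N = {}" using ab \<open>{z, b} = {a, c}\<close>
    by (metis doubleton_eq_iff open_segment_commute)
qed

lemma edges_eq_if_two_common_points:
  assumes z: "z \<in> N" and E: "closed_segment z b \<in> edges_of N K" "closed_segment z b' \<in> edges_of N L"
    and p: "p \<noteq> z" "p \<in> closed_segment z b" "p \<in> closed_segment z b'"
  shows "closed_segment z b = closed_segment z b'"
proof (rule segments_eq_if_two_common_points[where p=p and q=z])
  note e = edge_facts[OF E(1) z] edge_facts[OF E(2) z]
  show "z \<notin> open_segment z b'" "z \<notin> open_segment z b" by (auto simp: open_segment_def)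
  show "b \<notin> open_segment z b'" "b' \<notin> open_segment z b" using e by blast+
  show "z \<noteq> b" "z \<noteq> b'" using e by auto
qed (use p in auto)

lemma edge_at_node_exists:
  assumes "z \<in> N" "K \<in> \<K>" "z \<in> K"
  obtains b where "closed_segment z b \<in> edges_of N K"
proof -
  have "z \<in> \<Union>(edges_of N K)" using node_in_frontier[OF assms] frontier_edges assms by simp
  then obtain E where "E \<in> edges_of N K" "z \<in> E" by blast
  then show ?thesis using edge_at_nodeE assms(1) that by metis
qed

lemma edge_length:
  assumes "K \<in> \<K>" "z \<in> N" "closed_segment z b \<in> edges_of N K"
  shows "diameter K \<le> \<kappa> * dist z b" "dist z b \<le> diameter K" "0 < dist z b"
proof -
  have "diameter K \<le> \<kappa> * diameter (closed_segment z b)" using reg assms by (auto simp: regular_mesh_def)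
  then show "diameter K \<le> \<kappa> * dist z b" by (simp only: diameter_closed_segment)
  have "closed_segment z b \<subseteq> K" using edge_facts(1)[OF assms(3,2)] frontier_element_subset assms by blast
  then show "dist z b \<le> diameter K" using diameter_element_le[OF assms(1)] by auto
  show "0 < dist z b" using edge_facts(3)[OF assms(3,2)] by simp
qed

text \<open>The star disc fits into the element, so its diameter \<open>2 * \<rho>\<close> is at
  most \<open>\<sigma> * \<rho>\<close>; an edge fits into the element, so its length is at most
  \<open>\<kappa>\<close> times itself. For smaller parameters no regular mesh has a node.\<close>

lemma parameters:
  assumes "z \<in> N" shows "2 \<le> \<sigma>" "1 \<le> \<kappa>"
proof -
  obtain K where K: "K \<in> \<K>" "z \<in> K" using assms mesh(4) frontier_element_subset by blast
  obtain \<rho> where r: "0 < \<rho>" "diameter K \<le> \<sigma> * \<rho>" "2 * \<rho> \<le> diameter K" using element_star[OF K(1)] by metis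
  then have "2 * \<rho> \<le> \<sigma> * \<rho>" by linarith
  then show "2 \<le> \<sigma>" using r(1) by simp
  obtain b where b: "closed_segment z b \<in> edges_of N K" using edge_at_node_exists assms K by blast
  note l = edge_length[OF K(1) assms b]
  have "1 * dist z b \<le> \<kappa> * dist z b" using l(1,2) unfolding mult_1 by linarith
  then show "1 \<le> \<kappa>" using l(3) by (rule mult_right_le_imp_le)
qed

text \<open>A point \<open>p\<close> common to a selected and an unselected element, close to
  \<open>z\<close> but different from it, lies on the frontier of both, hence on an edge of each
  through \<open>z\<close>. These edges share \<open>z\<close> and \<open>p\<close> and so coincide.
  Puncturing the neighbourhood is essential, because \<open>z\<close> itself belongs to all these
  elements.\<close>

lemma elements_linked_by_edge:
  assumes z: "z \<in> N" and \<A>: "\<A> \<subseteq> {K\<in>\<K>. z \<in> K}" "\<A> \<noteq> {}" "\<A> \<noteq> {K\<in>\<K>. z \<in> K}"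
  obtains A B b where "A \<in> \<A>" "B \<in> {K\<in>\<K>. z \<in> K} - \<A>"
    "closed_segment z b \<in> edges_of N A" "closed_segment z b \<in> edges_of N B"
proof -
  let ?Z = "{K\<in>\<K>. z \<in> K}"
  \<comment> \<open>The elements and edges not containing \<open>z\<close> form a closed set that
    misses \<open>z\<close>; inside a small ball only those through \<open>z\<close> occur.\<close>
  define X where "X = \<Union>{K\<in>\<K>. z \<notin> K} \<union> \<Union>{E \<in> (\<Union>K\<in>\<K>. edges_of N K). z \<notin> E}"
  have fe: "finite (edges_of N K)" for K
  proof (rule finite_subset)
    show "edges_of N K \<subseteq> (\<lambda>(a, b). closed_segment a b) ` (N \<times> N)"
      by (auto simp: edges_of_def nodes_of_def)
  qed (use mesh in simp)
  have cle: "closed E" if "E \<in> edges_of N K" for E K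
    using that by (auto simp: edges_of_def)
  have "closed X" unfolding X_def
  proof (intro closed_Un closed_Union ballI)
    show "finite {K\<in>\<K>. z \<notin> K}" "finite {E \<in> (\<Union>K\<in>\<K>. edges_of N K). z \<notin> E}" using mesh fe by simp_all
  next
    fix K assume "K \<in> {K\<in>\<K>. z \<notin> K}"
    then show "closed K" using compact_element compact_imp_closed by blast
  next
    fix E assume "E \<in> {E \<in> (\<Union>K\<in>\<K>. edges_of N K). z \<notin> E}"
    then show "closed E" using cle by blast
  qed
  moreover have "z \<notin> X" by (auto simp: X_def)
  ultimately obtain e where e: "0 < e" "ball z e \<subseteq> - X" using openE[of "- X" z] open_Compl by blast
  have "z \<in> closure \<Omega>"
    using z mesh(3,4) frontier_element_subset by blast
  then obtain d where d: "0 < d" "d \<le> e" "connected (\<Omega> \<inter> ball z d - {z})"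
    using polygonal_domain_locally_connected[OF dom _ e(1)] by metis
  let ?U = "\<Omega> \<inter> ball z d - {z}"
  have dX: "ball z d \<inter> X = {}" using e(2) d(2) subset_ball[of d e z] by blast
  have cover: "?U \<subseteq> \<Union>\<A> \<union> \<Union>(?Z - \<A>)"
  proof
    fix p assume p: "p \<in> ?U"
    then have "p \<in> \<Union>\<K>" using mesh(3) closure_subset by blast
    then obtain K where "K \<in> \<K>" "p \<in> K" by blast
    moreover have "p \<notin> X" using p dX by blast
    ultimately have "z \<in> K" by (auto simp: X_def)
    then show "p \<in> \<Union>\<A> \<union> \<Union>(?Z - \<A>)" using \<open>K \<in> \<K>\<close> \<open>p \<in> K\<close> by blast
  qed
  have meets: "K \<inter> ?U \<noteq> {}" if K: "K \<in> ?Z" for K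
  proof -
    have "z \<in> closure (interior K)" using K element_subset_closure_interior by blast
    then have "interior K \<inter> ball z d \<noteq> {}"
      using open_Int_closure_eq_empty[of "ball z d" "interior K"] d(1) by (metis Int_commute IntI centre_in_ball empty_iff open_ball)
    moreover have "interior K \<subseteq> closure \<Omega>" using K mesh(3) interior_subset by blast
    ultimately have "(interior K \<inter> ball z d) \<inter> closure \<Omega> \<noteq> {}" by blast
    then have "(interior K \<inter> ball z d) \<inter> \<Omega> \<noteq> {}"
      using open_Int_closure_eq_empty[OF open_Int[OF open_interior open_ball]] by metis
    moreover have "z \<notin> interior K" using node_in_frontier[OF z] K by (auto simp: frontier_def)
    ultimately show ?thesis using interior_subset by blast
  qed
  \<comment> \<open>Selected and unselected elements form two closed sets that cover the connected
    set \<open>?U\<close> and both meet it, so they meet each other within it.\<close>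
  have "\<exists>p. p \<in> \<Union>\<A> \<inter> \<Union>(?Z - \<A>) \<inter> ?U"
  proof (rule ccontr)
    assume no: "\<not> ?thesis"
    have fin: "finite ?Z" using mesh by simp
    have "closed (\<Union>\<A>)" "closed (\<Union>(?Z - \<A>))"
      using \<A> fin compact_element compact_imp_closed by (auto intro!: closed_Union intro: finite_subset)
    moreover have "\<Union>\<A> \<inter> ?U \<noteq> {}" using meets \<A> by blast
    moreover have "\<Union>(?Z - \<A>) \<inter> ?U \<noteq> {}" using meets \<A> by blast
    moreover have "\<Union>\<A> \<inter> \<Union>(?Z - \<A>) \<inter> ?U = {}" using no by blast
    ultimately have "\<not> connected ?U" unfolding connected_closed using cover by blast
    then show False using d(3) by blast
  qed
  then obtain p A B where p: "A \<in> \<A>" "B \<in> ?Z - \<A>" "p \<in> A" "p \<in> B" "p \<in> ball z d" "p \<noteq> z" by blast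
  have AB: "A \<in> \<K>" "B \<in> \<K>" "A \<noteq> B" using p \<A>(1) by auto
  have edge: "\<exists>b. closed_segment z b \<in> edges_of N K \<and> p \<in> closed_segment z b"
    if K: "K \<in> \<K>" "p \<in> frontier K" for K
  proof -
    obtain E where E: "E \<in> edges_of N K" "p \<in> E" using K frontier_edges by blast
    have "p \<notin> X" using p(5) dX by blast
    then have "z \<in> E" using E K by (auto simp: X_def)
    then show ?thesis using edge_at_nodeE[OF E(1) _ z] E by metis
  qed
  obtain b where b: "closed_segment z b \<in> edges_of N A" "p \<in> closed_segment z b"
    using edge[OF AB(1)] common_point_in_frontier AB p by blast
  obtain b' where b': "closed_segment z b' \<in> edges_of N B" "p \<in> closed_segment z b'"
    using edge[OF AB(2)] common_point_in_frontier[of B A] AB p by blast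
  have "closed_segment z b = closed_segment z b'"
    using edges_eq_if_two_common_points[OF z b(1) b'(1) p(6) b(2) b'(2)] .
  then have "closed_segment z b \<in> edges_of N B" using b'(1) by metis
  then show ?thesis using that p(1,2) b(1) by blast
qed

section \<open>Auxiliary triangles at a node\<close>

lemma tri_subset_element:
  assumes K: "K \<in> \<K>" and z: "z \<in> N" "closed_segment z b \<in> edges_of N K"
  shows "tri ctr z K b \<subseteq> K" "tri ctr z K b = (\<Union>x\<in>closed_segment z b. closed_segment (ctr K) x)"
proof -
  have "tri ctr z K b = convex hull (insert (ctr K) {z, b})" by (simp add: tri_def insert_commute)
  also have "\<dots> = (\<Union>x\<in>closed_segment z b. closed_segment (ctr K) x)"
    by (subst convex_hull_insert_segments) (simp add: segment_convex_hull)
  finally show eq: "tri ctr z K b = (\<Union>x\<in>closed_segment z b. closed_segment (ctr K) x)" .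
  obtain \<rho> where "star_shaped_wrt_disc K (ctr K) \<rho>" "0 < \<rho>" using element_star[OF K] by metis
  moreover have "closed_segment z b \<subseteq> K" using edge_facts(1)[OF z(2,1)] frontier_element_subset K by blast
  ultimately show "tri ctr z K b \<subseteq> K" unfolding eq star_shaped_wrt_disc_def by fastforce
qed

lemma tri_height:
  assumes K: "K \<in> \<K>" and z: "z \<in> N" "closed_segment z b \<in> edges_of N K"
    and r: "star_shaped_wrt_disc K (ctr K) \<rho>"
  shows "\<rho> * dist z b \<le> \<bar>cross2 (b - z) (ctr K - z)\<bar>" "\<rho> \<le> dist z (ctr K)"
proof -
  have cl: "closed K" using compact_element[OF K] compact_imp_closed by blast
  note e = edge_facts[OF z(2,1)]
  show "\<rho> * dist z b \<le> \<bar>cross2 (b - z) (ctr K - z)\<bar>"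
    by (rule height_over_frontier_edge[OF cl r e(3,1)])
  show "\<rho> \<le> dist z (ctr K)"
    using line_of_frontier_edge_misses_disc[OF cl r e(3,1), of 0] by simp
qed

lemma tri_star_cell:
  assumes K: "K \<in> \<K>" and z: "z \<in> N" "closed_segment z b \<in> edges_of N K"
  shows "star_cell (8 * \<kappa> * \<sigma> * (1 + \<sigma>)) (tri ctr z K b)"
    "dist z b \<le> diameter (tri ctr z K b)" "dist z (ctr K) \<le> diameter (tri ctr z K b)"
    "diameter (tri ctr z K b) \<le> diameter K"
proof -
  obtain \<rho> where r: "star_shaped_wrt_disc K (ctr K) \<rho>" "0 < \<rho>" "diameter K \<le> \<sigma> * \<rho>" "ctr K \<in> K"
    "2 * \<rho> \<le> diameter K" using element_star[OF K] by metis
  note e = edge_facts[OF z(2,1)] and l = edge_length[OF K z]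
  have bK: "bounded K" using compact_element[OF K] compact_imp_bounded by blast
  show d: "diameter (tri ctr z K b) \<le> diameter K"
    by (rule diameter_subset[OF tri_subset_element(1)[OF K z] bK])
  have bT: "bounded (tri ctr z K b)" using tri_subset_element(1)[OF K z] bK bounded_subset by blast
  have mem: "z \<in> tri ctr z K b" "b \<in> tri ctr z K b" "ctr K \<in> tri ctr z K b"
    unfolding tri_def by (auto intro: hull_inc)
  show "dist z b \<le> diameter (tri ctr z K b)" "dist z (ctr K) \<le> diameter (tri ctr z K b)"
    using diameter_bounded_bound[OF bT] mem by auto
  have "midpoint z b \<in> K" using e(1) frontier_element_subset[OF K] midpoint_in_closed_segment by blast
  then have "dist (ctr K) (midpoint z b) \<le> diameter K" using diameter_element_le[OF K r(4)] by blast
  then show "star_cell (8 * \<kappa> * \<sigma> * (1 + \<sigma>)) (tri ctr z K b)"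
    unfolding tri_def
    by (intro triangle_star_cell[where h="diameter K" and \<eta>=\<rho>])
      (use e l r d tri_height(1)[OF K z r(1)] in \<open>auto simp: tri_def\<close>)
qed

text \<open>Each triangle lies in its own element, so triangles of distinct elements do not overlap;
  over a common edge their centres are then on opposite sides.\<close>

lemma disc_on_common_edge:
  assumes K: "A \<in> \<K>" "B \<in> \<K>" "A \<noteq> B" and z: "z \<in> N" "closed_segment z b \<in> edges_of N A" "closed_segment z b \<in> edges_of N B"
  shows "ball (midpoint z b) (dist z b / (4 * (1 + \<sigma>))) \<subseteq> tri ctr z A b \<union> tri ctr z B b"
proof -
  have key: "\<exists>\<rho>>0. dist (ctr K) (midpoint z b) \<le> diameter K \<and> dist z b \<le> diameter K \<and> diameter K \<le> \<sigma> * \<rho> \<and>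
      \<rho> * dist z b \<le> \<bar>cross2 (b - z) (ctr K - midpoint z b)\<bar>"
    if K: "K \<in> \<K>" "closed_segment z b \<in> edges_of N K" for K
  proof -
    obtain \<rho> where r: "star_shaped_wrt_disc K (ctr K) \<rho>" "0 < \<rho>" "diameter K \<le> \<sigma> * \<rho>" "ctr K \<in> K"
      using element_star[OF K(1)] by metis
    have "midpoint z b \<in> K"
      using edge_facts(1)[OF K(2) z(1)] frontier_element_subset[OF K(1)] midpoint_in_closed_segment by blast
    then have "dist (ctr K) (midpoint z b) \<le> diameter K" using diameter_element_le[OF K(1) r(4)] by blast
    then show ?thesis
      using r edge_length[OF K(1) z(1) K(2)] tri_height(1)[OF K(1) z(1) K(2) r(1)] cross2_midpoint[of b z "ctr K"]
      by (intro exI[of _ \<rho>]) auto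
  qed
  obtain \<rho>A where A: "dist (ctr A) (midpoint z b) \<le> diameter A" "dist z b \<le> diameter A" "0 < \<rho>A" "diameter A \<le> \<sigma> * \<rho>A"
      "\<rho>A * dist z b \<le> \<bar>cross2 (b - z) (ctr A - midpoint z b)\<bar>" using key[OF K(1) z(2)] by blast
  obtain \<rho>B where B: "dist (ctr B) (midpoint z b) \<le> diameter B" "dist z b \<le> diameter B" "0 < \<rho>B" "diameter B \<le> \<sigma> * \<rho>B"
      "\<rho>B * dist z b \<le> \<bar>cross2 (b - z) (ctr B - midpoint z b)\<bar>" using key[OF K(2) z(3)] by blast
  have "interior (tri ctr z A b) \<inter> interior (tri ctr z B b) = {}"
    using interiors_disjoint[OF K] interior_mono[OF tri_subset_element(1)[OF K(1) z(1,2)]]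
      interior_mono[OF tri_subset_element(1)[OF K(2) z(1,3)]] by blast
  then show ?thesis unfolding tri_def
    using disc_subset_adjacent_triangles[OF edge_facts(3)[OF z(2,1)] A B] by blast
qed

text \<open>A ray from the centre meets the frontier once, so a common point other than the centre
  lies below a common point of the two edges, and that can only be \<open>z\<close>. The triangles
  thus share only the spoke from the centre to \<open>z\<close>, which has empty interior.\<close>

lemma tri_interiors_disjoint_same_element:
  assumes K: "K \<in> \<K>" and z: "z \<in> N" "closed_segment z b \<in> edges_of N K" "closed_segment z b' \<in> edges_of N K"
    and ne: "closed_segment z b \<noteq> closed_segment z b'"
  shows "interior (tri ctr z K b) \<inter> interior (tri ctr z K b') = {}"
proof -
  let ?m = "ctr K"
  obtain \<rho> where r: "star_shaped_wrt_disc K ?m \<rho>" "0 < \<rho>" "?m \<in> K" using element_star[OF K] by metis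
  \<comment> \<open>If \<open>s < s'\<close>, then \<open>p'\<close> lies strictly before the point
    \<open>p\<close> of \<open>K\<close> on the same ray from the centre, hence in the
    interior.\<close>
  have far: "\<not> s < s'" if s: "0 < s" "s \<le> 1" "0 < s'" "s' \<le> 1" and p: "p \<in> K" "p' \<in> frontier K"
    and eq: "?m + s *\<^sub>R (p - ?m) = ?m + s' *\<^sub>R (p' - ?m)" for s s' p p'
  proof
    assume "s < s'"
    define t where "t = 1 - s / s'"
    have t: "0 < t" "t \<le> 1" using \<open>s < s'\<close> s by (auto simp: t_def)
    have "s *\<^sub>R (p - ?m) = s' *\<^sub>R (p' - ?m)" using eq by simp
    then have "(1 / s') *\<^sub>R s *\<^sub>R (p - ?m) = (1 / s') *\<^sub>R s' *\<^sub>R (p' - ?m)" by simp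
    then have "p' - ?m = (s / s') *\<^sub>R (p - ?m)" using s by simp
    then have "p' = ?m + (1 - t) *\<^sub>R (p - ?m)" by (simp add: t_def algebra_simps)
    then have "p' = p + t *\<^sub>R (?m - p)" by (simp add: algebra_simps)
    then have "p' \<in> interior K" using star_shaped_interior[OF r(1) p(1) t] by simp
    then show False using p(2) by (simp add: frontier_def)
  qed
  have "tri ctr z K b \<inter> tri ctr z K b' \<subseteq> closed_segment ?m z"
  proof
    fix x assume "x \<in> tri ctr z K b \<inter> tri ctr z K b'"
    then obtain p p' where p: "p \<in> closed_segment z b" "x \<in> closed_segment ?m p" "p' \<in> closed_segment z b'" "x \<in> closed_segment ?m p'"
      unfolding tri_subset_element(2)[OF K z(1,2)] tri_subset_element(2)[OF K z(1,3)] by blast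
    have pf: "p \<in> frontier K" "p' \<in> frontier K" using p edge_facts(1)[OF z(2,1)] edge_facts(1)[OF z(3,1)] by auto
    then have pK: "p \<in> K" "p' \<in> K" using frontier_element_subset[OF K] by auto
    show "x \<in> closed_segment ?m z"
    proof (cases "x = ?m")
      case False
      obtain s s' where s: "0 \<le> s" "s \<le> 1" "x = (1 - s) *\<^sub>R ?m + s *\<^sub>R p" "0 \<le> s'" "s' \<le> 1" "x = (1 - s') *\<^sub>R ?m + s' *\<^sub>R p'"
        using p by (auto simp: in_segment)
      have x: "x = ?m + s *\<^sub>R (p - ?m)" "x = ?m + s' *\<^sub>R (p' - ?m)"
        by (simp add: s(3) algebra_simps, simp add: s(6) algebra_simps)
      have "s \<noteq> 0" "s' \<noteq> 0" using x False by auto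
      then have "s = s'"
        using far[of s s' p p'] far[of s' s p' p] s pK pf x by fastforce
      then have "s *\<^sub>R (p - ?m) = s *\<^sub>R (p' - ?m)" using x by (metis add_left_cancel)
      then have "p = p'" using \<open>s \<noteq> 0\<close> by simp
      then have "p = z"
        using edges_eq_if_two_common_points[OF z] p ne by blast
      then show ?thesis using p(2) by simp
    qed simp
  qed
  then have "interior (tri ctr z K b \<inter> tri ctr z K b') \<subseteq> interior (closed_segment ?m z)" by (rule interior_mono)
  then show ?thesis by (simp add: interior_closed_segment_ge2)
qed

text \<open>The triangles are viewed over the spoke as base, with apexes \<open>b\<close> and
  \<open>b'\<close>. Twice the area does not depend on the base: it is at least
  \<open>\<rho>\<close> times the edge length, and the edge length is at least
  \<open>diameter K / \<kappa>\<close>. The height over the spoke is then at least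
  \<open>\<rho> / \<kappa>\<close>, so \<open>\<kappa> * \<sigma>\<close> takes the place of
  \<open>\<sigma>\<close>.\<close>

lemma disc_on_common_spoke:
  assumes K: "K \<in> \<K>" and z: "z \<in> N" "closed_segment z b \<in> edges_of N K" "closed_segment z b' \<in> edges_of N K"
    and ne: "closed_segment z b \<noteq> closed_segment z b'"
  shows "ball (midpoint z (ctr K)) (dist z (ctr K) / (4 * (1 + \<kappa> * \<sigma>))) \<subseteq> tri ctr z K b \<union> tri ctr z K b'"
proof -
  let ?m = "ctr K"
  obtain \<rho> where r: "star_shaped_wrt_disc K ?m \<rho>" "0 < \<rho>" "?m \<in> K" "diameter K \<le> \<sigma> * \<rho>" "2 * \<rho> \<le> diameter K"
    using element_star[OF K] by metis
  have par: "2 \<le> \<sigma>" "1 \<le> \<kappa>" using parameters[OF z(1)] by auto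
  have zK: "z \<in> K" using edge_facts(1)[OF z(2,1)] frontier_element_subset[OF K] by auto
  have "closed_segment ?m z \<subseteq> K" using r zK by (auto simp: star_shaped_wrt_disc_def)
  then have mid: "midpoint z ?m \<in> K" by (metis closed_segment_commute midpoint_in_closed_segment subsetD)
  have zm: "dist z ?m \<le> diameter K" using diameter_element_le[OF K zK r(3)] .
  have nezm: "z \<noteq> ?m" using tri_height(2)[OF K z(1,2) r(1)] r(2) by auto
  have key: "dist c (midpoint z ?m) \<le> diameter K" "\<rho> / \<kappa> * dist z ?m \<le> \<bar>cross2 (?m - z) (c - midpoint z ?m)\<bar>"
    if c: "closed_segment z c \<in> edges_of N K" for c
  proof -
    have "c \<in> K" using edge_facts(1)[OF c z(1)] frontier_element_subset[OF K] by auto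
    then show "dist c (midpoint z ?m) \<le> diameter K" using diameter_element_le[OF K _ mid] by blast
    have "\<rho> / \<kappa> * dist z ?m \<le> \<rho> / \<kappa> * diameter K" using zm r par by (intro mult_left_mono) auto
    also have "\<dots> \<le> \<rho> / \<kappa> * (\<kappa> * dist z c)" using edge_length(1)[OF K z(1) c] r par by (intro mult_left_mono) auto
    also have "\<dots> = \<rho> * dist z c" using par by simp
    also have "\<dots> \<le> \<bar>cross2 (c - z) (?m - z)\<bar>" by (rule tri_height(1)[OF K z(1) c r(1)])
    also have "\<dots> = \<bar>cross2 (?m - z) (c - z)\<bar>" by (simp add: cross2_skew[of "c - z"])
    finally show "\<rho> / \<kappa> * dist z ?m \<le> \<bar>cross2 (?m - z) (c - midpoint z ?m)\<bar>" by (simp add: cross2_midpoint)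
  qed
  have s: "0 < \<rho> / \<kappa>" "diameter K \<le> (\<kappa> * \<sigma>) * (\<rho> / \<kappa>)" using r par by auto
  have hull: "convex hull {z, ?m, c} = tri ctr z K c" for c by (simp add: tri_def insert_commute)
  show ?thesis
    using disc_subset_adjacent_triangles[OF nezm key(1)[OF z(2)] zm s key(2)[OF z(2)] key(1)[OF z(3)] zm s key(2)[OF z(3)]]
      tri_interiors_disjoint_same_element[OF assms] unfolding hull by blast
qed

end

text \<open>One ratio must serve both kinds of links. Across an edge the diameter is at most
  \<open>\<kappa>\<close> times the edge length, and the disc radius is that length over
  \<open>4 * (1 + \<sigma>)\<close>. Across a spoke the factors are \<open>\<sigma>\<close> and
  \<open>4 * (1 + \<kappa> * \<sigma>)\<close>.\<close>

lemma link_ratio: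
  fixes \<sigma> \<kappa> :: real
  assumes "2 \<le> \<sigma>" "1 \<le> \<kappa>"
  defines "\<theta> \<equiv> 1 / (4 * \<kappa> * \<sigma> * (1 + \<kappa> * \<sigma>))"
  shows "0 < \<theta>" "\<theta> \<le> 1" "\<theta> * \<kappa> \<le> 1 / (4 * (1 + \<sigma>))" "\<theta> * \<sigma> \<le> 1 / (4 * (1 + \<kappa> * \<sigma>))"
proof -
  have \<sigma>: "\<sigma> > 0" and \<kappa>: "\<kappa> > 0" using assms by auto
  have ks: "2 \<le> \<kappa> * \<sigma>" using mult_mono[of 1 \<kappa> 2 \<sigma>] assms by simp
  have p: "0 < 1 + \<kappa> * \<sigma>" using ks by linarith
  show "0 < \<theta>" unfolding \<theta>_def using \<sigma> \<kappa> p by simp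
  have "1 * 1 \<le> (4 * \<kappa> * \<sigma>) * (1 + \<kappa> * \<sigma>)" using ks by (intro mult_mono) auto
  then show "\<theta> \<le> 1" unfolding \<theta>_def using \<sigma> \<kappa> p by (simp add: divide_le_eq)
  have "\<theta> * \<kappa> = 1 / (4 * (\<sigma> * (1 + \<kappa> * \<sigma>)))" using \<kappa> by (simp add: \<theta>_def)
  also have "\<dots> \<le> 1 / (4 * (1 + \<sigma>))"
  proof (intro divide_left_mono mult_left_mono)
    have "1 * 2 \<le> (\<kappa> * \<sigma>) * \<sigma>" using ks assms by (intro mult_mono) auto
    then show "1 + \<sigma> \<le> \<sigma> * (1 + \<kappa> * \<sigma>)" by (simp add: algebra_simps)
  qed (use \<sigma> p in auto)
  finally show "\<theta> * \<kappa> \<le> 1 / (4 * (1 + \<sigma>))" .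
  have "\<theta> * \<sigma> = 1 / (4 * (\<kappa> * (1 + \<kappa> * \<sigma>)))" using \<sigma> by (simp add: \<theta>_def)
  also have "\<dots> \<le> 1 / (4 * (1 + \<kappa> * \<sigma>))"
  proof (intro divide_left_mono mult_left_mono)
    show "1 + \<kappa> * \<sigma> \<le> \<kappa> * (1 + \<kappa> * \<sigma>)" using mult_right_mono[OF assms(2), of "1 + \<kappa> * \<sigma>"] p by simp
  qed (use \<kappa> p in auto)
  finally show "\<theta> * \<sigma> \<le> 1 / (4 * (1 + \<kappa> * \<sigma>))" .
qed

section \<open>Links between neighbouring cells at a node\<close>

context regular_polygonal_mesh begin

definition "\<theta> = 1 / (4 * \<kappa> * \<sigma> * (1 + \<kappa> * \<sigma>))"

text \<open>\<open>A'\<close> and \<open>B'\<close> may be the elements or their triangles at the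
  edge, so both patches use the same link. The disc is covered by the two triangles in either
  case.\<close>

lemma linked_across_edge:
  assumes K: "A \<in> \<K>" "B \<in> \<K>" "A \<noteq> B" and z: "z \<in> N" "closed_segment z b \<in> edges_of N A" "closed_segment z b \<in> edges_of N B"
    and A: "tri ctr z A b \<subseteq> A'" "A' \<in> \<C>" "diameter (tri ctr z A b) \<le> diameter A'"
    and B: "tri ctr z B b \<subseteq> B'" "B' \<in> \<C>" "diameter (tri ctr z B b) \<le> diameter B'" "diameter B' \<le> diameter B"
  shows "linked \<theta> (interior (\<Union>\<C>)) A' B'"
  unfolding linked_def
proof (intro exI conjI)
  let ?r = "dist z b / (4 * (1 + \<sigma>))"
  have par: "2 \<le> \<sigma>" "1 \<le> \<kappa>" using parameters[OF z(1)] by auto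
  note l = edge_length[OF K(2) z(1,3)]
  have "midpoint z b \<in> closed_segment z b" by simp
  moreover have "closed_segment z b \<subseteq> tri ctr z K b" for K
    unfolding tri_def segment_convex_hull by (rule hull_mono) auto
  ultimately show "midpoint z b \<in> A' \<inter> B'" using A B by blast
  show "0 < ?r" using l par by simp
  show "ball (midpoint z b) ?r \<subseteq> interior (\<Union>\<C>)"
  proof (rule interior_maximal[OF _ open_ball])
    have "tri ctr z A b \<union> tri ctr z B b \<subseteq> \<Union>\<C>" using A(1,2) B(1,2) by blast
    then show "ball (midpoint z b) ?r \<subseteq> \<Union>\<C>" using disc_on_common_edge[OF K z] by (rule order.trans[rotated])
  qed
  have "dist z b \<le> 4 * (1 + \<sigma>) * dist z b" using l par by (simp add: mult_le_cancel_right1)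
  then have r: "?r \<le> dist z b" using par by (simp add: divide_le_eq mult.commute)
  then show "?r \<le> diameter A'" using tri_star_cell(2)[OF K(1) z(1,2)] A by linarith
  show "?r \<le> diameter B'" using r tri_star_cell(2)[OF K(2) z(1,3)] B by linarith
  have th: "0 < \<theta>" "\<theta> * \<kappa> \<le> 1 / (4 * (1 + \<sigma>))" using link_ratio[OF par] by (simp_all add: \<theta>_def)
  have "\<theta> * diameter B' \<le> \<theta> * (\<kappa> * dist z b)" using th(1) l(1) B(4) by (intro mult_left_mono) auto
  also have "\<dots> = (\<theta> * \<kappa>) * dist z b" by simp
  also have "\<dots> \<le> 1 / (4 * (1 + \<sigma>)) * dist z b" using th(2) by (intro mult_right_mono) auto
  finally show "\<theta> * diameter B' \<le> ?r" by simp
qed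

text \<open>The spoke is at least as long as the star radius, so the diameter of a triangle is at
  most \<open>\<sigma>\<close> times the length of the spoke.\<close>

lemma linked_across_spoke:
  assumes K: "K \<in> \<K>" and z: "z \<in> N" "closed_segment z b \<in> edges_of N K" "closed_segment z b' \<in> edges_of N K"
    and ne: "closed_segment z b \<noteq> closed_segment z b'"
    and C: "tri ctr z K b \<in> \<C>" "tri ctr z K b' \<in> \<C>"
  shows "linked \<theta> (interior (\<Union>\<C>)) (tri ctr z K b) (tri ctr z K b')"
  unfolding linked_def
proof (intro exI conjI)
  let ?r = "dist z (ctr K) / (4 * (1 + \<kappa> * \<sigma>))"
  have par: "2 \<le> \<sigma>" "1 \<le> \<kappa>" using parameters[OF z(1)] by auto
  have ks: "0 < \<kappa> * \<sigma>" using par by simp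
  obtain \<rho> where r: "star_shaped_wrt_disc K (ctr K) \<rho>" "0 < \<rho>" "diameter K \<le> \<sigma> * \<rho>" using element_star[OF K] by metis
  have zm: "\<rho> \<le> dist z (ctr K)" by (rule tri_height(2)[OF K z(1,2) r(1)])
  have zm0: "0 < dist z (ctr K)" using zm r by linarith
  have "midpoint z (ctr K) \<in> closed_segment z (ctr K)" by simp
  moreover have "closed_segment z (ctr K) \<subseteq> tri ctr z K b" for b
    unfolding tri_def segment_convex_hull by (rule hull_mono) auto
  ultimately show "midpoint z (ctr K) \<in> tri ctr z K b \<inter> tri ctr z K b'" by blast
  show "0 < ?r" using zm0 ks by (intro divide_pos_pos) auto
  show "ball (midpoint z (ctr K)) ?r \<subseteq> interior (\<Union>\<C>)"
  proof (rule interior_maximal[OF _ open_ball])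
    have "tri ctr z K b \<union> tri ctr z K b' \<subseteq> \<Union>\<C>" using C by blast
    then show "ball (midpoint z (ctr K)) ?r \<subseteq> \<Union>\<C>" using disc_on_common_spoke[OF K z ne] by (rule order.trans[rotated])
  qed
  have "dist z (ctr K) \<le> 4 * (1 + \<kappa> * \<sigma>) * dist z (ctr K)" using zm0 ks by (simp add: mult_le_cancel_right1)
  then have r': "?r \<le> dist z (ctr K)" using ks by (simp add: divide_le_eq mult.commute)
  then show "?r \<le> diameter (tri ctr z K b)" using tri_star_cell(3)[OF K z(1,2)] by linarith
  show "?r \<le> diameter (tri ctr z K b')" using r' tri_star_cell(3)[OF K z(1,3)] by linarith
  have th: "0 < \<theta>" "\<theta> * \<sigma> \<le> 1 / (4 * (1 + \<kappa> * \<sigma>))" using link_ratio[OF par] by (simp_all add: \<theta>_def)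
  have "\<sigma> * \<rho> \<le> \<sigma> * dist z (ctr K)" using zm par by (intro mult_left_mono) auto
  then have "diameter (tri ctr z K b') \<le> \<sigma> * dist z (ctr K)" using tri_star_cell(4)[OF K z(1,3)] r(3) by linarith
  then have "\<theta> * diameter (tri ctr z K b') \<le> \<theta> * (\<sigma> * dist z (ctr K))" using th(1) by (intro mult_left_mono) auto
  also have "\<dots> = (\<theta> * \<sigma>) * dist z (ctr K)" by simp
  also have "\<dots> \<le> 1 / (4 * (1 + \<kappa> * \<sigma>)) * dist z (ctr K)" using th(2) by (intro mult_right_mono) auto
  finally show "\<theta> * diameter (tri ctr z K b') \<le> ?r" by simp
qed

lemma elements_at_node_linked:
  assumes z: "z \<in> N" and \<A>: "\<A> \<subseteq> {K\<in>\<K>. z \<in> K}" "\<A> \<noteq> {}" "\<A> \<noteq> {K\<in>\<K>. z \<in> K}"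
  shows "\<exists>C\<in>\<A>. \<exists>C'\<in>{K\<in>\<K>. z \<in> K} - \<A>. linked \<theta> (interior (\<Union>{K\<in>\<K>. z \<in> K})) C C'"
proof -
  obtain A B b where AB: "A \<in> \<A>" "B \<in> {K\<in>\<K>. z \<in> K} - \<A>"
    "closed_segment z b \<in> edges_of N A" "closed_segment z b \<in> edges_of N B"
    using elements_linked_by_edge[OF assms] by blast
  then have K: "A \<in> \<K>" "B \<in> \<K>" "A \<noteq> B" using \<A> by auto
  have "linked \<theta> (interior (\<Union>{K\<in>\<K>. z \<in> K})) A B"
    by (rule linked_across_edge[OF K z AB(3,4)])
      (use AB \<A> tri_subset_element(1)[OF K(1) z AB(3)] tri_subset_element(1)[OF K(2) z AB(4)]
        tri_star_cell(4)[OF K(1) z AB(3)] tri_star_cell(4)[OF K(2) z AB(4)] in auto)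
  then show ?thesis using AB by blast
qed

text \<open>A triangle that contains \<open>z\<close> has \<open>z\<close> as an endpoint of its
  mesh edge: all its points off that edge are interior to the element, a node never is, and a node
  on an edge is one of its ends.\<close>

lemma triangles_at_node:
  assumes z: "z \<in> N"
  shows "{T \<in> aux_triangulation \<K> N ctr. z \<in> T} = {tri ctr z K b |K b. K \<in> \<K> \<and> closed_segment z b \<in> edges_of N K}"
    (is "?L = ?R")
proof
  have hull: "convex hull (insert (ctr K) (closed_segment z b)) = tri ctr z K b" for K b
    unfolding tri_def segment_convex_hull by (metis hull_insert insert_commute)
  show "?R \<subseteq> ?L"
  proof
    fix T assume "T \<in> ?R"
    then obtain K b where K: "K \<in> \<K>" "closed_segment z b \<in> edges_of N K" "T = tri ctr z K b" by blast
    then have "T \<in> aux_triangulation \<K> N ctr" unfolding aux_triangulation_def hull[symmetric] by blast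
    moreover have "z \<in> T" unfolding K tri_def by (simp add: hull_inc)
    ultimately show "T \<in> ?L" by blast
  qed
  show "?L \<subseteq> ?R"
  proof
    fix T assume "T \<in> ?L"
    then obtain K E where K: "K \<in> \<K>" "E \<in> edges_of N K" "T = convex hull (insert (ctr K) E)" "z \<in> T"
      unfolding aux_triangulation_def by blast
    obtain a c where E: "E = closed_segment a c" "a \<in> N" "closed_segment a c \<subseteq> frontier K"
      using K(2) by (auto simp: edges_of_def nodes_of_def)
    have EK: "E \<subseteq> K" using E frontier_element_subset[OF K(1)] by blast
    obtain \<rho> where r: "star_shaped_wrt_disc K (ctr K) \<rho>" "0 < \<rho>" using element_star[OF K(1)] by metis
    have "T = (\<Union>x\<in>E. closed_segment (ctr K) x)"
      unfolding K(3) E(1) by (subst convex_hull_insert_segments) (simp add: hull_same convex_closed_segment)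
    then obtain x where x: "x \<in> E" "z \<in> closed_segment (ctr K) x" using K(4) by blast
    have "ctr K \<in> cball (ctr K) \<rho>" "x \<in> K" using r(2) x(1) EK by auto
    then have "closed_segment (ctr K) x \<subseteq> K" using r(1) unfolding star_shaped_wrt_disc_def by blast
    then have zK: "z \<in> K" using x by blast
    have zf: "z \<notin> interior K" using node_in_frontier[OF z K(1) zK] by (simp add: frontier_def)
    obtain u where u: "0 \<le> u" "u \<le> 1" "z = (1 - u) *\<^sub>R ctr K + u *\<^sub>R x" using x by (auto simp: in_segment)
    have "u = 1"
    proof (rule ccontr)
      assume "u \<noteq> 1"
      have "x + (1 - u) *\<^sub>R (ctr K - x) \<in> interior K"
        by (rule star_shaped_interior[OF r(1)]) (use x EK u \<open>u \<noteq> 1\<close> in auto)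
      moreover have "x + (1 - u) *\<^sub>R (ctr K - x) = z" using u by (simp add: algebra_simps)
      ultimately show False using zf by simp
    qed
    then have "z \<in> E" using u x by simp
    then obtain b where "E = closed_segment z b" using edge_at_nodeE[OF K(2) _ z] by metis
    then show "T \<in> ?R" using K hull by blast
  qed
qed

lemma triangles_interiors_disjoint:
  assumes z: "z \<in> N" and K: "K \<in> \<K>" "closed_segment z b \<in> edges_of N K" "L \<in> \<K>" "closed_segment z c \<in> edges_of N L"
    and ne: "tri ctr z K b \<noteq> tri ctr z L c"
  shows "interior (tri ctr z K b) \<inter> interior (tri ctr z L c) = {}"
proof (cases "K = L")
  case True
  have "closed_segment z b \<noteq> closed_segment z c"
  proof
    assume "closed_segment z b = closed_segment z c"
    then show False using ne True tri_subset_element(2)[OF K(1) z K(2)] tri_subset_element(2)[OF K(3) z K(4)] by metis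
  qed
  then show ?thesis using tri_interiors_disjoint_same_element[OF K(1) z K(2)] K True by simp
next
  case False
  then show ?thesis
    using interiors_disjoint[OF K(1,3)] interior_mono[OF tri_subset_element(1)[OF K(1) z K(2)]]
      interior_mono[OF tri_subset_element(1)[OF K(3) z K(4)]] by blast
qed

text \<open>Without a link out of the selection, the links across spokes force it to contain all or
  none of the triangles at \<open>z\<close> of each element. It then stems from a proper nonempty
  set of elements, and the edge leading out of that set gives a link between triangles after
  all.\<close>

lemma triangles_at_node_linked:
  assumes z: "z \<in> N"
  defines "\<C> \<equiv> {tri ctr z K b |K b. K \<in> \<K> \<and> closed_segment z b \<in> edges_of N K}"
  assumes \<A>: "\<A> \<subseteq> \<C>" "\<A> \<noteq> {}" "\<A> \<noteq> \<C>"
  shows "\<exists>C\<in>\<A>. \<exists>C'\<in>\<C> - \<A>. linked \<theta> (interior (\<Union>\<C>)) C C'"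
proof (rule ccontr)
  assume no: "\<not> ?thesis"
  have mem: "tri ctr z K b \<in> \<C>" if "K \<in> \<K>" "closed_segment z b \<in> edges_of N K" for K b
    unfolding \<C>_def using that by blast
  have same: "tri ctr z K b' \<in> \<A>"
    if K: "K \<in> \<K>" "closed_segment z b \<in> edges_of N K" "closed_segment z b' \<in> edges_of N K" "tri ctr z K b \<in> \<A>" for K b b'
  proof (cases "closed_segment z b = closed_segment z b'")
    case True
    then show ?thesis using K(4) tri_subset_element(2)[OF K(1) z K(2)] tri_subset_element(2)[OF K(1) z K(3)] by metis
  next
    case False
    from linked_across_spoke[OF K(1) z K(2,3) False mem[OF K(1,2)] mem[OF K(1,3)]]
    show ?thesis using no mem[OF K(1,3)] K(4) by blast
  qed
  define \<A>1 where "\<A>1 = {K\<in>\<K>. z \<in> K \<and> (\<exists>b. closed_segment z b \<in> edges_of N K \<and> tri ctr z K b \<in> \<A>)}"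
  have zK: "z \<in> K" if "K \<in> \<K>" "closed_segment z b \<in> edges_of N K" for K b
    using edge_facts(1)[OF that(2) z] frontier_element_subset[OF that(1)] by auto
  have ne: "\<A>1 \<noteq> {}"
  proof -
    obtain T where T: "T \<in> \<A>" using \<A>(2) by blast
    then have "T \<in> \<C>" using \<A>(1) by blast
    then obtain K b where K: "K \<in> \<K>" "closed_segment z b \<in> edges_of N K" "T = tri ctr z K b"
      unfolding \<C>_def by blast
    then have "K \<in> \<A>1" using T zK[OF K(1,2)] unfolding \<A>1_def by blast
    then show ?thesis by blast
  qed
  have proper: "\<A>1 \<noteq> {K\<in>\<K>. z \<in> K}"
  proof
    assume all: "\<A>1 = {K\<in>\<K>. z \<in> K}"
    obtain T where T: "T \<in> \<C>" "T \<notin> \<A>" using \<A>(1,3) by blast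
    then obtain K b where K: "K \<in> \<K>" "closed_segment z b \<in> edges_of N K" "T = tri ctr z K b"
      unfolding \<C>_def by blast
    then have "K \<in> \<A>1" using all zK[OF K(1,2)] by blast
    then obtain b' where "closed_segment z b' \<in> edges_of N K" "tri ctr z K b' \<in> \<A>" unfolding \<A>1_def by blast
    then have "T \<in> \<A>" using same[OF K(1) _ K(2)] K(3) by blast
    then show False using T by blast
  qed
  have sub: "\<A>1 \<subseteq> {K\<in>\<K>. z \<in> K}" by (auto simp: \<A>1_def)
  obtain A B b where AB: "A \<in> \<A>1" "B \<in> {K\<in>\<K>. z \<in> K} - \<A>1"
    "closed_segment z b \<in> edges_of N A" "closed_segment z b \<in> edges_of N B"
    by (rule elements_linked_by_edge[OF z sub ne proper])
  then have K: "A \<in> \<K>" "B \<in> \<K>" "A \<noteq> B" by (auto simp: \<A>1_def)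
  obtain b' where b': "closed_segment z b' \<in> edges_of N A" "tri ctr z A b' \<in> \<A>"
    using AB(1) unfolding \<A>1_def by blast
  have "tri ctr z A b \<in> \<A>" by (rule same[OF K(1) b'(1) AB(3) b'(2)])
  moreover have "tri ctr z B b \<notin> \<A>" using AB(2,4) unfolding \<A>1_def by blast
  moreover have "linked \<theta> (interior (\<Union>\<C>)) (tri ctr z A b) (tri ctr z B b)"
    by (rule linked_across_edge[OF K z AB(3,4)])
      (use mem[OF K(1) AB(3)] mem[OF K(2) AB(4)] tri_star_cell(4)[OF K(2) z AB(4)] in auto)
  ultimately show False using no mem[OF K(2) AB(4)] by blast
qed

end

section \<open>A uniform constant for both patches\<close>

theorem lemma5:
  fixes \<sigma> \<kappa> :: real
  shows "\<exists>c>0. \<forall>\<Omega> \<K> N ctr.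
    polygonal_domain \<Omega> \<longrightarrow> regular_mesh \<sigma> \<kappa> \<Omega> \<K> N ctr \<longrightarrow>
    (\<forall>z\<in>N.
      (\<forall>v\<in>H1 (node_patch \<K> N z).
         L2_norm (node_patch \<K> N z) (\<lambda>x. v x - mean_value (node_patch \<K> N z) v)
           \<le> c * diameter (node_patch \<K> N z) * H1_seminorm (node_patch \<K> N z) v) \<and>
      (\<forall>v\<in>H1 (triangle_patch \<K> N ctr z).
         L2_norm (triangle_patch \<K> N ctr z) (\<lambda>x. v x - mean_value (triangle_patch \<K> N ctr z) v)
           \<le> c * diameter (triangle_patch \<K> N ctr z) * H1_seminorm (triangle_patch \<K> N ctr z) v))"
proof (cases "2 \<le> \<sigma> \<and> 1 \<le> \<kappa>")
  \<comment> \<open>By \<open>parameters\<close> a regular mesh has no nodes here, so any positive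
    constant will do.\<close>
  case False
  have "z \<notin> N" if "polygonal_domain \<Omega>" "regular_mesh \<sigma> \<kappa> \<Omega> \<K> N ctr" for \<Omega> \<K> N ctr z
  proof
    assume "z \<in> N"
    interpret regular_polygonal_mesh \<sigma> \<kappa> \<Omega> \<K> N ctr by unfold_locales (fact that)+
    show False using parameters[OF \<open>z \<in> N\<close>] False by blast
  qed
  then show ?thesis by (intro exI[of _ 1]) auto
next
  case True
  then have par: "2 \<le> \<sigma>" "1 \<le> \<kappa>" by auto
  define t where "t = 1 / (4 * \<kappa> * \<sigma> * (1 + \<kappa> * \<sigma>))"
  have t: "0 < t" "t \<le> 1" using link_ratio[OF par] by (simp_all add: t_def)
  define s where "s = 8 * \<kappa> * \<sigma> * (1 + \<sigma>)"
  have "2 * 1 \<le> (8 * \<kappa> * \<sigma>) * (1 + \<sigma>)"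
    using par mult_mono[of 1 \<kappa> 2 \<sigma>] by (intro mult_mono) auto
  then have s: "2 \<le> s" by (simp add: s_def)
  define P where "P c \<C> \<longleftrightarrow> (\<forall>v\<in>H1 (interior (\<Union>\<C>)). L2_norm (interior (\<Union>\<C>)) (\<lambda>x. v x - mean_value (interior (\<Union>\<C>)) v)
        \<le> c * diameter (interior (\<Union>\<C>)) * H1_seminorm (interior (\<Union>\<C>)) v)"
    for c :: real and \<C> :: "point set set"
  define Q where "Q r \<C> z \<longleftrightarrow> finite \<C> \<and> \<C> \<noteq> {} \<and> (\<forall>C\<in>\<C>. star_cell r C \<and> z \<in> C) \<and>
     (\<forall>C\<in>\<C>. \<forall>C'\<in>\<C>. C \<noteq> C' \<longrightarrow> interior C \<inter> interior C' = {}) \<and>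
     (\<forall>\<A>\<subseteq>\<C>. \<A> \<noteq> {} \<longrightarrow> \<A> \<noteq> \<C> \<longrightarrow> (\<exists>C\<in>\<A>. \<exists>C'\<in>\<C> - \<A>. linked t (interior (\<Union>\<C>)) C C'))"
    for r :: real and \<C> :: "point set set" and z :: point
  \<comment> \<open>The link ratio \<open>t\<close> is common to both patches. The star ratio
    differs: \<open>\<sigma>\<close> for elements, and the ratio \<open>s\<close> of
    \<open>triangle_star_cell\<close> for triangles.\<close>
  have PQ: "\<exists>c>0. \<forall>\<C> z. Q r \<C> z \<longrightarrow> P c \<C>" if r: "2 \<le> r" for r
    unfolding P_def Q_def imp_conjL by (rule star_cells_poincare[OF r t])
  obtain c1 where c1: "c1 > 0" "\<And>\<C> z. Q \<sigma> \<C> z \<Longrightarrow> P c1 \<C>" using PQ[OF par(1)] by blast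
  obtain c2 where c2: "c2 > 0" "\<And>\<C> z. Q s \<C> z \<Longrightarrow> P c2 \<C>" using PQ[OF s] by blast
  define c where "c = max c1 c2"
  \<comment> \<open>Enlarging the constant requires a nonnegative right-hand side, and the diameter
    is known to be nonnegative for bounded sets.\<close>
  have Pmono: "P c \<C>" if P: "P c' \<C>" and c': "c' \<le> c" and b: "bounded (\<Union>\<C>)" for c' and \<C> :: "point set set"
    unfolding P_def
  proof
    fix v assume "v \<in> H1 (interior (\<Union>\<C>))"
    then have "L2_norm (interior (\<Union>\<C>)) (\<lambda>x. v x - mean_value (interior (\<Union>\<C>)) v)
        \<le> c' * diameter (interior (\<Union>\<C>)) * H1_seminorm (interior (\<Union>\<C>)) v" using P unfolding P_def by blast
    also have "\<dots> \<le> c * diameter (interior (\<Union>\<C>)) * H1_seminorm (interior (\<Union>\<C>)) v"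
    proof (intro mult_right_mono c')
      show "0 \<le> diameter (interior (\<Union>\<C>))" using b bounded_subset interior_subset by (intro diameter_ge_0) blast
    qed (simp add: H1_seminorm_def L2_norm_def)
    finally show "L2_norm (interior (\<Union>\<C>)) (\<lambda>x. v x - mean_value (interior (\<Union>\<C>)) v)
        \<le> c * diameter (interior (\<Union>\<C>)) * H1_seminorm (interior (\<Union>\<C>)) v" .
  qed
  have bQ: "bounded (\<Union>\<C>)" if "Q r \<C> z" for r \<C> z
    using that unfolding Q_def star_cell_def by (auto intro!: bounded_Union compact_imp_bounded)
  have main: "P c {K\<in>\<K>. z \<in> nodes_of N K} \<and> P c {T\<in>aux_triangulation \<K> N ctr. z \<in> T}"
    if asm: "polygonal_domain \<Omega>" "regular_mesh \<sigma> \<kappa> \<Omega> \<K> N ctr" and z: "z \<in> N" for \<Omega> \<K> N ctr z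
  proof -
    interpret regular_polygonal_mesh \<sigma> \<kappa> \<Omega> \<K> N ctr by unfold_locales (fact asm)+
    have \<theta>: "\<theta> = t" by (simp add: \<theta>_def t_def)
    obtain K0 where K0: "K0 \<in> \<K>" "z \<in> K0" using z mesh(4) frontier_element_subset by blast
    have Q1: "Q \<sigma> {K\<in>\<K>. z \<in> K} z"
      unfolding Q_def
    proof (intro conjI ballI allI impI)
      show "{K\<in>\<K>. z \<in> K} \<noteq> {}" using K0 by blast
      fix \<A> assume "\<A> \<subseteq> {K\<in>\<K>. z \<in> K}" "\<A> \<noteq> {}" "\<A> \<noteq> {K\<in>\<K>. z \<in> K}"
      from elements_at_node_linked[OF z this]
      show "\<exists>C\<in>\<A>. \<exists>C'\<in>{K\<in>\<K>. z \<in> K} - \<A>. linked t (interior (\<Union>{K\<in>\<K>. z \<in> K})) C C'"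
        unfolding \<theta> .
    qed (use mesh star_cell_element interiors_disjoint in auto)
    let ?T = "{tri ctr z K b |K b. K \<in> \<K> \<and> closed_segment z b \<in> edges_of N K}"
    have Q2: "Q s ?T z"
      unfolding Q_def
    proof (intro conjI ballI allI impI)
      have "?T \<subseteq> (\<lambda>(K, b). tri ctr z K b) ` (\<K> \<times> N)" using edge_facts(4)[OF _ z] by auto
      then show "finite ?T" by (rule finite_subset) (use mesh in simp)
      obtain b where "closed_segment z b \<in> edges_of N K0" using edge_at_node_exists[OF z K0] by blast
      then show "?T \<noteq> {}" using K0 by blast
    next
      fix C assume "C \<in> ?T"
      then show "star_cell s C" unfolding s_def using tri_star_cell(1) z by blast
    next
      fix C assume "C \<in> ?T"
      then show "z \<in> C" by (auto simp: tri_def hull_inc)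
    next
      fix C C' assume "C \<in> ?T" "C' \<in> ?T" "C \<noteq> C'"
      then show "interior C \<inter> interior C' = {}" using triangles_interiors_disjoint[OF z] by blast
    next
      fix \<A> assume "\<A> \<subseteq> ?T" "\<A> \<noteq> {}" "\<A> \<noteq> ?T"
      from triangles_at_node_linked[OF z this]
      show "\<exists>C\<in>\<A>. \<exists>C'\<in>?T - \<A>. linked t (interior (\<Union>?T)) C C'" unfolding \<theta> .
    qed
    show ?thesis
      unfolding elements_at_node[OF z] triangles_at_node[OF z]
      using Pmono[OF c1(2)[OF Q1] _ bQ[OF Q1]] Pmono[OF c2(2)[OF Q2] _ bQ[OF Q2]] by (simp add: c_def)
  qed
  show ?thesis
  proof (intro exI[of _ c] conjI allI impI ballI)
    show "0 < c" using c1 by (simp add: c_def)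
  qed (use main in \<open>unfold P_def node_patch_def triangle_patch_def, blast+\<close>)
qed

end
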